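(* Let $M$ be a left $D_X$-module and $f\in K[x]$ a nonzero polynomial. Set $\tilde M = B_{Z|Y}[f^{-1}]\otimes_{K[x,f^{-1}]}M[f^{-1}]$ and define $\varphi : M[f^{-1}] \rightarrow \tilde M/\partial_t\tilde M$ by $\varphi(v)=\delta\otimes v \bmod \partial_t\tilde M$ for $v\in M[f^{-1}]$. Then $\varphi$ is an isomorphism of left $D_X[f^{-1}]$-modules, and consequently of left $D_X$-modules.
   Context: $K$ is a field of characteristic zero, $K[x]=K[x_1,\dots,x_n]$, $X=K^n$, $D_X$ is the $n$-th Weyl algebra in $x$, and $D_X[f^{-1}]=K[x,f^{-1}]\otimes_{K[x]}D_X$; $t$ is a new variable, $Y=X\times K$ with coordinates $(x,t)$, $D_Y$ is the Weyl algebra in $(x,t)$ and $D_Y[f^{-1}]=K[x,f^{-1}]\otimes_{K[x]}D_Y$. Put $Z=\{(x,t)\in Y\mid tf(x)=1\}$, $B_{Z|Y}=H^1_{(tf-1)}(K[x,t])=K[x,t,(tf-1)^{-1}]/K[x,t]$ and $B_{Z|Y}[f^{-1}]=B_{Z|Y}\otimes_{K[x]}K[x,f^{-1}]=K[x,t,f^{-1},(tf-1)^{-1}]/K[x,t,f^{-1}]$. Let $\delta\in B_{Z|Y}[f^{-1}]$ be the residue class of $f/(tf-1)$. $M[f^{-1}]=M\otimes_{K[x]}K[x,f^{-1}]$ is a left $D_X[f^{-1}]$-module via the Leibniz rule. On $\tilde M$ the left $D_Y[f^{-1}]$-module structure is: $t,\partial_t$ act on the first factor and $\partial_{x_i}$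 acts by the Leibniz rule; since $D_X[f^{-1}]$ commutes with $\partial_t$, $\tilde M/\partial_t\tilde M$ is a left $D_X[f^{-1}]$-module. *)

theory Defs
  imports
    "HOL-Computational_Algebra.Polynomial_Factorial"
    "HOL-Algebra.Free_Abelian_Groups"
    "HOL-Algebra.QuotRing"
    "HOL-Algebra.Module"
begin

section \<open>Left modules over a (not necessarily commutative) ring\<close>

text \<open>
  The locale \<^locale>\<open>module\<close> of the library assumes a commutative ring of scalars.  As there, a
  module is a record of type \<open>('r, 'm) module\<close>, whose fields \<open>mult\<close> and \<open>one\<close> are irrelevant.
\<close>

locale left_module = R?: ring R + M?: abelian_group M
  for R :: "('r, 'a) ring_scheme" (structure) and M :: "('r, 'm, 'b) module_scheme" (structure) +
  assumes smult_closed: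
      "\<lbrakk>a \<in> carrier R; x \<in> carrier M\<rbrakk> \<Longrightarrow> a \<odot>\<^bsub>M\<^esub> x \<in> carrier M"
    and smult_l_distr:
      "\<lbrakk>a \<in> carrier R; b \<in> carrier R; x \<in> carrier M\<rbrakk> \<Longrightarrow>
        (a \<oplus>\<^bsub>R\<^esub> b) \<odot>\<^bsub>M\<^esub> x = a \<odot>\<^bsub>M\<^esub> x \<oplus>\<^bsub>M\<^esub> b \<odot>\<^bsub>M\<^esub> x"
    and smult_r_distr:
      "\<lbrakk>a \<in> carrier R; x \<in> carrier M; y \<in> carrier M\<rbrakk> \<Longrightarrow>
        a \<odot>\<^bsub>M\<^esub> (x \<oplus>\<^bsub>M\<^esub> y) = a \<odot>\<^bsub>M\<^esub> x \<oplus>\<^bsub>M\<^esub> a \<odot>\<^bsub>M\<^esub> y"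
    and smult_assoc:
      "\<lbrakk>a \<in> carrier R; b \<in> carrier R; x \<in> carrier M\<rbrakk> \<Longrightarrow>
        (a \<otimes>\<^bsub>R\<^esub> b) \<odot>\<^bsub>M\<^esub> x = a \<odot>\<^bsub>M\<^esub> (b \<odot>\<^bsub>M\<^esub> x)"
    and smult_one:
      "x \<in> carrier M \<Longrightarrow> \<one>\<^bsub>R\<^esub> \<odot>\<^bsub>M\<^esub> x = x"

definition left_module_hom ::
    "('r, 'a) ring_scheme \<Rightarrow> ('r, 'm, 'b) module_scheme \<Rightarrow> ('r, 'n, 'c) module_scheme \<Rightarrow> ('m \<Rightarrow> 'n) set"
  where "left_module_hom R A B =
    {h \<in> carrier A \<rightarrow> carrier B.
      (\<forall>x\<in>carrier A. \<forall>y\<in>carrier A. h (x \<oplus>\<^bsub>A\<^esub> y) = h x \<oplus>\<^bsub>B\<^esub> h y) \<and>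
      (\<forall>r\<in>carrier R. \<forall>x\<in>carrier A. h (r \<odot>\<^bsub>A\<^esub> x) = r \<odot>\<^bsub>B\<^esub> h x)}"

definition left_module_iso ::
    "('r, 'a) ring_scheme \<Rightarrow> ('r, 'm, 'b) module_scheme \<Rightarrow> ('r, 'n, 'c) module_scheme \<Rightarrow> ('m \<Rightarrow> 'n) \<Rightarrow> bool"
  where "left_module_iso R A B h \<longleftrightarrow>
    left_module R A \<and> left_module R B \<and> h \<in> left_module_hom R A B \<and> bij_betw h (carrier A) (carrier B)"

definition with_smult :: "('m, 'b) ring_scheme \<Rightarrow> ('r \<Rightarrow> 'm \<Rightarrow> 'm) \<Rightarrow> ('r, 'm) module"
  where "with_smult A act =
    \<lparr>carrier = carrier A, mult = mult A, one = one A, zero = zero A, add = add A,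
     smult = act\<rparr>"

definition regular_module :: "('r, 'a) ring_scheme \<Rightarrow> ('r, 'r) module"
  where "regular_module R = with_smult R (mult R)"

definition restrict_scalars :: "('r \<Rightarrow> 's) \<Rightarrow> ('s, 'm, 'b) module_scheme \<Rightarrow> ('r, 'm) module"
  where "restrict_scalars h A = with_smult A (\<lambda>r. smult A (h r))"

text \<open>
  The map on cosets of \<open>N\<close> induced by a map \<open>h\<close> with \<open>h ` N \<subseteq> N\<close>, in the style of
  \<^const>\<open>rcoset_mult\<close>.
\<close>

definition quotient_op :: "('m, 'b) ring_scheme \<Rightarrow> 'm set \<Rightarrow> ('m \<Rightarrow> 'm) \<Rightarrow> 'm set \<Rightarrow> 'm set"
  where "quotient_op A N h C = (\<Union>c\<in>C. N +>\<^bsub>A\<^esub> h c)"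

definition quotient_module :: "('r, 'm, 'b) module_scheme \<Rightarrow> 'm set \<Rightarrow> ('r, 'm set) module"
  where "quotient_module A N =
    \<lparr>carrier = carrier (A A_Mod N), mult = undefined, one = undefined,
     zero = one (A A_Mod N), add = mult (A A_Mod N),
     smult = (\<lambda>r. quotient_op A N (smult A r))\<rparr>"


section \<open>Tensor products over a commutative ring\<close>

definition tensor_relators ::
    "('r, 'a) ring_scheme \<Rightarrow> ('r, 'm, 'b) module_scheme \<Rightarrow> ('r, 'n, 'c) module_scheme \<Rightarrow> ('m \<times> 'n \<Rightarrow>\<^sub>0 int) set"
  where "tensor_relators R A B =
    {frag_of (a \<oplus>\<^bsub>A\<^esub> a', b) - frag_of (a, b) - frag_of (a', b) | a a' b.
       a \<in> carrier A \<and> a' \<in> carrier A \<and> b \<in> carrier B} \<union>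
    {frag_of (a, b \<oplus>\<^bsub>B\<^esub> b') - frag_of (a, b) - frag_of (a, b') | a b b'.
       a \<in> carrier A \<and> b \<in> carrier B \<and> b' \<in> carrier B} \<union>
    {frag_of (r \<odot>\<^bsub>A\<^esub> a, b) - frag_of (a, r \<odot>\<^bsub>B\<^esub> b) | r a b.
       r \<in> carrier R \<and> a \<in> carrier A \<and> b \<in> carrier B}"

definition tensor_null ::
    "('r, 'a) ring_scheme \<Rightarrow> ('r, 'm, 'b) module_scheme \<Rightarrow> ('r, 'n, 'c) module_scheme \<Rightarrow> ('m \<times> 'n \<Rightarrow>\<^sub>0 int) set"
  where "tensor_null R A B =
    generate (free_Abelian_group (carrier A \<times> carrier B)) (tensor_relators R A B)"

definition tensor_group ::
    "('r, 'a) ring_scheme \<Rightarrow> ('r, 'm, 'b) module_scheme \<Rightarrow> ('r, 'n, 'c) module_scheme \<Rightarrow> ('m \<times> 'n \<Rightarrow>\<^sub>0 int) set ring"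
  where "tensor_group R A B =
    (let Q = free_Abelian_group (carrier A \<times> carrier B) Mod tensor_null R A B
     in \<lparr>carrier = carrier Q, mult = undefined, one = undefined,
         zero = one Q, add = mult Q\<rparr>)"

definition tensor_elt ::
    "('r, 'a) ring_scheme \<Rightarrow> ('r, 'm, 'b) module_scheme \<Rightarrow> ('r, 'n, 'c) module_scheme \<Rightarrow> 'm \<Rightarrow> 'n \<Rightarrow> ('m \<times> 'n \<Rightarrow>\<^sub>0 int) set"
  where "tensor_elt R A B a b =
    tensor_null R A B #>\<^bsub>free_Abelian_group (carrier A \<times> carrier B)\<^esub> frag_of (a, b)"

text \<open>
  For a balanced biadditive \<open>h\<close> with values in \<open>U\<close>, \<open>tensor_lift U h\<close> is the additive map on the
  tensor product that sends \<open>a \<otimes> b\<close> to \<open>h (a, b)\<close>: all representatives of a coset \<open>C\<close> then have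
  the same value.
\<close>

definition tensor_lift :: "('u, 'b) ring_scheme \<Rightarrow> ('m \<times> 'n \<Rightarrow> 'u) \<Rightarrow> ('m \<times> 'n \<Rightarrow>\<^sub>0 int) set \<Rightarrow> 'u"
  where "tensor_lift U h C =
    the_elem ((\<lambda>c. \<Oplus>\<^bsub>U\<^esub>z\<in>Poly_Mapping.keys c. [poly_mapping.lookup c z] \<cdot>\<^bsub>U\<^esub> h z) ` C)"

definition tensor_left ::
    "('r, 'a) ring_scheme \<Rightarrow> ('r, 'm, 'b) module_scheme \<Rightarrow> ('r, 'n, 'c) module_scheme \<Rightarrow>
     ('m \<Rightarrow> 'm) \<Rightarrow> ('m \<times> 'n \<Rightarrow>\<^sub>0 int) set \<Rightarrow> ('m \<times> 'n \<Rightarrow>\<^sub>0 int) set"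
  where "tensor_left R A B h =
    tensor_lift (tensor_group R A B) (\<lambda>(a, b). tensor_elt R A B (h a) b)"

definition tensor_leibniz ::
    "('r, 'a) ring_scheme \<Rightarrow> ('r, 'm, 'b) module_scheme \<Rightarrow> ('r, 'n, 'c) module_scheme \<Rightarrow>
     ('m \<Rightarrow> 'm) \<Rightarrow> ('n \<Rightarrow> 'n) \<Rightarrow> ('m \<times> 'n \<Rightarrow>\<^sub>0 int) set \<Rightarrow> ('m \<times> 'n \<Rightarrow>\<^sub>0 int) set"
  where "tensor_leibniz R A B dA dB =
    tensor_lift (tensor_group R A B)
      (\<lambda>(a, b). tensor_elt R A B (dA a) b \<oplus>\<^bsub>tensor_group R A B\<^esub> tensor_elt R A B a (dB b))"


section \<open>Polynomials, rational functions and their derivations\<close>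

text \<open>
  The coordinates are indexed by a finite type \<open>'n\<close>, so \<open>n = CARD('n)\<close>.  Its linear order is that
  of the list \<open>x\<^sub>1, \<dots>, x\<^sub>n\<close>; it also provides the instance of \<^class>\<open>idom\<close> for polynomials.
\<close>

type_synonym ('n, 'k) mpoly = "('n \<Rightarrow>\<^sub>0 nat) \<Rightarrow>\<^sub>0 'k"

definition mderiv :: "'n \<Rightarrow> ('n::linorder, 'k::field_char_0) mpoly \<Rightarrow> ('n, 'k) mpoly"
  where "mderiv i p = (\<Sum>m\<in>Poly_Mapping.keys p.
    Poly_Mapping.single (m - Poly_Mapping.single i 1)
      (of_nat (poly_mapping.lookup m i) * poly_mapping.lookup p m))"

text \<open>Quotient rule; the value does not depend on the fraction if \<open>d\<close> is a derivation.\<close>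

definition fract_deriv :: "('a::idom \<Rightarrow> 'a) \<Rightarrow> 'a fract \<Rightarrow> 'a fract"
  where "fract_deriv d z =
    the_elem {Fract (d a * b - a * d b) (b * b) | a b. b \<noteq> 0 \<and> z = Fract a b}"

definition subring_of_type :: "'a::comm_ring_1 set \<Rightarrow> 'a ring"
  where "subring_of_type S =
    \<lparr>carrier = S, mult = (*), one = 1, zero = 0, add = (+)\<rparr>"

text \<open>\<open>K[x]\<close>, and \<open>K[x, f\<^sup>-\<^sup>1]\<close> inside \<open>K(x)\<close>.\<close>

definition Kx :: "('n::linorder, 'k::field_char_0) mpoly ring"
  where "Kx = subring_of_type UNIV"

definition Kxf :: "('n::linorder, 'k::field_char_0) mpoly \<Rightarrow> ('n, 'k) mpoly fract ring"
  where "Kxf f = subring_of_type {Fract p (f ^ k) | p k. True}"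

definition x_deriv :: "'n \<Rightarrow> ('n::linorder, 'k::field_char_0) mpoly fract \<Rightarrow> ('n, 'k) mpoly fract"
  where "x_deriv i = fract_deriv (mderiv i)"

text \<open>
  \<open>K(x, t)\<close> is realised as the fraction field of \<open>K(x)[t]\<close>; the polynomial variable is \<open>t\<close>.
\<close>

type_synonym ('n, 'k) xt_fract = "('n, 'k) mpoly fract poly fract"

definition xt_dx :: "'n \<Rightarrow> ('n::linorder, 'k::field_char_0) xt_fract \<Rightarrow> ('n, 'k) xt_fract"
  where "xt_dx i = fract_deriv (map_poly (x_deriv i))"

definition xt_dt :: "('n::linorder, 'k::field_char_0) xt_fract \<Rightarrow> ('n, 'k) xt_fract"
  where "xt_dt = fract_deriv pderiv"

definition tf1 :: "('n::linorder, 'k::field_char_0) mpoly \<Rightarrow> ('n, 'k) mpoly fract poly"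
  where "tf1 f = [: -1, to_fract f :]"

text \<open>\<open>K[x, t, f\<^sup>-\<^sup>1]\<close> and \<open>K[x, t, f\<^sup>-\<^sup>1, (tf - 1)\<^sup>-\<^sup>1]\<close> as subrings of \<open>K(x, t)\<close>.\<close>

definition Kxtf :: "('n::linorder, 'k::field_char_0) mpoly \<Rightarrow> ('n, 'k) xt_fract ring"
  where "Kxtf f =
    subring_of_type {Fract p 1 | p. \<forall>j. poly.coeff p j \<in> carrier (Kxf f)}"

definition Kxtf_tf1 :: "('n::linorder, 'k::field_char_0) mpoly \<Rightarrow> ('n, 'k) xt_fract ring"
  where "Kxtf_tf1 f =
    subring_of_type {Fract p (tf1 f ^ k) | p k. \<forall>j. poly.coeff p j \<in> carrier (Kxf f)}"


section \<open>The Weyl algebra\<close>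

text \<open>
  The \<open>n\<close>-th Weyl algebra in normal form: \<open>P\<close> stands for \<open>\<Sum>\<beta>. lookup P \<beta> \<cdot> \<partial>\<^sup>\<beta>\<close> with coefficients
  in \<open>K[x]\<close>.  Left multiplication by \<open>\<partial>\<^sub>i\<close> is determined by the relations \<open>\<partial>\<^sub>i q = q \<partial>\<^sub>i + \<partial>q/\<partial>x\<^sub>i\<close>
  and \<open>\<partial>\<^sub>i \<partial>\<^sub>j = \<partial>\<^sub>j \<partial>\<^sub>i\<close> (\<open>weyl_left_partial\<close>), and the product is obtained from it by linearity.
\<close>

type_synonym ('n, 'k) weyl = "('n \<Rightarrow>\<^sub>0 nat) \<Rightarrow>\<^sub>0 ('n, 'k) mpoly"

definition weyl_const :: "('n::linorder, 'k::field_char_0) mpoly \<Rightarrow> ('n, 'k) weyl"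
  where "weyl_const p = Poly_Mapping.single 0 p"

definition weyl_partial :: "'n \<Rightarrow> ('n::linorder, 'k::field_char_0) weyl"
  where "weyl_partial i = Poly_Mapping.single (Poly_Mapping.single i 1) 1"

definition weyl_free :: "(('n::linorder, 'k::field_char_0) mpoly, ('n, 'k) weyl) module"
  where "weyl_free =
    \<lparr>carrier = UNIV, mult = undefined, one = undefined, zero = 0, add = (+),
     smult = (\<lambda>p. Poly_Mapping.map ((*) p))\<rparr>"

definition weyl_left_partial :: "'n \<Rightarrow> ('n::linorder, 'k::field_char_0) weyl \<Rightarrow> ('n, 'k) weyl"
  where "weyl_left_partial i Q = (\<Sum>\<beta>\<in>Poly_Mapping.keys Q.
    Poly_Mapping.single (\<beta> + Poly_Mapping.single i 1) (poly_mapping.lookup Q \<beta>) +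
    Poly_Mapping.single \<beta> (mderiv i (poly_mapping.lookup Q \<beta>)))"

text \<open>
  \<open>partial_power d \<beta>\<close> composes the operators \<open>d i ^^ \<beta>\<^sub>i\<close>.  The order of composition is fixed, but
  it is irrelevant as the operators \<open>d i\<close> used below commute (on the relevant carriers).
\<close>

definition partial_power :: "('n::linorder \<Rightarrow> 'u \<Rightarrow> 'u) \<Rightarrow> ('n \<Rightarrow>\<^sub>0 nat) \<Rightarrow> 'u \<Rightarrow> 'u"
  where "partial_power d \<beta> =
    fold (\<lambda>i. d i ^^ poly_mapping.lookup \<beta> i) (sorted_list_of_set (Poly_Mapping.keys \<beta>))"

text \<open>The action of \<open>P\<close> on a \<open>K[x]\<close>-module \<open>U\<close> on which \<open>\<partial>\<^sub>i\<close> acts by \<open>d i\<close>.\<close>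

definition weyl_act ::
    "(('n::linorder, 'k::field_char_0) mpoly, 'u, 'b) module_scheme \<Rightarrow> ('n \<Rightarrow> 'u \<Rightarrow> 'u) \<Rightarrow>
     ('n, 'k) weyl \<Rightarrow> 'u \<Rightarrow> 'u"
  where "weyl_act U d P u =
    (\<Oplus>\<^bsub>U\<^esub>\<beta>\<in>Poly_Mapping.keys P. poly_mapping.lookup P \<beta> \<odot>\<^bsub>U\<^esub> partial_power d \<beta> u)"

definition Weyl :: "('n::linorder, 'k::field_char_0) weyl ring"
  where "Weyl =
    \<lparr>carrier = UNIV, mult = weyl_act weyl_free weyl_left_partial, one = weyl_const 1,
     zero = 0, add = (+)\<rparr>"


section \<open>Localization at \<open>f\<close>\<close>

text \<open>
  For a left \<open>D\<^sub>X\<close>-module \<open>M\<close>, \<open>localize f M\<close> is \<open>M[f\<^sup>-\<^sup>1]\<close>, written as \<open>K[x, f\<^sup>-\<^sup>1] \<otimes> M\<close> over \<open>K[x]\<close>,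
  as a \<open>K[x, f\<^sup>-\<^sup>1]\<close>-module, and \<open>localize_partial f M i\<close> is the operator \<open>\<partial>\<^sub>i\<close> on it.
\<close>

definition Kxf_over_Kx ::
    "('n::linorder, 'k::field_char_0) mpoly \<Rightarrow> (('n, 'k) mpoly, ('n, 'k) mpoly fract) module"
  where "Kxf_over_Kx f = restrict_scalars to_fract (regular_module (Kxf f))"

type_synonym ('n, 'k, 'm) localized = "(('n, 'k) mpoly fract \<times> 'm \<Rightarrow>\<^sub>0 int) set"

definition localize_elt ::
    "('n::linorder, 'k::field_char_0) mpoly \<Rightarrow> (('n, 'k) weyl, 'm) module \<Rightarrow>
     ('n, 'k) mpoly fract \<Rightarrow> 'm \<Rightarrow> ('n, 'k, 'm) localized"
  where "localize_elt f M = tensor_elt Kx (Kxf_over_Kx f) (restrict_scalars weyl_const M)"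

definition localize ::
    "('n::linorder, 'k::field_char_0) mpoly \<Rightarrow> (('n, 'k) weyl, 'm) module \<Rightarrow>
     (('n, 'k) mpoly fract, ('n, 'k, 'm) localized) module"
  where "localize f M =
    (let M0 = restrict_scalars weyl_const M
     in with_smult (tensor_group Kx (Kxf_over_Kx f) M0)
          (\<lambda>g. tensor_left Kx (Kxf_over_Kx f) M0 ((*) g)))"

definition localize_partial ::
    "('n::linorder, 'k::field_char_0) mpoly \<Rightarrow> (('n, 'k) weyl, 'm) module \<Rightarrow>
     'n \<Rightarrow> ('n, 'k, 'm) localized \<Rightarrow> ('n, 'k, 'm) localized"
  where "localize_partial f M i =
    tensor_leibniz Kx (Kxf_over_Kx f) (restrict_scalars weyl_const M)
      (x_deriv i) (smult M (weyl_partial i))"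

text \<open>
  The underlying group of \<open>D\<^sub>X[f\<^sup>-\<^sup>1]\<close> is \<open>K[x, f\<^sup>-\<^sup>1] \<otimes> D\<^sub>X\<close>.  If \<open>\<partial>\<^sub>i\<close> acts by \<open>d i\<close> on a
  \<open>K[x, f\<^sup>-\<^sup>1]\<close>-module \<open>U\<close>, then \<open>g \<otimes> P\<close> acts by \<open>u \<mapsto> g \<cdot> (P \<cdot> u)\<close>.  The product of \<open>D\<^sub>X[f\<^sup>-\<^sup>1]\<close> is the
  case \<open>U = K[x, f\<^sup>-\<^sup>1] \<otimes> D\<^sub>X\<close>, where \<open>\<partial>\<^sub>i (h \<otimes> Q) = (\<partial>h/\<partial>x\<^sub>i) \<otimes> Q + h \<otimes> \<partial>\<^sub>i Q\<close>.
\<close>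

definition weyl_loc_act ::
    "(('n::linorder, 'k::field_char_0) mpoly fract, 'u, 'b) module_scheme \<Rightarrow> ('n \<Rightarrow> 'u \<Rightarrow> 'u) \<Rightarrow>
     ('n, 'k, ('n, 'k) weyl) localized \<Rightarrow> 'u \<Rightarrow> 'u"
  where "weyl_loc_act U d C u =
    tensor_lift U (\<lambda>(g, P). g \<odot>\<^bsub>U\<^esub> weyl_act (restrict_scalars to_fract U) d P u) C"

definition Weyl_loc ::
    "('n::linorder, 'k::field_char_0) mpoly \<Rightarrow> ('n, 'k, ('n, 'k) weyl) localized ring"
  where "Weyl_loc f =
    (let D = regular_module Weyl; U = localize f D
     in \<lparr>carrier = carrier U, mult = weyl_loc_act U (localize_partial f D),
         one = localize_elt f D 1 (weyl_const 1), zero = zero U, add = add U\<rparr>)"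

definition weyl_to_loc ::
    "('n::linorder, 'k::field_char_0) mpoly \<Rightarrow> ('n, 'k) weyl \<Rightarrow> ('n, 'k, ('n, 'k) weyl) localized"
  where "weyl_to_loc f P = localize_elt f (regular_module Weyl) 1 P"

definition localized_module ::
    "('n::linorder, 'k::field_char_0) mpoly \<Rightarrow> (('n, 'k) weyl, 'm) module \<Rightarrow>
     (('n, 'k, ('n, 'k) weyl) localized, ('n, 'k, 'm) localized) module"
  where "localized_module f M =
    with_smult (localize f M) (weyl_loc_act (localize f M) (localize_partial f M))"


section \<open>The module \<open>B\<^bsub>Z|Y\<^esub>[f\<^sup>-\<^sup>1]\<close> and the direct image\<close>

text \<open>\<open>BZf f\<close> is \<open>K[x, t, f\<^sup>-\<^sup>1, (tf - 1)\<^sup>-\<^sup>1] / K[x, t, f\<^sup>-\<^sup>1]\<close> as a \<open>K[x, f\<^sup>-\<^sup>1]\<close>-module.\<close>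

definition Kxtf_tf1_over_Kxf ::
    "('n::linorder, 'k::field_char_0) mpoly \<Rightarrow> (('n, 'k) mpoly fract, ('n, 'k) xt_fract) module"
  where "Kxtf_tf1_over_Kxf f =
    restrict_scalars (\<lambda>g. to_fract [:g:]) (regular_module (Kxtf_tf1 f))"

definition BZf ::
    "('n::linorder, 'k::field_char_0) mpoly \<Rightarrow> (('n, 'k) mpoly fract, ('n, 'k) xt_fract set) module"
  where "BZf f = quotient_module (Kxtf_tf1_over_Kxf f) (carrier (Kxtf f))"

definition BZf_dx ::
    "('n::linorder, 'k::field_char_0) mpoly \<Rightarrow> 'n \<Rightarrow> ('n, 'k) xt_fract set \<Rightarrow> ('n, 'k) xt_fract set"
  where "BZf_dx f i = quotient_op (Kxtf_tf1_over_Kxf f) (carrier (Kxtf f)) (xt_dx i)"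

definition BZf_dt ::
    "('n::linorder, 'k::field_char_0) mpoly \<Rightarrow> ('n, 'k) xt_fract set \<Rightarrow> ('n, 'k) xt_fract set"
  where "BZf_dt f = quotient_op (Kxtf_tf1_over_Kxf f) (carrier (Kxtf f)) xt_dt"

definition BZf_delta :: "('n::linorder, 'k::field_char_0) mpoly \<Rightarrow> ('n, 'k) xt_fract set"
  where "BZf_delta f =
    carrier (Kxtf f) +>\<^bsub>Kxtf_tf1_over_Kxf f\<^esub> Fract [:to_fract f:] (tf1 f)"

text \<open>
  \<open>Mtilde f M\<close> is the tensor product of \<open>B\<^bsub>Z|Y\<^esub>[f\<^sup>-\<^sup>1]\<close> and \<open>M[f\<^sup>-\<^sup>1]\<close> over \<open>K[x, f\<^sup>-\<^sup>1]\<close>, first as a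
  \<open>K[x, f\<^sup>-\<^sup>1]\<close>-module (\<open>Mtilde_base\<close>) and then as a left \<open>D\<^sub>X[f\<^sup>-\<^sup>1]\<close>-module.
\<close>

type_synonym ('n, 'k, 'm) tilde =
  "(('n, 'k) xt_fract set \<times> ('n, 'k, 'm) localized \<Rightarrow>\<^sub>0 int) set"

definition Mtilde_base ::
    "('n::linorder, 'k::field_char_0) mpoly \<Rightarrow> (('n, 'k) weyl, 'm) module \<Rightarrow>
     (('n, 'k) mpoly fract, ('n, 'k, 'm) tilde) module"
  where "Mtilde_base f M =
    with_smult (tensor_group (Kxf f) (BZf f) (localize f M))
      (\<lambda>g. tensor_left (Kxf f) (BZf f) (localize f M) (smult (BZf f) g))"

definition Mtilde_dx ::
    "('n::linorder, 'k::field_char_0) mpoly \<Rightarrow> (('n, 'k) weyl, 'm) module \<Rightarrow>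
     'n \<Rightarrow> ('n, 'k, 'm) tilde \<Rightarrow> ('n, 'k, 'm) tilde"
  where "Mtilde_dx f M i =
    tensor_leibniz (Kxf f) (BZf f) (localize f M) (BZf_dx f i) (localize_partial f M i)"

definition Mtilde_dt ::
    "('n::linorder, 'k::field_char_0) mpoly \<Rightarrow> (('n, 'k) weyl, 'm) module \<Rightarrow>
     ('n, 'k, 'm) tilde \<Rightarrow> ('n, 'k, 'm) tilde"
  where "Mtilde_dt f M = tensor_left (Kxf f) (BZf f) (localize f M) (BZf_dt f)"

definition Mtilde ::
    "('n::linorder, 'k::field_char_0) mpoly \<Rightarrow> (('n, 'k) weyl, 'm) module \<Rightarrow>
     (('n, 'k, ('n, 'k) weyl) localized, ('n, 'k, 'm) tilde) module"
  where "Mtilde f M =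
    with_smult (Mtilde_base f M) (weyl_loc_act (Mtilde_base f M) (Mtilde_dx f M))"

definition Mtilde_mod_dt ::
    "('n::linorder, 'k::field_char_0) mpoly \<Rightarrow> (('n, 'k) weyl, 'm) module \<Rightarrow>
     (('n, 'k, ('n, 'k) weyl) localized, ('n, 'k, 'm) tilde set) module"
  where "Mtilde_mod_dt f M =
    quotient_module (Mtilde f M) (Mtilde_dt f M ` carrier (Mtilde f M))"

definition phi ::
    "('n::linorder, 'k::field_char_0) mpoly \<Rightarrow> (('n, 'k) weyl, 'm) module \<Rightarrow>
     ('n, 'k, 'm) localized \<Rightarrow> ('n, 'k, 'm) tilde set"
  where "phi f M v =
    (Mtilde_dt f M ` carrier (Mtilde f M)) +>\<^bsub>Mtilde f M\<^esub>
      tensor_elt (Kxf f) (BZf f) (localize f M) (BZf_delta f) v"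

end

theory Submission
  imports Defs
begin

text \<open>
  Write \<open>e\<^sub>k\<close> for the class of \<open>(tf - 1)\<^sup>-\<^sup>k\<close> in \<open>B = B\<^bsub>Z|Y\<^esub>[f\<^sup>-\<^sup>1]\<close>, so that \<open>\<delta> = f e\<^sub>1\<close>.  Since \<open>f\<close> is a unit
  of \<open>K[x, f\<^sup>-\<^sup>1]\<close>, the variable \<open>t\<close> equals \<open>((tf - 1) + 1) / f\<close>, and hence \<open>B\<close> is spanned over
  \<open>K[x, f\<^sup>-\<^sup>1]\<close> by the \<open>e\<^sub>k\<close> with \<open>k \<ge> 1\<close> (\<open>Kxtf_tf1_induct\<close>).

  Surjectivity of \<open>\<phi>\<close>: \<open>\<partial>\<^sub>t e\<^sub>k = - k f e\<^bsub>k+1\<^esub>\<close>, and \<open>k f\<close> is a unit in characteristic zero.  So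
  every tensor \<open>e\<^bsub>k+1\<^esub> \<otimes> v\<close> lies in the image of \<open>\<partial>\<^sub>t\<close>, and \<open>e\<^sub>1 \<otimes> v = \<delta> \<otimes> f\<^sup>-\<^sup>1 v\<close>
  (\<open>proj_te_eq_phi\<close>).

  Injectivity of \<open>\<phi>\<close>: the residue in \<open>t\<close> is a \<open>K[x, f\<^sup>-\<^sup>1]\<close>-linear functional on \<open>B\<close> that takes the
  value 1 at \<open>\<delta>\<close> and vanishes on derivatives with respect to \<open>t\<close>.  Therefore \<open>b \<otimes> v \<mapsto> res(b) v\<close>
  vanishes on the image of \<open>\<partial>\<^sub>t\<close> and sends \<open>\<delta> \<otimes> v\<close> to \<open>v\<close> (\<open>residue_map_dt\<close>, \<open>residue_map_delta\<close>).

  Linearity of \<open>\<phi>\<close>: \<open>\<partial>\<delta>/\<partial>x\<^sub>i\<close> is the derivative of \<open>(\<partial>f/\<partial>x\<^sub>i) f\<^sup>-\<^sup>1 e\<^sub>1\<close> with respect to \<open>t\<close>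
  (\<open>xt_dx_delta0\<close>), so \<open>\<partial>\<^sub>i (\<delta> \<otimes> v)\<close> and \<open>\<delta> \<otimes> \<partial>\<^sub>i v\<close> agree modulo the image of \<open>\<partial>\<^sub>t\<close>.

  The modules over \<open>D\<^sub>X\<close> and \<open>D\<^sub>X[f\<^sup>-\<^sup>1]\<close> are handled as modules over \<open>K[x]\<close> or \<open>K[x, f\<^sup>-\<^sup>1]\<close> with
  commuting operators \<open>\<partial>\<^sub>i\<close> that satisfy the Leibniz rule (locale \<open>diff_module\<close>).  Such structures
  pass to tensor products (\<open>diff_module_tensor_group\<close>) and to quotients (\<open>diff_module_quotient\<close>),
  and every one over \<open>K[x, f\<^sup>-\<^sup>1]\<close> is a left \<open>D\<^sub>X[f\<^sup>-\<^sup>1]\<close>-module (\<open>left_module_weyl_loc\<close>).  What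
  replaces explicit computations with differential operators is \<open>weyl_loc_act_intertwine\<close>: an
  additive map that commutes with scalars and with the \<open>\<partial>\<^sub>i\<close> commutes with all of \<open>D\<^sub>X[f\<^sup>-\<^sup>1]\<close>.  It
  yields the associativity of the product of \<open>D\<^sub>X[f\<^sup>-\<^sup>1]\<close>, the fact that the image of \<open>\<partial>\<^sub>t\<close> is a
  submodule, and the linearity of \<open>\<phi>\<close>.
\<close>

section \<open>Derivations of fraction fields and polynomial rings\<close>

definition derivation :: "('a::comm_ring_1 \<Rightarrow> 'a) \<Rightarrow> bool"
  where "derivation d \<longleftrightarrow> (\<forall>a b. d (a + b) = d a + d b) \<and> (\<forall>a b. d (a * b) = d a * b + a * d b)"

lemma derivation_add: "derivation d \<Longrightarrow> d (a + b) = d a + d b"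
  and derivation_mult: "derivation d \<Longrightarrow> d (a * b) = d a * b + a * d b"
  by (simp_all add: derivation_def)

lemma derivation_0: "derivation d \<Longrightarrow> d 0 = 0"
  using derivation_add[of d 0 0] by simp

lemma derivation_1: "derivation d \<Longrightarrow> d 1 = 0"
  using derivation_mult[of d 1 1] by simp

lemma derivation_minus: "derivation d \<Longrightarrow> d (- a) = - d a"
  using derivation_add[of d a "- a"] derivation_0[of d] by (simp add: eq_neg_iff_add_eq_0 add.commute)

lemma derivation_sum: "derivation d \<Longrightarrow> d (\<Sum>i\<in>I. g i) = (\<Sum>i\<in>I. d (g i))"
  by (induction I rule: infinite_finite_induct) (auto simp: derivation_0 derivation_add)

lemma derivation_of_nat: "derivation d \<Longrightarrow> d (of_nat n) = 0"
  by (induction n) (auto simp: derivation_0 derivation_1 derivation_add)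

lemma derivation_commutator:
  assumes "derivation d" "derivation e"
  shows "derivation (\<lambda>z. d (e z) - e (d z))"
  using assms unfolding derivation_def by (auto simp: algebra_simps)

text \<open>
  If \<open>a b' = a' b\<close>, then applying \<open>d\<close> to this equation shows that both fractions give the same
  value of the quotient rule, so the set in the definition of \<open>fract_deriv\<close> is a singleton.
\<close>

lemma fract_deriv_Fract:
  assumes d: "derivation d" and b: "b \<noteq> 0"
  shows "fract_deriv d (Fract a b) = Fract (d a * b - a * d b) (b * b)"
proof -
  have "Fract (d a' * b' - a' * d b') (b' * b') = Fract (d a * b - a * d b) (b * b)"
    if b': "b' \<noteq> 0" and eq: "Fract a b = Fract a' b'" for a' b'
  proof -
    have ab: "a * b' = a' * b" using eq b b' by (simp add: eq_fract)
    then have "d (a * b') = d (a' * b)" by simp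
    then have dab: "d a * b' + a * d b' = d a' * b + a' * d b" by (simp add: derivation_mult[OF d])
    have "(d a' * b' - a' * d b') * (b * b) - (d a * b - a * d b) * (b' * b')
        = b * b' * ((d a' * b + a' * d b) - (d a * b' + a * d b')) + (a * b' - a' * b) * (d b * b' + b * d b')"
      by (simp add: algebra_simps)
    also have "\<dots> = 0" using ab dab by simp
    finally show ?thesis using b b' by (simp add: eq_fract)
  qed
  then have "{Fract (d a' * b' - a' * d b') (b' * b') | a' b'. b' \<noteq> 0 \<and> Fract a b = Fract a' b'}
      = {Fract (d a * b - a * d b) (b * b)}" using b by blast
  then show ?thesis by (simp add: fract_deriv_def)
qed

lemma derivation_fract_deriv:
  fixes d :: "'a::idom \<Rightarrow> 'a"
  assumes d: "derivation d"
  shows "derivation (fract_deriv d)"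
  unfolding derivation_def
proof (intro conjI allI)
  fix x y :: "'a fract"
  obtain a b where x: "x = Fract a b" "b \<noteq> 0" by (cases x)
  obtain a' b' where y: "y = Fract a' b'" "b' \<noteq> 0" by (cases y)
  show "fract_deriv d (x + y) = fract_deriv d x + fract_deriv d y"
    using x y by (simp add: fract_deriv_Fract[OF d] eq_fract derivation_add[OF d] derivation_mult[OF d])
      (simp add: algebra_simps)
  show "fract_deriv d (x * y) = fract_deriv d x * y + x * fract_deriv d y"
    using x y by (simp add: fract_deriv_Fract[OF d] eq_fract derivation_add[OF d] derivation_mult[OF d])
      (simp add: algebra_simps)
qed

lemma fract_deriv_to_fract: "derivation d \<Longrightarrow> fract_deriv d (to_fract a) = to_fract (d a)"
  by (simp add: to_fract_def fract_deriv_Fract derivation_1)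

lemma Fract_conv_to_fract_mult: "b \<noteq> 0 \<Longrightarrow> Fract a b * to_fract b = to_fract a"
  by (simp add: to_fract_def eq_fract)

text \<open>
  For \<open>z = a / b\<close> the product rule for \<open>z b = a\<close> leaves \<open>D z \<cdot> b = 0\<close>.  Applied to commutators, this
  reduces the commutation of derivations on fractions to that on the base ring and avoids second
  derivatives of quotients.
\<close>

lemma derivation_fract_eq_0:
  fixes D :: "'a::idom fract \<Rightarrow> 'a fract"
  assumes D: "derivation D" and 0: "\<And>a. D (to_fract a) = 0"
  shows "D z = 0"
proof -
  obtain a b where z: "z = Fract a b" "b \<noteq> 0" by (cases z)
  have "D (z * to_fract b) = 0" using z 0 by (simp add: Fract_conv_to_fract_mult)
  then have "D z * to_fract b = 0" using 0[of b] by (simp add: derivation_mult[OF D])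
  then show ?thesis using z by simp
qed

lemma fract_deriv_commute:
  assumes d: "derivation d" and e: "derivation e" and c: "\<And>a. d (e a) = e (d a)"
  shows "fract_deriv d (fract_deriv e z) = fract_deriv e (fract_deriv d z)"
proof -
  have "fract_deriv d (fract_deriv e z) - fract_deriv e (fract_deriv d z) = 0"
    by (rule derivation_fract_eq_0[OF derivation_commutator[OF derivation_fract_deriv[OF d] derivation_fract_deriv[OF e]]])
      (simp add: fract_deriv_to_fract d e c)
  then show ?thesis by simp
qed

lemma derivation_map_poly:
  fixes d :: "'a::comm_ring_1 \<Rightarrow> 'a"
  assumes d: "derivation d"
  shows "derivation (map_poly d)"
  unfolding derivation_def
proof (intro conjI allI)
  fix p q :: "'a poly"
  show "map_poly d (p + q) = map_poly d p + map_poly d q"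
    by (rule poly_eqI) (simp add: coeff_map_poly derivation_0[OF d] derivation_add[OF d])
  show "map_poly d (p * q) = map_poly d p * q + p * map_poly d q"
    by (rule poly_eqI) (simp add: coeff_map_poly coeff_mult derivation_0[OF d] derivation_sum[OF d]
        derivation_mult[OF d] sum.distrib)
qed

lemma derivation_pderiv: "derivation (pderiv :: 'a::idom poly \<Rightarrow> 'a poly)"
  by (simp add: derivation_def pderiv_add pderiv_mult algebra_simps)

lemma map_poly_derivation_commute:
  assumes "derivation d" "derivation e" "\<And>a. d (e a) = e (d a)"
  shows "map_poly d (map_poly e p) = map_poly e (map_poly d p)"
  by (rule poly_eqI) (simp add: coeff_map_poly derivation_0 assms)

lemma map_poly_derivation_pderiv:
  assumes d: "derivation (d :: 'a::idom \<Rightarrow> 'a)"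
  shows "map_poly d (pderiv p) = pderiv (map_poly d p)"
  by (rule poly_eqI) (simp add: coeff_map_poly coeff_pderiv derivation_0[OF d] derivation_mult[OF d]
      derivation_of_nat[OF d] derivation_add[OF d] derivation_1[OF d])

text \<open>
  Polynomials and normal forms of differential operators are both finitely supported functions, so
  additive identities between them only have to be checked on single terms.
\<close>

lemma poly_mapping_add_induct [case_names zero single add]:
  fixes P :: "('i \<Rightarrow>\<^sub>0 'a::comm_monoid_add) \<Rightarrow> bool"
  assumes z: "P 0" and s: "\<And>k v. P (Poly_Mapping.single k v)"
    and a: "\<And>p q. P p \<Longrightarrow> P q \<Longrightarrow> P (p + q)"
  shows "P p"
proof (induction p rule: Poly_Mapping.update_induct)
  case const
  then show ?case using z by simp
next
  case (update f x y)
  have "Poly_Mapping.update x y f = f + Poly_Mapping.single x y"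
    by (rule poly_mapping_eqI)
      (use update in \<open>auto simp: lookup_update lookup_add lookup_single not_in_keys_iff_lookup_eq_zero when_def\<close>)
  then show ?case using a[OF update(3) s] by simp
qed

lemma sum_keys_superset:
  assumes "finite A" "Poly_Mapping.keys p \<subseteq> A" "\<And>k. g k 0 = 0"
  shows "(\<Sum>k\<in>Poly_Mapping.keys p. g k (poly_mapping.lookup p k)) = (\<Sum>k\<in>A. g k (poly_mapping.lookup p k))"
  by (rule sum.mono_neutral_left) (use assms in \<open>auto simp: in_keys_iff\<close>)

lemma sum_keys_add:
  fixes g :: "'i \<Rightarrow> 'a::comm_monoid_add \<Rightarrow> 'b::comm_monoid_add"
  assumes "\<And>k. g k 0 = 0" "\<And>k a b. g k (a + b) = g k a + g k b"
  shows "(\<Sum>k\<in>Poly_Mapping.keys (p + q). g k (poly_mapping.lookup (p + q) k))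
    = (\<Sum>k\<in>Poly_Mapping.keys p. g k (poly_mapping.lookup p k)) + (\<Sum>k\<in>Poly_Mapping.keys q. g k (poly_mapping.lookup q k))"
proof -
  let ?A = "Poly_Mapping.keys p \<union> Poly_Mapping.keys q"
  have "Poly_Mapping.keys (p + q) \<subseteq> ?A" by (rule keys_add)
  then have "(\<Sum>k\<in>Poly_Mapping.keys (p + q). g k (poly_mapping.lookup (p + q) k)) =
      (\<Sum>k\<in>?A. g k (poly_mapping.lookup (p + q) k))"
    by (intro sum_keys_superset assms(1)) simp_all
  also have "\<dots> = (\<Sum>k\<in>?A. g k (poly_mapping.lookup p k)) + (\<Sum>k\<in>?A. g k (poly_mapping.lookup q k))"
    by (simp add: sum.distrib lookup_add assms(2))
  finally show ?thesis
    by (simp add: sum_keys_superset[of ?A _ g, OF _ _ assms(1)])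
qed

lemma mderiv_0 [simp]: "mderiv i 0 = 0"
  by (simp add: mderiv_def)

lemma mderiv_single:
  "mderiv i (Poly_Mapping.single m v) =
    Poly_Mapping.single (m - Poly_Mapping.single i 1) (of_nat (poly_mapping.lookup m i) * v)"
  by (cases "v = 0") (simp_all add: mderiv_def)

lemma mderiv_add: "mderiv i (p + q) = mderiv i p + mderiv i q"
  unfolding mderiv_def
  by (rule sum_keys_add[where g = "\<lambda>m v. Poly_Mapping.single (m - Poly_Mapping.single i 1) (of_nat (poly_mapping.lookup m i) * v)"])
    (simp_all add: algebra_simps single_add)

text \<open>
  Exponents are subtracted in the natural numbers.  If \<open>x\<^sub>i\<close> does not occur in the monomial, this is
  harmless in the product rule since the coefficient of the derivative is then zero.
\<close>

lemma single_diff_add: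
  fixes m m' :: "'n \<Rightarrow>\<^sub>0 nat"
  assumes "poly_mapping.lookup m i \<noteq> 0"
  shows "m + m' - Poly_Mapping.single i 1 = (m - Poly_Mapping.single i 1) + m'"
  by (rule poly_mapping_eqI) (use assms in \<open>auto simp: lookup_add lookup_minus lookup_single when_def\<close>)

lemma mderiv_single_mult:
  fixes v w :: "'k::field_char_0" and m m' :: "'n::linorder \<Rightarrow>\<^sub>0 nat"
  defines "p \<equiv> Poly_Mapping.single m v" and "q \<equiv> Poly_Mapping.single m' w"
  shows "mderiv i (p * q) = mderiv i p * q + p * mderiv i q"
proof -
  let ?e = "Poly_Mapping.single i (1::nat)"
  have 1: "Poly_Mapping.single (m + m' - ?e) (of_nat (poly_mapping.lookup m i) * (v * w)) =
      Poly_Mapping.single ((m - ?e) + m') (of_nat (poly_mapping.lookup m i) * (v * w))"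
    by (cases "poly_mapping.lookup m i = 0") (simp_all add: single_diff_add[simplified])
  have 2: "Poly_Mapping.single (m + m' - ?e) (of_nat (poly_mapping.lookup m' i) * (v * w)) =
      Poly_Mapping.single (m + (m' - ?e)) (of_nat (poly_mapping.lookup m' i) * (v * w))"
    by (cases "poly_mapping.lookup m' i = 0") (use single_diff_add[of m' i m] in \<open>simp_all add: add.commute[of m]\<close>)
  have "mderiv i (p * q) = Poly_Mapping.single (m + m' - ?e) (of_nat (poly_mapping.lookup m i) * (v * w))
      + Poly_Mapping.single (m + m' - ?e) (of_nat (poly_mapping.lookup m' i) * (v * w))"
    unfolding p_def q_def by (simp only: mult_single mderiv_single lookup_add of_nat_add distrib_right single_add)
  then show ?thesis
    unfolding 1 2 p_def q_def mderiv_single mult_single by (simp add: mult_ac)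
qed

lemma derivation_mderiv: "derivation (mderiv i :: ('n::linorder, 'k::field_char_0) mpoly \<Rightarrow> _)"
  unfolding derivation_def
proof (intro conjI allI)
  fix p q :: "('n, 'k) mpoly"
  show "mderiv i (p + q) = mderiv i p + mderiv i q" by (rule mderiv_add)
  show "mderiv i (p * q) = mderiv i p * q + p * mderiv i q"
  proof (induction p rule: poly_mapping_add_induct)
    case (single m v)
    then show ?case
      by (induction q rule: poly_mapping_add_induct) (simp_all add: mderiv_single_mult mderiv_add algebra_simps)
  qed (simp_all add: mderiv_add algebra_simps)
qed

lemma mderiv_commute: "mderiv i (mderiv j p) = mderiv j (mderiv i p)"
proof (induction p rule: poly_mapping_add_induct)
  case (single m v)
  have "m - Poly_Mapping.single j 1 - Poly_Mapping.single i 1 = m - Poly_Mapping.single i 1 - Poly_Mapping.single j 1"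
    by (rule poly_mapping_eqI) (simp add: lookup_minus)
  then show ?case by (cases "i = j") (simp_all add: mderiv_single lookup_minus lookup_single mult_ac)
qed (simp_all add: mderiv_add)

lemmas derivation_x_deriv = derivation_fract_deriv[OF derivation_mderiv, folded x_deriv_def]

lemma x_deriv_to_fract: "x_deriv i (to_fract p) = to_fract (mderiv i p)"
  by (simp add: x_deriv_def fract_deriv_to_fract derivation_mderiv)

lemma x_deriv_commute: "x_deriv i (x_deriv j z) = x_deriv j (x_deriv i z)"
  unfolding x_deriv_def by (rule fract_deriv_commute) (simp_all add: derivation_mderiv mderiv_commute)

lemma derivation_xt_dx: "derivation (xt_dx i)"
  unfolding xt_dx_def by (intro derivation_fract_deriv derivation_map_poly derivation_x_deriv)

lemma derivation_xt_dt: "derivation xt_dt"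
  unfolding xt_dt_def by (intro derivation_fract_deriv derivation_pderiv)

lemma xt_dx_to_fract: "xt_dx i (to_fract p) = to_fract (map_poly (x_deriv i) p)"
  unfolding xt_dx_def by (intro fract_deriv_to_fract derivation_map_poly derivation_x_deriv)

lemma xt_dt_to_fract: "xt_dt (to_fract p) = to_fract (pderiv p)"
  unfolding xt_dt_def by (intro fract_deriv_to_fract derivation_pderiv)

lemma xt_dx_commute: "xt_dx i (xt_dx j z) = xt_dx j (xt_dx i z)"
  unfolding xt_dx_def
  by (intro fract_deriv_commute derivation_map_poly derivation_x_deriv map_poly_derivation_commute x_deriv_commute)

lemma xt_dx_dt_commute: "xt_dx i (xt_dt z) = xt_dt (xt_dx i z)"
  unfolding xt_dx_def xt_dt_def
  by (intro fract_deriv_commute derivation_map_poly derivation_x_deriv derivation_pderiv map_poly_derivation_pderiv)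

section \<open>The total residue of a rational function in one variable\<close>

text \<open>
  The coefficient of \<open>1 / t\<close> in the expansion of a rational function at \<open>t = \<infinity>\<close>, which is the sum
  of its residues at all finite poles.  Reduction modulo the denominator removes the polynomial part;
  for a constant denominator the remainder is zero, so that the truncated index \<open>degree b - 1\<close> does
  no harm.
\<close>

definition total_residue :: "'a::field poly fract \<Rightarrow> 'a"
  where "total_residue z =
    the_elem {poly.coeff (a mod b) (degree b - 1) / lead_coeff b | a b. b \<noteq> 0 \<and> z = Fract a b}"

text \<open>
  Cancelling \<open>c\<close> is compatible with division with remainder: \<open>a c mod b c = (a mod b) c\<close>.  As
  \<open>a mod b\<close> has degree at most \<open>degree b - 1\<close>, the coefficient in question is just multiplied by the
  leading coefficient of \<open>c\<close>.
\<close>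

lemma residue_coeff_cancel:
  fixes a b c :: "'a::field poly"
  assumes b: "b \<noteq> 0" and c: "c \<noteq> 0"
  shows "poly.coeff (a * c mod (b * c)) (degree (b * c) - 1) / lead_coeff (b * c)
    = poly.coeff (a mod b) (degree b - 1) / lead_coeff b"
proof (cases "degree b = 0")
  case True
  then obtain k where k: "b = [:k:]" by (auto elim: degree_eq_zeroE)
  with b have "k \<noteq> 0" by simp
  then have "b dvd 1" using k by (simp add: is_unit_const_poly_iff dvd_field_iff)
  then have "b dvd a" using dvd_trans by blast
  then have "a mod b = 0" "a * c mod (b * c) = 0" by (simp_all add: mult_mod_right mult.commute)
  then show ?thesis by simp
next
  case False
  let ?r = "a mod b"
  have le: "degree ?r \<le> degree b - 1"
    using degree_mod_less'[OF b, of a] False by (cases "?r = 0") auto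
  have "poly.coeff (?r * c) (degree b - 1 + degree c) = poly.coeff ?r (degree b - 1) * lead_coeff c"
  proof (cases "degree ?r = degree b - 1")
    case True
    then show ?thesis using coeff_mult_degree_sum[of ?r c] by simp
  next
    case False
    then have lt: "degree ?r < degree b - 1" using le by simp
    have "degree (?r * c) \<le> degree ?r + degree c" by (rule degree_mult_le)
    then show ?thesis using lt by (simp add: coeff_eq_0)
  qed
  moreover have "a * c mod (b * c) = ?r * c" by (metis mult_mod_right mult.commute)
  moreover have "degree (b * c) - 1 = degree b - 1 + degree c"
    using b c False by (simp add: degree_mult_eq)
  ultimately show ?thesis using c by (simp add: lead_coeff_mult mult.commute[of c])
qed

lemma total_residue_Fract:
  assumes b: "b \<noteq> 0"
  shows "total_residue (Fract a b) = poly.coeff (a mod b) (degree b - 1) / lead_coeff b"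
proof -
  have "poly.coeff (a' mod b') (degree b' - 1) / lead_coeff b' = poly.coeff (a mod b) (degree b - 1) / lead_coeff b"
    if b': "b' \<noteq> 0" and eq: "Fract a b = Fract a' b'" for a' b'
  proof -
    have "a * b' = a' * b" using eq b b' by (simp add: eq_fract)
    then show ?thesis
      using residue_coeff_cancel[OF b b', of a] residue_coeff_cancel[OF b' b, of a'] by (simp add: mult.commute)
  qed
  then have "{poly.coeff (a' mod b') (degree b' - 1) / lead_coeff b' | a' b'. b' \<noteq> 0 \<and> Fract a b = Fract a' b'}
      = {poly.coeff (a mod b) (degree b - 1) / lead_coeff b}" using b by blast
  then show ?thesis by (simp add: total_residue_def)
qed

lemma total_residue_add: "total_residue (x + y) = total_residue x + total_residue y"
proof -
  obtain a b where x: "x = Fract a b" "b \<noteq> 0" by (cases x)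
  obtain a' b' where y: "y = Fract a' b'" "b' \<noteq> 0" by (cases y)
  have x': "x = Fract (a * b') (b * b')" and y': "y = Fract (a' * b) (b * b')"
    using x y by (simp_all add: eq_fract)
  have "x + y = Fract (a * b' + a' * b) (b * b')" using x y by simp
  then show ?thesis unfolding x' y'
    using x(2) y(2) by (simp add: x(2) y(2) total_residue_Fract poly_mod_add_left add_divide_distrib del: add_fract)
qed

lemma total_residue_scale: "total_residue (to_fract [:c:] * x) = c * total_residue x"
proof -
  obtain a b where x: "x = Fract a b" "b \<noteq> 0" by (cases x)
  then show ?thesis by (simp add: to_fract_def total_residue_Fract mod_smult_left)
qed

lemma total_residue_poly: "total_residue (to_fract p) = 0"
  by (simp add: to_fract_def total_residue_Fract)

lemma total_residue_proper:
  assumes "b \<noteq> 0" "degree a < degree b"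
  shows "total_residue (Fract a b) = poly.coeff a (degree b - 1) / lead_coeff b"
  using assms by (simp add: total_residue_Fract mod_poly_less)

lemma degree_pderiv_le: "degree (pderiv p) \<le> degree p - 1"
  by (rule degree_le) (simp add: coeff_pderiv coeff_eq_0)

text \<open>
  Polynomials have polynomial derivatives.  For a proper fraction \<open>r / b\<close>, the numerator of the
  derivative has degree less than \<open>2 degree b - 1\<close>, so its expansion at infinity starts in degree at
  most \<open>-2\<close>.
\<close>

lemma total_residue_pderiv: "total_residue (fract_deriv pderiv x) = 0"
proof -
  note d = derivation_pderiv
  obtain a b where x: "x = Fract a b" "b \<noteq> 0" by (cases x)
  let ?r = "a mod b"
  have eq: "x = to_fract (a div b) + Fract ?r b"
    using x by (simp add: to_fract_def eq_fract)
  have "total_residue (fract_deriv pderiv (Fract ?r b)) = 0"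
  proof (cases "?r = 0")
    case True
    then show ?thesis using x(2) by (simp add: fract_deriv_Fract[OF d] total_residue_Fract derivation_0[OF d])
  next
    case False
    then have lt: "degree ?r < degree b" using degree_mod_less[OF x(2), of a] by simp
    have deg: "degree (pderiv ?r * b - ?r * pderiv b) < degree (b * b) - 1"
    proof (rule degree_diff_less)
      show "degree (pderiv ?r * b) < degree (b * b) - 1"
      proof (cases "degree ?r = 0")
        case True
        then have "pderiv ?r = 0" by (auto elim: degree_eq_zeroE simp: pderiv_pCons)
        then show ?thesis using lt x(2) by (simp add: degree_mult_eq)
      next
        case False
        have "degree (pderiv ?r * b) \<le> degree ?r - 1 + degree b"
          by (meson add_mono degree_mult_le degree_pderiv_le le_refl order_trans)
        then show ?thesis using lt False x(2) by (simp add: degree_mult_eq)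
      qed
      have "degree (?r * pderiv b) \<le> degree ?r + (degree b - 1)"
        by (meson add_mono degree_mult_le degree_pderiv_le le_refl order_trans)
      then show "degree (?r * pderiv b) < degree (b * b) - 1"
        using lt x(2) by (simp add: degree_mult_eq)
    qed
    then have "poly.coeff (pderiv ?r * b - ?r * pderiv b) (degree (b * b) - 1) = 0"
      by (rule coeff_eq_0)
    then show ?thesis using x(2) deg
      by (simp add: fract_deriv_Fract[OF d] total_residue_proper)
  qed
  then show ?thesis
    unfolding eq by (simp add: derivation_add[OF derivation_fract_deriv[OF d]] total_residue_add
        fract_deriv_to_fract[OF d] total_residue_poly)
qed

section \<open>Additive maps, quotients and change of scalars\<close>

definition additive_map :: "('a, 'b) ring_scheme \<Rightarrow> ('c, 'd) ring_scheme \<Rightarrow> ('a \<Rightarrow> 'c) \<Rightarrow> bool"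
  where "additive_map A B h \<longleftrightarrow> h \<in> carrier A \<rightarrow> carrier B \<and>
    (\<forall>x\<in>carrier A. \<forall>y\<in>carrier A. h (x \<oplus>\<^bsub>A\<^esub> y) = h x \<oplus>\<^bsub>B\<^esub> h y)"

lemma additiveI:
  assumes "\<And>x. x \<in> carrier A \<Longrightarrow> h x \<in> carrier B"
    and "\<And>x y. \<lbrakk>x \<in> carrier A; y \<in> carrier A\<rbrakk> \<Longrightarrow> h (x \<oplus>\<^bsub>A\<^esub> y) = h x \<oplus>\<^bsub>B\<^esub> h y"
  shows "additive_map A B h"
  using assms by (auto simp: additive_map_def)

lemma additive_closed: "additive_map A B h \<Longrightarrow> x \<in> carrier A \<Longrightarrow> h x \<in> carrier B"
  and additive_add: "additive_map A B h \<Longrightarrow> x \<in> carrier A \<Longrightarrow> y \<in> carrier A \<Longrightarrow> h (x \<oplus>\<^bsub>A\<^esub> y) = h x \<oplus>\<^bsub>B\<^esub> h y"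
  by (auto simp: additive_map_def)

lemma additive_zero:
  assumes "abelian_group A" "abelian_group B" "additive_map A B h"
  shows "h \<zero>\<^bsub>A\<^esub> = \<zero>\<^bsub>B\<^esub>"
proof -
  interpret A: abelian_group A by fact
  interpret B: abelian_group B by fact
  have "h \<zero>\<^bsub>A\<^esub> \<oplus>\<^bsub>B\<^esub> h \<zero>\<^bsub>A\<^esub> = h \<zero>\<^bsub>A\<^esub> \<oplus>\<^bsub>B\<^esub> \<zero>\<^bsub>B\<^esub>"
    using additive_add[OF assms(3), of "\<zero>\<^bsub>A\<^esub>" "\<zero>\<^bsub>A\<^esub>"] additive_closed[OF assms(3)] by simp
  then show ?thesis using additive_closed[OF assms(3)] by (metis A.zero_closed B.add.l_cancel_one B.r_zero)
qed

lemma additive_finsum: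
  assumes "abelian_group A" "abelian_group B" "additive_map A B h" "g \<in> I \<rightarrow> carrier A"
  shows "h (finsum A g I) = finsum B (\<lambda>i. h (g i)) I"
proof -
  interpret A: abelian_group A by fact
  interpret B: abelian_group B by fact
  show ?thesis using assms(4)
    by (induction I rule: infinite_finite_induct)
      (auto simp: additive_zero[OF assms(1-3)] additive_add[OF assms(3)] Pi_def additive_closed[OF assms(3)])
qed

lemma additive_compose: "additive_map A B h \<Longrightarrow> additive_map B C k \<Longrightarrow> additive_map A C (\<lambda>x. k (h x))"
  by (auto simp: additive_map_def Pi_def)

text \<open>
  Being an abelian group depends only on the carrier, the addition and the zero.  This transfers the
  property between the many records that share these three fields.
\<close>

lemma comm_group_abelian_group:
  assumes "comm_group Q" and [simp]: "carrier A = carrier Q" "add A = mult Q" "zero A = one Q"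
  shows "abelian_group A"
proof -
  interpret comm_group Q by fact
  show ?thesis by (rule abelian_groupI) (auto simp: m_ac)
qed

lemma with_smult_simps [simp]:
  "carrier (with_smult A act) = carrier A" "add (with_smult A act) = add A" "zero (with_smult A act) = zero A"
  "smult (with_smult A act) = act"
  by (simp_all add: with_smult_def)

lemma abelian_group_with_smult: "abelian_group A \<Longrightarrow> abelian_group (with_smult A act)"
  by (rule comm_group_abelian_group[OF abelian_group.a_comm_group]) simp_all

lemma with_smult_smult: "with_smult (A :: ('r, 'm) module) (smult A) = A"
  by (cases A) (simp add: with_smult_def)

lemma restrict_scalars_simps [simp]:
  "carrier (restrict_scalars h A) = carrier A" "add (restrict_scalars h A) = add A" "zero (restrict_scalars h A) = zero A"
  "smult (restrict_scalars h A) r x = h r \<odot>\<^bsub>A\<^esub> x"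
  by (simp_all add: restrict_scalars_def)

lemma left_module_restrict_scalars:
  assumes "left_module S A" "ring R" "h \<in> ring_hom R S"
  shows "left_module R (restrict_scalars h A)"
proof -
  interpret A: left_module S A by fact
  have 1: "abelian_group (restrict_scalars h A)"
    unfolding restrict_scalars_def by (intro abelian_group_with_smult A.M.abelian_group_axioms)
  note h = ring_hom_closed[OF assms(3)] ring_hom_add[OF assms(3)] ring_hom_mult[OF assms(3)] ring_hom_one[OF assms(3)]
  show ?thesis
    by (intro left_module.intro assms(2) 1 left_module_axioms.intro)
      (simp_all add: h A.smult_closed A.smult_l_distr A.smult_r_distr A.smult_assoc A.smult_one)
qed

lemma module_iff_left_module: "module R A \<longleftrightarrow> cring R \<and> left_module R A"
  unfolding module_def left_module_def module_axioms_def left_module_axioms_def cring_def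
  by auto

lemma left_module_regular: "ring R \<Longrightarrow> left_module R (regular_module R)"
proof -
  assume "ring R"
  then interpret ring R .
  show ?thesis unfolding regular_module_def
    by (intro left_module.intro ring_axioms abelian_group_with_smult abelian_group_axioms left_module_axioms.intro)
      (auto simp: l_distr r_distr m_assoc)
qed

lemma left_module_iso_restrict_scalars:
  assumes "left_module_iso S A B \<phi>" "ring R" "h \<in> ring_hom R S"
  shows "left_module_iso R (restrict_scalars h A) (restrict_scalars h B) \<phi>"
  using assms(1) left_module_restrict_scalars[of S A, OF _ assms(2,3)] left_module_restrict_scalars[of S B, OF _ assms(2,3)]
    ring_hom_closed[OF assms(3)]
  unfolding left_module_iso_def left_module_hom_def by auto

text \<open>
  By additivity \<open>h (n + a)\<close> and \<open>h a\<close> differ by \<open>h n \<in> N\<close>, so all the cosets that are united in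
  \<open>quotient_op\<close> coincide.
\<close>

lemma quotient_op_coset:
  assumes A: "abelian_group A" and N: "additive_subgroup N A"
    and h: "additive_map A A h" "\<And>n. n \<in> N \<Longrightarrow> h n \<in> N" and a: "a \<in> carrier A"
  shows "quotient_op A N h (N +>\<^bsub>A\<^esub> a) = N +>\<^bsub>A\<^esub> h a"
proof -
  interpret abelian_group A by fact
  interpret abelian_subgroup N A by (rule abelian_subgroupI3[OF N A])
  have "N +>\<^bsub>A\<^esub> h c = N +>\<^bsub>A\<^esub> h a" if c: "c \<in> N +>\<^bsub>A\<^esub> a" for c
  proof -
    obtain n where n: "n \<in> N" "c = n \<oplus>\<^bsub>A\<^esub> a" using c by (auto simp: a_r_coset_def')
    have "h c = h n \<oplus>\<^bsub>A\<^esub> h a" using n a additive_add[OF h(1), of n a] by auto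
    then have "h c \<in> N +>\<^bsub>A\<^esub> h a" using h(2)[OF n(1)] by (auto simp: a_r_coset_def')
    then show ?thesis
      using a_repr_independence[of "h c" N "h a"] additive_closed[OF h(1) a] a_subgroup by simp
  qed
  moreover have "a \<in> N +>\<^bsub>A\<^esub> a" using a a_rcos_self by simp
  ultimately show ?thesis unfolding quotient_op_def by blast
qed

lemma carrier_quotient_module: "carrier (quotient_module A N) = (\<lambda>a. N +>\<^bsub>A\<^esub> a) ` carrier A"
  by (auto simp: quotient_module_def A_FactGroup_def carrier_FactGroup a_r_coset_def)

lemma smult_quotient_module: "r \<odot>\<^bsub>quotient_module A N\<^esub> C = quotient_op A N (smult A r) C"
  by (simp add: quotient_module_def)

lemma zero_quotient_module: "\<zero>\<^bsub>quotient_module A N\<^esub> = N"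
  by (simp add: quotient_module_def A_FactGroup_def)

lemma add_quotient_module:
  assumes A: "abelian_group A" and N: "additive_subgroup N A" and "a \<in> carrier A" "b \<in> carrier A"
  shows "(N +>\<^bsub>A\<^esub> a) \<oplus>\<^bsub>quotient_module A N\<^esub> (N +>\<^bsub>A\<^esub> b) = N +>\<^bsub>A\<^esub> (a \<oplus>\<^bsub>A\<^esub> b)"
proof -
  interpret abelian_group A by fact
  interpret abelian_subgroup N A by (rule abelian_subgroupI3[OF N A])
  show ?thesis using assms(3,4) a_rcos_sum[of a b]
    by (simp add: quotient_module_def A_FactGroup_def set_add_def)
qed

lemma abelian_group_quotient_module:
  assumes A: "abelian_group A" and N: "additive_subgroup N A"
  shows "abelian_group (quotient_module A N)"
proof -
  interpret abelian_group A by fact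
  interpret abelian_subgroup N A by (rule abelian_subgroupI3[OF N A])
  show ?thesis
    by (rule comm_group_abelian_group[OF a_factorgroup_is_comm_group]) (simp_all add: quotient_module_def)
qed

lemma additive_quotient_proj:
  assumes "abelian_group A" "additive_subgroup N A"
  shows "additive_map A (quotient_module A N) (\<lambda>a. N +>\<^bsub>A\<^esub> a)"
  by (rule additiveI) (auto simp: carrier_quotient_module add_quotient_module[OF assms])

lemma additive_quotient_op:
  assumes A: "abelian_group A" and N: "additive_subgroup N A"
    and h: "additive_map A A h" "\<And>n. n \<in> N \<Longrightarrow> h n \<in> N"
  shows "additive_map (quotient_module A N) (quotient_module A N) (quotient_op A N h)"
  by (rule additiveI)
    (auto simp: carrier_quotient_module add_quotient_module[OF A N] quotient_op_coset[OF A N h]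
      additive_closed[OF h(1)] additive_add[OF h(1)] abelian_groupE(1)[OF A])

lemma coset_add_left:
  assumes A: "abelian_group A" and N: "additive_subgroup N A" and n: "n \<in> N" and a: "a \<in> carrier A"
  shows "N +>\<^bsub>A\<^esub> (n \<oplus>\<^bsub>A\<^esub> a) = N +>\<^bsub>A\<^esub> a"
proof -
  interpret abelian_group A by fact
  interpret abelian_subgroup N A by (rule abelian_subgroupI3[OF N A])
  have "n \<oplus>\<^bsub>A\<^esub> a \<in> N +>\<^bsub>A\<^esub> a" using n by (auto simp: a_r_coset_def')
  then show ?thesis using a_repr_independence[of "n \<oplus>\<^bsub>A\<^esub> a" N a] a a_subgroup by simp
qed

lemma coset_eqE:
  assumes A: "abelian_group A" and N: "additive_subgroup N A" and a: "a \<in> carrier A"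
    and eq: "N +>\<^bsub>A\<^esub> a = N +>\<^bsub>A\<^esub> b"
  obtains n where "n \<in> N" "a = n \<oplus>\<^bsub>A\<^esub> b"
proof -
  interpret abelian_group A by fact
  interpret abelian_subgroup N A by (rule abelian_subgroupI3[OF N A])
  have "a \<in> N +>\<^bsub>A\<^esub> b" using a_rcos_self[OF a] eq by simp
  then show ?thesis using that by (auto simp: a_r_coset_def')
qed

lemma additive_subgroupI_closed:
  assumes A: "abelian_group A" and "N \<subseteq> carrier A" "\<zero>\<^bsub>A\<^esub> \<in> N"
    "\<And>x y. x \<in> N \<Longrightarrow> y \<in> N \<Longrightarrow> x \<oplus>\<^bsub>A\<^esub> y \<in> N" "\<And>x. x \<in> N \<Longrightarrow> \<exists>y\<in>N. y \<oplus>\<^bsub>A\<^esub> x = \<zero>\<^bsub>A\<^esub>"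
  shows "additive_subgroup N A"
proof -
  interpret abelian_group A by fact
  have "\<ominus>\<^bsub>A\<^esub> x \<in> N" if x: "x \<in> N" for x
  proof -
    obtain y where y: "y \<in> N" "y \<oplus>\<^bsub>A\<^esub> x = \<zero>\<^bsub>A\<^esub>" using assms(5)[OF x] by blast
    then have "\<ominus>\<^bsub>A\<^esub> x = y" using x assms(2) by (intro minus_equality) auto
    then show ?thesis using y by simp
  qed
  then show ?thesis using assms
    by (intro additive_subgroupI subgroup.intro) (auto simp: a_inv_def)
qed

lemma a_r_coset_with_smult [simp]: "N +>\<^bsub>with_smult A act\<^esub> x = N +>\<^bsub>A\<^esub> x"
  by (simp add: a_r_coset_def r_coset_def)

lemma quotient_module_with_smult:
  "carrier (quotient_module (with_smult A act) N) = carrier (quotient_module A N)"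
  "add (quotient_module (with_smult A act) N) = add (quotient_module A N)"
  by (simp_all add: carrier_quotient_module)
    (simp add: quotient_module_def A_FactGroup_def set_mult_def fun_eq_iff)

lemma left_module_quotient_module:
  assumes M: "left_module R A" and N: "additive_subgroup N A"
    and sm: "\<And>r n. r \<in> carrier R \<Longrightarrow> n \<in> N \<Longrightarrow> r \<odot>\<^bsub>A\<^esub> n \<in> N"
  shows "left_module R (quotient_module A N)"
proof -
  interpret left_module R A by fact
  have A: "abelian_group A" ..
  have h: "additive_map A A (smult A r)" if "r \<in> carrier R" for r
    using that by (auto intro: additiveI simp: smult_closed smult_r_distr)
  have q: "r \<odot>\<^bsub>quotient_module A N\<^esub> (N +>\<^bsub>A\<^esub> a) = N +>\<^bsub>A\<^esub> (r \<odot>\<^bsub>A\<^esub> a)" if "r \<in> carrier R" "a \<in> carrier A" for r a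
    using that by (simp add: smult_quotient_module quotient_op_coset[OF A N h sm])
  show ?thesis
    by (intro left_module.intro R.ring_axioms abelian_group_quotient_module[OF A N] left_module_axioms.intro)
      (auto simp: carrier_quotient_module q add_quotient_module[OF A N] smult_closed smult_l_distr smult_r_distr
        smult_assoc smult_one)
qed

section \<open>Sums over coefficients\<close>

text \<open>
  The shape that is common to the extension of a map to a free abelian group (\<open>g k n = n \<cdot> h k\<close>) and
  to the action of a differential operator in normal form (\<open>g \<beta> p = p \<cdot> \<partial>\<^sup>\<beta> u\<close>).
\<close>

definition coeff_sum :: "('u, 'b) ring_scheme \<Rightarrow> ('i \<Rightarrow> 'a::zero \<Rightarrow> 'u) \<Rightarrow> ('i \<Rightarrow>\<^sub>0 'a) \<Rightarrow> 'u"
  where "coeff_sum U g p = (\<Oplus>\<^bsub>U\<^esub>k\<in>Poly_Mapping.keys p. g k (poly_mapping.lookup p k))"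

context abelian_group
begin

lemma coeff_sum_closed:
  assumes "Poly_Mapping.keys p \<subseteq> S" "\<And>k a. k \<in> S \<Longrightarrow> g k a \<in> carrier G"
  shows "coeff_sum G g p \<in> carrier G"
  unfolding coeff_sum_def using assms by (intro finsum_closed) auto

lemma coeff_sum_zero: "coeff_sum G g 0 = \<zero>"
  by (simp add: coeff_sum_def)

lemma coeff_sum_single:
  assumes "g k 0 = \<zero>" "g k a \<in> carrier G"
  shows "coeff_sum G g (Poly_Mapping.single k a) = g k a"
  using assms by (cases "a = 0") (simp_all add: coeff_sum_def)

lemma coeff_sum_superset:
  assumes "finite A" "Poly_Mapping.keys p \<subseteq> A" "\<And>k a. k \<in> A \<Longrightarrow> g k a \<in> carrier G" "\<And>k. k \<in> A \<Longrightarrow> g k 0 = \<zero>"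
  shows "coeff_sum G g p = (\<Oplus>k\<in>A. g k (poly_mapping.lookup p k))"
  unfolding coeff_sum_def
  by (rule add.finprod_mono_neutral_cong_left) (use assms in \<open>auto simp: in_keys_iff\<close>)

text \<open>
  Supports may shrink in \<open>p + q\<close>; since \<open>g\<close> vanishes at zero coefficients, all three sums can be
  taken over the union of the two supports.
\<close>

lemma coeff_sum_add:
  fixes g :: "'i \<Rightarrow> 'v::comm_monoid_add \<Rightarrow> 'a"
  assumes "Poly_Mapping.keys p \<subseteq> S" "Poly_Mapping.keys q \<subseteq> S"
    and g: "\<And>k a. k \<in> S \<Longrightarrow> g k a \<in> carrier G" "\<And>k. k \<in> S \<Longrightarrow> g k 0 = \<zero>"
      "\<And>k a b. k \<in> S \<Longrightarrow> g k (a + b) = g k a \<oplus> g k b"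
  shows "coeff_sum G g (p + q) = coeff_sum G g p \<oplus> coeff_sum G g q"
proof -
  let ?A = "Poly_Mapping.keys p \<union> Poly_Mapping.keys q"
  have A: "?A \<subseteq> S" "Poly_Mapping.keys (p + q) \<subseteq> ?A" using assms keys_add[of p q] by auto
  have "coeff_sum G g r = (\<Oplus>k\<in>?A. g k (poly_mapping.lookup r k))" if "Poly_Mapping.keys r \<subseteq> ?A" for r
    by (rule coeff_sum_superset) (use that A g in auto)
  moreover have "(\<Oplus>k\<in>?A. g k (poly_mapping.lookup (p + q) k))
      = (\<Oplus>k\<in>?A. g k (poly_mapping.lookup p k) \<oplus> g k (poly_mapping.lookup q k))"
    by (rule finsum_cong') (use A g in \<open>auto simp: lookup_add Pi_def\<close>)
  moreover have "\<dots> = (\<Oplus>k\<in>?A. g k (poly_mapping.lookup p k)) \<oplus> (\<Oplus>k\<in>?A. g k (poly_mapping.lookup q k))"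
    by (rule finsum_addf) (use A g in auto)
  ultimately show ?thesis using A(2) by simp
qed

end

section \<open>Tensor products\<close>

locale tensor_product = A: module R A + B: module R B
  for R :: "('r, 'a) ring_scheme" and A :: "('r, 'm, 'b) module_scheme" and B :: "('r, 'n, 'c) module_scheme"
begin

abbreviation "F \<equiv> free_Abelian_group (carrier A \<times> carrier B)"
abbreviation "N \<equiv> tensor_null R A B"
abbreviation "T \<equiv> tensor_group R A B"
abbreviation "te \<equiv> tensor_elt R A B"

sublocale F: comm_group F by (rule abelian_free_Abelian_group)

lemma relators_subset: "tensor_relators R A B \<subseteq> carrier F"
  unfolding tensor_relators_def by (auto dest!: subsetD[OF keys_diff] simp: keys_frag_of)

lemma subgroup_N: "subgroup N F"
  unfolding tensor_null_def by (rule F.generate_is_subgroup[OF relators_subset])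

sublocale N: normal N F
  by (rule F.subgroup_imp_normal[OF subgroup_N])

lemma relator_in_N: "x \<in> tensor_relators R A B \<Longrightarrow> x \<in> N"
  unfolding tensor_null_def by (rule generate.incl)

lemma coset_eqI:
  assumes "x \<in> carrier F" "y \<in> carrier F" "x - y \<in> N"
  shows "N #>\<^bsub>F\<^esub> x = N #>\<^bsub>F\<^esub> y"
proof -
  have "x \<in> N #>\<^bsub>F\<^esub> y" unfolding r_coset_def using assms(3) by (force intro: bexI[of _ "x - y"])
  then show ?thesis using F.repr_independence[of x N y] assms(2) subgroup_N by simp
qed

lemma T_simps: "carrier T = (\<lambda>x. N #>\<^bsub>F\<^esub> x) ` carrier F" "\<zero>\<^bsub>T\<^esub> = N"
  "x \<in> carrier F \<Longrightarrow> y \<in> carrier F \<Longrightarrow> (N #>\<^bsub>F\<^esub> x) \<oplus>\<^bsub>T\<^esub> (N #>\<^bsub>F\<^esub> y) = N #>\<^bsub>F\<^esub> (x + y)"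
proof -
  show "carrier T = (\<lambda>x. N #>\<^bsub>F\<^esub> x) ` carrier F" "\<zero>\<^bsub>T\<^esub> = N"
    by (simp_all add: tensor_group_def Let_def carrier_FactGroup)
  show "(N #>\<^bsub>F\<^esub> x) \<oplus>\<^bsub>T\<^esub> (N #>\<^bsub>F\<^esub> y) = N #>\<^bsub>F\<^esub> (x + y)" if "x \<in> carrier F" "y \<in> carrier F"
    using N.rcos_sum[OF that] by (simp add: tensor_group_def Let_def)
qed

lemma abelian_group_T: "abelian_group T"
proof -
  show ?thesis
    by (rule comm_group_abelian_group[OF F.abelian_FactGroup[OF subgroup_N]]) (simp_all add: tensor_group_def Let_def)
qed

sublocale T: abelian_group T by (rule abelian_group_T)

lemma elt_closed [intro, simp]: "a \<in> carrier A \<Longrightarrow> b \<in> carrier B \<Longrightarrow> te a b \<in> carrier T"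
  by (auto simp: T_simps tensor_elt_def)

lemma elt_add_left:
  assumes "a \<in> carrier A" "a' \<in> carrier A" "b \<in> carrier B"
  shows "te (a \<oplus>\<^bsub>A\<^esub> a') b = te a b \<oplus>\<^bsub>T\<^esub> te a' b"
proof -
  have "frag_of (a \<oplus>\<^bsub>A\<^esub> a', b) - frag_of (a, b) - frag_of (a', b) \<in> N"
    by (rule relator_in_N) (use assms in \<open>auto simp: tensor_relators_def\<close>)
  then have "N #>\<^bsub>F\<^esub> frag_of (a \<oplus>\<^bsub>A\<^esub> a', b) = N #>\<^bsub>F\<^esub> (frag_of (a, b) + frag_of (a', b))"
    by (intro coset_eqI) (use assms in \<open>auto simp: diff_diff_add keys_frag_of dest!: subsetD[OF keys_add]\<close>)
  then show ?thesis using assms by (simp add: tensor_elt_def T_simps)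
qed

lemma elt_add_right:
  assumes "a \<in> carrier A" "b \<in> carrier B" "b' \<in> carrier B"
  shows "te a (b \<oplus>\<^bsub>B\<^esub> b') = te a b \<oplus>\<^bsub>T\<^esub> te a b'"
proof -
  have "frag_of (a, b \<oplus>\<^bsub>B\<^esub> b') - frag_of (a, b) - frag_of (a, b') \<in> N"
    by (rule relator_in_N) (use assms in \<open>auto simp: tensor_relators_def\<close>)
  then have "N #>\<^bsub>F\<^esub> frag_of (a, b \<oplus>\<^bsub>B\<^esub> b') = N #>\<^bsub>F\<^esub> (frag_of (a, b) + frag_of (a, b'))"
    by (intro coset_eqI) (use assms in \<open>auto simp: diff_diff_add keys_frag_of dest!: subsetD[OF keys_add]\<close>)
  then show ?thesis using assms by (simp add: tensor_elt_def T_simps)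
qed

lemma elt_balanced:
  assumes "r \<in> carrier R" "a \<in> carrier A" "b \<in> carrier B"
  shows "te (r \<odot>\<^bsub>A\<^esub> a) b = te a (r \<odot>\<^bsub>B\<^esub> b)"
proof -
  have "frag_of (r \<odot>\<^bsub>A\<^esub> a, b) - frag_of (a, r \<odot>\<^bsub>B\<^esub> b) \<in> N"
    by (rule relator_in_N) (use assms in \<open>auto simp: tensor_relators_def\<close>)
  then show ?thesis unfolding tensor_elt_def
    by (intro coset_eqI) (use assms in \<open>auto simp: keys_frag_of\<close>)
qed

lemma additive_elt_left: "b \<in> carrier B \<Longrightarrow> additive_map A T (\<lambda>a. te a b)"
  and additive_elt_right: "a \<in> carrier A \<Longrightarrow> additive_map B T (te a)"
  by (auto intro!: additiveI simp: elt_add_left elt_add_right)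

lemma elt_zero_left: "b \<in> carrier B \<Longrightarrow> te \<zero>\<^bsub>A\<^esub> b = \<zero>\<^bsub>T\<^esub>"
  using additive_zero[OF A.M.abelian_group_axioms abelian_group_T additive_elt_left] .

text \<open>
  Elementary tensors generate the tensor product as a monoid already, because the inverse of \<open>a \<otimes> b\<close>
  is \<open>(- a) \<otimes> b\<close>.  The induction over the free group therefore treats an element together with its
  negative.
\<close>

lemma T_induct [consumes 1, case_names elt add]:
  assumes C: "C \<in> carrier T"
    and elt: "\<And>a b. a \<in> carrier A \<Longrightarrow> b \<in> carrier B \<Longrightarrow> P (te a b)"
    and add: "\<And>x y. \<lbrakk>x \<in> carrier T; y \<in> carrier T; P x; P y\<rbrakk> \<Longrightarrow> P (x \<oplus>\<^bsub>T\<^esub> y)"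
  shows "P C"
proof -
  have P0: "P \<zero>\<^bsub>T\<^esub>" using elt[of "\<zero>\<^bsub>A\<^esub>" "\<zero>\<^bsub>B\<^esub>"] by (simp add: elt_zero_left)
  have padd: "P (N #>\<^bsub>F\<^esub> (x + y))"
    if "x \<in> carrier F" "y \<in> carrier F" "P (N #>\<^bsub>F\<^esub> x)" "P (N #>\<^bsub>F\<^esub> y)" for x y
    using add[of "N #>\<^bsub>F\<^esub> x" "N #>\<^bsub>F\<^esub> y"] that T_simps by auto
  have "P (N #>\<^bsub>F\<^esub> x) \<and> P (N #>\<^bsub>F\<^esub> (- x))" if "Poly_Mapping.keys x \<subseteq> carrier A \<times> carrier B" for x
    using that
  proof (induction x rule: free_Abelian_group_induct[consumes 1])
    case 1
    have "N #>\<^bsub>F\<^esub> 0 = N" using F.coset_mult_one[of N] N.subset by simp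
    then show ?case using P0 T_simps(2) by simp
  next
    case (2 x y)
    then show ?case using padd[of x "- y"] padd[of "- x" y] by (simp add: add.commute)
  next
    case (3 z)
    obtain a b where z: "z = (a, b)" "a \<in> carrier A" "b \<in> carrier B" using 3 by auto
    have fc: "frag_of z \<in> carrier F" "- frag_of z \<in> carrier F" using 3 by (auto simp: keys_frag_of)
    then have "(N #>\<^bsub>F\<^esub> - frag_of z) \<oplus>\<^bsub>T\<^esub> te a b = \<zero>\<^bsub>T\<^esub>"
      using T_simps(3)[OF fc(2,1)] F.coset_mult_one[of N] N.subset z(1) by (simp add: tensor_elt_def T_simps(2))
    moreover have "te (\<ominus>\<^bsub>A\<^esub> a) b \<oplus>\<^bsub>T\<^esub> te a b = \<zero>\<^bsub>T\<^esub>"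
      using z elt_add_left[of "\<ominus>\<^bsub>A\<^esub> a" a b] by (simp add: A.M.l_neg elt_zero_left)
    moreover have "(N #>\<^bsub>F\<^esub> - frag_of z) \<in> carrier T" using fc(2) T_simps(1) by blast
    ultimately have "N #>\<^bsub>F\<^esub> - frag_of z = te (\<ominus>\<^bsub>A\<^esub> a) b"
      using z T.add.right_cancel[of "te a b" "N #>\<^bsub>F\<^esub> - frag_of z" "te (\<ominus>\<^bsub>A\<^esub> a) b"] by simp
    then show ?case using elt[of a b] elt[of "\<ominus>\<^bsub>A\<^esub> a" b] z by (simp add: tensor_elt_def)
  qed
  then show ?thesis using C T_simps(1) by auto
qed

end

definition balanced ::
    "('r, 'a) ring_scheme \<Rightarrow> ('r, 'm, 'b) module_scheme \<Rightarrow> ('r, 'n, 'c) module_scheme \<Rightarrow> ('u, 'd) ring_scheme \<Rightarrow>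
     ('m \<Rightarrow> 'n \<Rightarrow> 'u) \<Rightarrow> bool"
  where "balanced R A B V h \<longleftrightarrow>
    (\<forall>b\<in>carrier B. additive_map A V (\<lambda>a. h a b)) \<and> (\<forall>a\<in>carrier A. additive_map B V (h a)) \<and>
    (\<forall>r\<in>carrier R. \<forall>a\<in>carrier A. \<forall>b\<in>carrier B. h (r \<odot>\<^bsub>A\<^esub> a) b = h a (r \<odot>\<^bsub>B\<^esub> b))"

context tensor_product
begin

context
  fixes V :: "('u, 'd) ring_scheme" and h :: "'m \<Rightarrow> 'n \<Rightarrow> 'u"
  assumes V: "abelian_group V" and h: "balanced R A B V h"
begin

interpretation V: abelian_group V by (rule V)

lemma hc: "a \<in> carrier A \<Longrightarrow> b \<in> carrier B \<Longrightarrow> h a b \<in> carrier V"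
  using h unfolding balanced_def additive_map_def by blast

abbreviation "ext \<equiv> coeff_sum V (\<lambda>z n::int. [n] \<cdot>\<^bsub>V\<^esub> (case z of (a, b) \<Rightarrow> h a b))"

lemma zero_pow: "add_pow V (0::int) x = \<zero>\<^bsub>V\<^esub>"
  by (simp add: add_pow_def)

lemma ext_closed: "x \<in> carrier F \<Longrightarrow> ext x \<in> carrier V"
  by (rule V.coeff_sum_closed[of _ "carrier A \<times> carrier B"]) (auto simp: hc)

lemma ext_add: "x \<in> carrier F \<Longrightarrow> y \<in> carrier F \<Longrightarrow> ext (x + y) = ext x \<oplus>\<^bsub>V\<^esub> ext y"
  by (rule V.coeff_sum_add[of _ "carrier A \<times> carrier B"]) (auto simp: hc V.add.int_pow_mult zero_pow)

lemma ext_frag: "a \<in> carrier A \<Longrightarrow> b \<in> carrier B \<Longrightarrow> ext (frag_of (a, b)) = h a b"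
  using V.coeff_sum_single[of "\<lambda>z n. [n] \<cdot>\<^bsub>V\<^esub> (case z of (a, b) \<Rightarrow> h a b)" "(a, b)" "1::int"]
  by (simp add: hc zero_pow)

lemma ext_minus: "x \<in> carrier F \<Longrightarrow> ext (- x) = \<ominus>\<^bsub>V\<^esub> ext x"
  using ext_add[of "- x" x] ext_closed[of x] ext_closed[of "- x"] V.minus_equality[of "ext (- x)" "ext x"]
  by (simp add: V.coeff_sum_zero)

lemma ext_diff: "x \<in> carrier F \<Longrightarrow> y \<in> carrier F \<Longrightarrow> ext (x - y) = ext x \<ominus>\<^bsub>V\<^esub> ext y"
  using ext_add[of x "- y"] ext_minus[of y] by (simp add: V.minus_eq)

text \<open>
  The extension of \<open>h\<close> to the free abelian group kills the relators because \<open>h\<close> is biadditive and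
  balanced; hence it factors through the tensor product.
\<close>

lemma ext_relator:
  assumes "x \<in> tensor_relators R A B"
  shows "ext x = \<zero>\<^bsub>V\<^esub>"
proof -
  have kd: "frag_of z - frag_of w \<in> carrier F" if "z \<in> carrier A \<times> carrier B" "w \<in> carrier A \<times> carrier B" for z w
    using that keys_diff[of "frag_of z" "frag_of w"] by (auto simp: keys_frag_of)
  have add: "h (a \<oplus>\<^bsub>A\<^esub> a') b = h a b \<oplus>\<^bsub>V\<^esub> h a' b" if "a \<in> carrier A" "a' \<in> carrier A" "b \<in> carrier B" for a a' b
    using that h unfolding balanced_def additive_map_def by blast
  have add': "h a (b \<oplus>\<^bsub>B\<^esub> b') = h a b \<oplus>\<^bsub>V\<^esub> h a b'" if "a \<in> carrier A" "b' \<in> carrier B" "b \<in> carrier B" for a b b'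
    using that h unfolding balanced_def additive_map_def by blast
  have bal: "h (r \<odot>\<^bsub>A\<^esub> a) b = h a (r \<odot>\<^bsub>B\<^esub> b)" if "r \<in> carrier R" "a \<in> carrier A" "b \<in> carrier B" for r a b
    using that h unfolding balanced_def by blast
  have three: "ext (frag_of (a, b) - frag_of (a', b') - frag_of (a'', b'')) = \<zero>\<^bsub>V\<^esub>"
    if "a \<in> carrier A" "a' \<in> carrier A" "a'' \<in> carrier A" "b \<in> carrier B" "b' \<in> carrier B" "b'' \<in> carrier B"
      "h a b = h a' b' \<oplus>\<^bsub>V\<^esub> h a'' b''" for a a' a'' b b' b''
    using that kd[of "(a, b)" "(a', b')"] hc[of a' b'] hc[of a'' b'']
    by (simp add: ext_diff ext_frag del: carrier_free_Abelian_group_iff)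
      (simp add: V.minus_eq V.a_ac V.r_neg V.r_neg1 V.r_neg2)
  show ?thesis using assms unfolding tensor_relators_def
    by (elim UnE CollectE exE conjE)
      (auto simp: three add add' bal ext_diff ext_frag hc V.r_neg V.minus_eq simp del: carrier_free_Abelian_group_iff)
qed

lemma ext_null:
  assumes "x \<in> N"
  shows "ext x = \<zero>\<^bsub>V\<^esub>"
  using assms unfolding tensor_null_def
proof (induction x rule: generate.induct)
  case one
  show ?case by (simp only: one_free_Abelian_group V.coeff_sum_zero)
next
  case (incl x)
  then show ?case by (rule ext_relator)
next
  case (inv x)
  have x: "x \<in> carrier F" using inv relators_subset by (rule rev_subsetD)
  have "inv\<^bsub>F\<^esub> x = - x" using x by (intro inv_free_Abelian_group) simp
  then show ?case using V.minus_equality[OF V.l_zero[OF V.zero_closed] V.zero_closed V.zero_closed]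
    by (simp only: ext_minus[OF x] ext_relator[OF inv])
next
  case (eng x y)
  have "x \<in> carrier F" "y \<in> carrier F"
    by (rule F.generate_in_carrier[OF relators_subset], fact)+
  then have "ext (x + y) = ext x \<oplus>\<^bsub>V\<^esub> ext y" by (rule ext_add)
  then show ?case by (simp only: mult_free_Abelian_group eng.IH V.l_zero V.zero_closed)
qed

lemma tensor_lift_coset:
  assumes "x \<in> carrier F"
  shows "tensor_lift V (\<lambda>(a, b). h a b) (N #>\<^bsub>F\<^esub> x) = ext x"
proof -
  have "ext y = ext x" if y: "y \<in> N #>\<^bsub>F\<^esub> x" for y
  proof -
    obtain n where n: "n \<in> N" "y = n \<otimes>\<^bsub>F\<^esub> x" using y by (auto simp only: r_coset_def UN_iff singleton_iff)
    have "n \<in> carrier F" using N.subset n(1) by (rule subsetD)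
    then have "ext y = ext n \<oplus>\<^bsub>V\<^esub> ext x"
      using ext_add[OF _ assms] by (simp only: n(2) mult_free_Abelian_group)
    then show ?thesis by (simp only: ext_null[OF n(1)] V.l_zero[OF ext_closed[OF assms]])
  qed
  then have "ext ` (N #>\<^bsub>F\<^esub> x) \<subseteq> {ext x}" by (intro image_subsetI) (simp only: singleton_iff)
  moreover have "ext x \<in> ext ` (N #>\<^bsub>F\<^esub> x)" by (rule imageI[OF F.rcos_self[OF assms subgroup_N]])
  ultimately have "ext ` (N #>\<^bsub>F\<^esub> x) = {ext x}" by (intro equalityI) (simp_all only: empty_subsetI insert_subset)
  then show ?thesis unfolding tensor_lift_def coeff_sum_def by (simp only: the_elem_eq)
qed

text \<open>
  Together with \<open>tensor_lift_elt\<close> this is the existence part of the universal property of the tensor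
  product.
\<close>

lemma additive_tensor_lift: "additive_map T V (tensor_lift V (\<lambda>(a, b). h a b))"
proof (rule additiveI)
  fix x assume "x \<in> carrier T"
  then show "tensor_lift V (\<lambda>(a, b). h a b) x \<in> carrier V"
    unfolding T_simps(1) by (auto simp: tensor_lift_coset ext_closed simp del: carrier_free_Abelian_group_iff)
next
  fix x y assume "x \<in> carrier T" "y \<in> carrier T"
  then obtain u v where uv: "x = N #>\<^bsub>F\<^esub> u" "y = N #>\<^bsub>F\<^esub> v" "u \<in> carrier F" "v \<in> carrier F"
    unfolding T_simps(1) by blast
  have "u + v \<in> carrier F" using F.m_closed[OF uv(3,4)] by simp
  then show "tensor_lift V (\<lambda>(a, b). h a b) (x \<oplus>\<^bsub>T\<^esub> y)
      = tensor_lift V (\<lambda>(a, b). h a b) x \<oplus>\<^bsub>V\<^esub> tensor_lift V (\<lambda>(a, b). h a b) y"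
    using uv(3,4) unfolding uv(1,2)
    by (simp add: T_simps(3) tensor_lift_coset ext_add del: carrier_free_Abelian_group_iff)
qed

lemma tensor_lift_elt:
  "a \<in> carrier A \<Longrightarrow> b \<in> carrier B \<Longrightarrow> tensor_lift V (\<lambda>(a, b). h a b) (te a b) = h a b"
  unfolding tensor_elt_def by (simp add: tensor_lift_coset ext_frag)

end

end

context tensor_product
begin

lemma balanced_tensor_left:
  assumes h: "additive_map A A h" "\<And>r a. r \<in> carrier R \<Longrightarrow> a \<in> carrier A \<Longrightarrow> h (r \<odot>\<^bsub>A\<^esub> a) = r \<odot>\<^bsub>A\<^esub> h a"
  shows "balanced R A B T (\<lambda>a b. te (h a) b)"
  unfolding balanced_def
  by (auto intro!: additiveI simp: additive_closed[OF h(1)] additive_add[OF h(1)] h(2) elt_add_left elt_add_right elt_balanced)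

lemma
  assumes h: "additive_map A A h" "\<And>r a. r \<in> carrier R \<Longrightarrow> a \<in> carrier A \<Longrightarrow> h (r \<odot>\<^bsub>A\<^esub> a) = r \<odot>\<^bsub>A\<^esub> h a"
  shows additive_tensor_left: "additive_map T T (tensor_left R A B h)"
    and tensor_left_elt: "a \<in> carrier A \<Longrightarrow> b \<in> carrier B \<Longrightarrow> tensor_left R A B h (te a b) = te (h a) b"
  unfolding tensor_left_def
  by (rule additive_tensor_lift[OF abelian_group_T balanced_tensor_left[OF h]], assumption+)
    (rule tensor_lift_elt[OF abelian_group_T balanced_tensor_left[OF h]], assumption+)

end

lemma additive_plus:
  assumes B: "abelian_group B" and h: "additive_map A B h" "additive_map A B k"
  shows "additive_map A B (\<lambda>x. h x \<oplus>\<^bsub>B\<^esub> k x)"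
proof -
  interpret B: abelian_group B by fact
  show ?thesis
    by (rule additiveI)
      (simp_all add: additive_closed[OF h(1)] additive_closed[OF h(2)] additive_add[OF h(1)] additive_add[OF h(2)] B.a_ac)
qed

section \<open>Modules over a commutative ring with derivations\<close>

text \<open>
  A module with commuting operators that satisfy the Leibniz rule over given operators \<open>D i\<close> on the
  scalars.  For \<open>R = K[x]\<close> this is a module over the Weyl algebra, and for \<open>R = K[x, f\<^sup>-\<^sup>1]\<close> a module
  over the localized Weyl algebra, described by generators only.
\<close>

locale diff_module = module R U
  for R :: "('r, 'a) ring_scheme" and U :: "('r, 'u, 'b) module_scheme" +
  fixes D :: "'i \<Rightarrow> 'r \<Rightarrow> 'r" and d :: "'i \<Rightarrow> 'u \<Rightarrow> 'u"
  assumes D_closed: "r \<in> carrier R \<Longrightarrow> D i r \<in> carrier R"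
    and additive_d: "additive_map U U (d i)"
    and d_smult: "\<lbrakk>r \<in> carrier R; u \<in> carrier U\<rbrakk> \<Longrightarrow> d i (r \<odot>\<^bsub>U\<^esub> u) = D i r \<odot>\<^bsub>U\<^esub> u \<oplus>\<^bsub>U\<^esub> r \<odot>\<^bsub>U\<^esub> d i u"
    and d_commute: "u \<in> carrier U \<Longrightarrow> d i (d j u) = d j (d i u)"
begin

lemmas d_closed = additive_closed[OF additive_d]
lemmas d_add = additive_add[OF additive_d]

lemma additive_smult: "r \<in> carrier R \<Longrightarrow> additive_map U U (smult U r)"
  by (rule additiveI) (simp_all add: smult_r_distr)

end

text \<open>
  The Leibniz rule is compatible with the relation \<open>r a \<otimes> b = a \<otimes> r b\<close>: on both sides the derivative
  contributes the same extra term \<open>a \<otimes> (D r) b\<close>.  The scalars \<open>S\<close> act through the first factor and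
  may differ from the ring \<open>R\<close> over which the tensor product is taken.  The localization of a module
  is the case \<open>R = K[x]\<close>, \<open>S = K[x, f\<^sup>-\<^sup>1]\<close>, and the direct image the case \<open>R = S = K[x, f\<^sup>-\<^sup>1]\<close>.
\<close>

lemma diff_module_tensor:
  fixes R :: "('r, 'a) ring_scheme" and A :: "('r, 'm, 'b) module_scheme" and B :: "('r, 'n, 'c) module_scheme"
    and S :: "('s, 'e) ring_scheme"
  assumes A: "diff_module R A D dA" and B: "diff_module R B D dB"
    and S: "diff_module S (with_smult A \<sigma>) DS dA"
    and lin: "\<And>s r a. \<lbrakk>s \<in> carrier S; r \<in> carrier R; a \<in> carrier A\<rbrakk> \<Longrightarrow> \<sigma> s (r \<odot>\<^bsub>A\<^esub> a) = r \<odot>\<^bsub>A\<^esub> \<sigma> s a"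
  defines "T \<equiv> tensor_group R A B"
    and "dT \<equiv> \<lambda>i. tensor_leibniz R A B (dA i) (dB i)"
  shows diff_module_tensor_group: "diff_module S (with_smult T (\<lambda>s. tensor_left R A B (\<sigma> s))) DS dT"
    and tensor_leibniz_elt: "\<lbrakk>a \<in> carrier A; b \<in> carrier B\<rbrakk> \<Longrightarrow>
      dT i (tensor_elt R A B a b) = tensor_elt R A B (dA i a) b \<oplus>\<^bsub>T\<^esub> tensor_elt R A B a (dB i b)"
    and tensor_scalar_elt: "\<lbrakk>s \<in> carrier S; a \<in> carrier A; b \<in> carrier B\<rbrakk> \<Longrightarrow>
      tensor_left R A B (\<sigma> s) (tensor_elt R A B a b) = tensor_elt R A B (\<sigma> s a) b"
proof -
  interpret A: diff_module R A D dA by fact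
  interpret B: diff_module R B D dB by fact
  interpret S: diff_module S "with_smult A \<sigma>" DS dA by fact
  interpret tensor_product R A B ..
  note T_def [simp]
  have bal: "balanced R A B T (\<lambda>a b. te (dA i a) b \<oplus>\<^bsub>T\<^esub> te a (dB i b))" for i
    unfolding balanced_def
  proof (intro conjI ballI)
    fix b assume b: "b \<in> carrier B"
    show "additive_map A T (\<lambda>a. te (dA i a) b \<oplus>\<^bsub>T\<^esub> te a (dB i b))"
      unfolding T_def by (intro additive_plus abelian_group_T additive_compose[OF A.additive_d additive_elt_left] additive_elt_left b B.d_closed)
  next
    fix a assume a: "a \<in> carrier A"
    show "additive_map B T (\<lambda>b. te (dA i a) b \<oplus>\<^bsub>T\<^esub> te a (dB i b))"
      unfolding T_def by (intro additive_plus abelian_group_T additive_compose[OF B.additive_d additive_elt_right] additive_elt_right a A.d_closed)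
  next
    fix r a b assume [simp]: "r \<in> carrier R" "a \<in> carrier A" "b \<in> carrier B"
    note [simp] = A.d_closed B.d_closed A.D_closed
    have "te (dA i (r \<odot>\<^bsub>A\<^esub> a)) b \<oplus>\<^bsub>T\<^esub> te (r \<odot>\<^bsub>A\<^esub> a) (dB i b)
        = te a (D i r \<odot>\<^bsub>B\<^esub> b) \<oplus>\<^bsub>T\<^esub> te (dA i a) (r \<odot>\<^bsub>B\<^esub> b) \<oplus>\<^bsub>T\<^esub> te a (r \<odot>\<^bsub>B\<^esub> dB i b)"
      by (simp add: A.d_smult elt_add_left elt_balanced)
    also have "\<dots> = te (dA i a) (r \<odot>\<^bsub>B\<^esub> b) \<oplus>\<^bsub>T\<^esub> te a (dB i (r \<odot>\<^bsub>B\<^esub> b))"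
      by (simp add: B.d_smult elt_add_right T.a_ac)
    finally show "te (dA i (r \<odot>\<^bsub>A\<^esub> a)) b \<oplus>\<^bsub>T\<^esub> te (r \<odot>\<^bsub>A\<^esub> a) (dB i b)
        = te (dA i a) (r \<odot>\<^bsub>B\<^esub> b) \<oplus>\<^bsub>T\<^esub> te a (dB i (r \<odot>\<^bsub>B\<^esub> b))" .
  qed
  have dT: "additive_map T T (dT i)" for i
    unfolding dT_def tensor_leibniz_def using additive_tensor_lift[OF abelian_group_T bal[unfolded T_def]] by simp
  show dT_elt: "dT i (te a b) = te (dA i a) b \<oplus>\<^bsub>T\<^esub> te a (dB i b)" if "a \<in> carrier A" "b \<in> carrier B" for a b i
    unfolding dT_def tensor_leibniz_def T_def by (rule tensor_lift_elt[OF abelian_group_T bal[unfolded T_def] that])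
  have sa: "additive_map A A (\<sigma> s)" if "s \<in> carrier S" for s
    using S.additive_smult[OF that] by (auto simp: additive_map_def)
  let ?l = "\<lambda>s. tensor_left R A B (\<sigma> s)"
  have ladd: "additive_map T T (?l s)" if "s \<in> carrier S" for s
    unfolding T_def using that lin by (intro additive_tensor_left sa) auto
  show l_elt: "?l s (te a b) = te (\<sigma> s a) b" if "s \<in> carrier S" "a \<in> carrier A" "b \<in> carrier B" for s a b
    using that lin by (intro tensor_left_elt sa) auto
  note [simp] = A.d_closed B.d_closed S.D_closed
  have sc [simp]: "s \<in> carrier S \<Longrightarrow> a \<in> carrier A \<Longrightarrow> \<sigma> s a \<in> carrier A" for s a
    using S.smult_closed[of s a] by simp
  note lc = additive_closed[OF ladd, simplified] and la = additive_add[OF ladd, simplified]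
  note tc = additive_closed[OF dT, simplified] and ta = additive_add[OF dT, simplified]
  have Smod: "module S (with_smult T ?l)"
  proof (rule moduleI)
    fix r s x assume r: "r \<in> carrier S" and s: "s \<in> carrier S" and x: "x \<in> carrier (with_smult T ?l)"
    then have x': "x \<in> carrier T" by simp
    show "(r \<oplus>\<^bsub>S\<^esub> s) \<odot>\<^bsub>with_smult T ?l\<^esub> x = r \<odot>\<^bsub>with_smult T ?l\<^esub> x \<oplus>\<^bsub>with_smult T ?l\<^esub> s \<odot>\<^bsub>with_smult T ?l\<^esub> x"
      using x'[unfolded T_def]
    proof (induction x rule: T_induct)
      case (elt a b)
      then show ?case using r s S.smult_l_distr[of r s a] by (simp add: l_elt elt_add_left)
    next
      case (add x y)
      then show ?case using r s by (simp add: la lc T.a_ac)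
    qed
    show "(r \<otimes>\<^bsub>S\<^esub> s) \<odot>\<^bsub>with_smult T ?l\<^esub> x = r \<odot>\<^bsub>with_smult T ?l\<^esub> (s \<odot>\<^bsub>with_smult T ?l\<^esub> x)"
      using x'[unfolded T_def]
    proof (induction x rule: T_induct)
      case (elt a b)
      then show ?case using r s S.smult_assoc1[of r s a] by (simp add: l_elt)
    next
      case (add x y)
      then show ?case using r s by (simp add: la lc)
    qed
  next
    fix x assume "x \<in> carrier (with_smult T ?l)"
    then have x': "x \<in> carrier T" by simp
    show "\<one>\<^bsub>S\<^esub> \<odot>\<^bsub>with_smult T ?l\<^esub> x = x"
      using x'[unfolded T_def]
    proof (induction x rule: T_induct)
      case (elt a b)
      then show ?case using S.smult_one[of a] by (simp add: l_elt)
    next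
      case (add x y)
      then show ?case by (simp add: la)
    qed
  qed (simp_all add: S.R.cring_axioms abelian_group_with_smult abelian_group_T lc la)
  show "diff_module S (with_smult T ?l) DS dT"
  proof (intro diff_module.intro Smod diff_module_axioms.intro)
    show "additive_map (with_smult T ?l) (with_smult T ?l) (dT i)" for i
      using dT[of i] by (simp add: additive_map_def)
    show "dT i (s \<odot>\<^bsub>with_smult T ?l\<^esub> x) = DS i s \<odot>\<^bsub>with_smult T ?l\<^esub> x \<oplus>\<^bsub>with_smult T ?l\<^esub> s \<odot>\<^bsub>with_smult T ?l\<^esub> dT i x"
      if s: "s \<in> carrier S" and x: "x \<in> carrier (with_smult T ?l)" for i s x
      using x[simplified]
    proof (induction x rule: T_induct)
      case (elt a b)
      then show ?case using s S.d_smult[of s a i]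
        by (simp add: l_elt dT_elt[unfolded T_def] la elt_add_left T.a_ac)
    next
      case (add x y)
      then show ?case using s by (simp add: la lc ta tc T.a_ac)
    qed
    show "dT i (dT j x) = dT j (dT i x)" if x: "x \<in> carrier (with_smult T ?l)" for i j x
      using x[simplified]
    proof (induction x rule: T_induct)
      case (elt a b)
      then show ?case by (simp add: dT_elt[unfolded T_def] ta A.d_commute[of _ i j] B.d_commute[of _ i j] T.a_ac)
    next
      case (add x y)
      then show ?case by (simp add: ta tc)
    qed
  qed simp
qed

lemma (in diff_module) diff_module_quotient:
  assumes N: "additive_subgroup N U"
    and sm: "\<And>r n. r \<in> carrier R \<Longrightarrow> n \<in> N \<Longrightarrow> r \<odot>\<^bsub>U\<^esub> n \<in> N"
    and d: "\<And>i n. n \<in> N \<Longrightarrow> d i n \<in> N"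
  shows "diff_module R (quotient_module U N) D (\<lambda>i. quotient_op U N (d i))"
proof -
  have U: "abelian_group U" ..
  have "left_module R (quotient_module U N)"
    using left_module_quotient_module[of R U N] N sm module_axioms by (simp add: module_iff_left_module)
  then have 1: "module R (quotient_module U N)" by (simp add: module_iff_left_module R.cring_axioms)
  have qd: "quotient_op U N (d i) (N +>\<^bsub>U\<^esub> a) = N +>\<^bsub>U\<^esub> d i a" if "a \<in> carrier U" for a i
    using that by (simp add: quotient_op_coset[OF U N additive_d d])
  have qs: "quotient_op U N (smult U r) (N +>\<^bsub>U\<^esub> a) = N +>\<^bsub>U\<^esub> (r \<odot>\<^bsub>U\<^esub> a)" if "a \<in> carrier U" "r \<in> carrier R" for a r
    using that by (simp add: quotient_op_coset[OF U N additive_smult sm])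
  show ?thesis
  proof (intro diff_module.intro 1 diff_module_axioms.intro)
    show "additive_map (quotient_module U N) (quotient_module U N) (quotient_op U N (d i))" for i
      by (rule additive_quotient_op[OF U N additive_d d])
  qed (auto simp: carrier_quotient_module smult_quotient_module qd qs D_closed d_closed d_smult d_commute
      add_quotient_module[OF U N] intro: arg_cong[OF d_commute])
qed

section \<open>Powers of commuting operators\<close>

lemma fold_funpow_closed:
  assumes "\<And>i u. u \<in> C \<Longrightarrow> d i u \<in> C" "u \<in> C"
  shows "(d i ^^ n) u \<in> C" "fold (\<lambda>i. d i ^^ g i) xs u \<in> C"
proof -
  have *: "(d i ^^ n) u \<in> C" if "u \<in> C" for i n u using that by (induction n) (auto simp: assms(1))
  show "(d i ^^ n) u \<in> C" using assms(2) by (rule *)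
  show "fold (\<lambda>i. d i ^^ g i) xs u \<in> C" using assms(2) by (induction xs arbitrary: u) (auto simp: *)
qed

lemma partial_power_closed:
  assumes "\<And>i u. u \<in> C \<Longrightarrow> d i u \<in> C" "u \<in> C"
  shows "partial_power d \<beta> u \<in> C"
  unfolding partial_power_def by (rule fold_funpow_closed(2)) (use assms in auto)

lemma partial_power_intertwine:
  assumes c: "\<And>i u. u \<in> C \<Longrightarrow> d i u \<in> C" and h: "\<And>i u. u \<in> C \<Longrightarrow> h (d i u) = d' i (h u)" and u: "u \<in> C"
  shows "h (partial_power d \<beta> u) = partial_power d' \<beta> (h u)"
proof -
  have 1: "h ((d i ^^ n) u) = (d' i ^^ n) (h u)" if "u \<in> C" for i n u
    using that by (induction n) (auto simp: h fold_funpow_closed(1)[of C d, OF c])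
  have "h (fold (\<lambda>i. d i ^^ g i) xs u) = fold (\<lambda>i. d' i ^^ g i) xs (h u)" for xs g
    using u by (induction xs arbitrary: u) (simp_all add: 1 fold_funpow_closed(1)[of C d, OF c])
  then show ?thesis by (simp add: partial_power_def)
qed

lemma partial_power_0 [simp]: "partial_power d 0 u = u"
  by (simp add: partial_power_def)

text \<open>
  Indices with exponent zero contribute the identity.  This makes \<open>\<partial>\<^sup>\<beta>\<close> and \<open>\<partial>\<^sup>\<beta> \<partial>\<^sub>i\<close> comparable, whose
  lists of indices differ.
\<close>

lemma partial_power_superset:
  assumes "finite A" "Poly_Mapping.keys \<beta> \<subseteq> A"
  shows "partial_power d \<beta> = fold (\<lambda>i. d i ^^ poly_mapping.lookup \<beta> i) (sorted_list_of_set A)"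
proof -
  have keys: "sorted_list_of_set (Poly_Mapping.keys \<beta>) = filter (\<lambda>i. poly_mapping.lookup \<beta> i \<noteq> 0) (sorted_list_of_set A)"
    by (rule sorted_distinct_set_unique)
      (use assms in \<open>auto simp: in_keys_iff intro: sorted_wrt_filter\<close>)
  have filt: "fold g (filter P xs) = fold g xs" if "\<And>x. \<not> P x \<Longrightarrow> g x = id" for g :: "'a \<Rightarrow> 'b \<Rightarrow> 'b" and P xs
    using that by (induction xs) auto
  have "fold (\<lambda>i. d i ^^ poly_mapping.lookup \<beta> i) (filter (\<lambda>i. poly_mapping.lookup \<beta> i \<noteq> 0) (sorted_list_of_set A))
      = fold (\<lambda>i. d i ^^ poly_mapping.lookup \<beta> i) (sorted_list_of_set A)"
    by (rule filt) (simp add: fun_eq_iff)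
  with keys show ?thesis by (simp add: partial_power_def)
qed

text \<open>
  The additional factor \<open>d i\<close> is created at the position of \<open>i\<close> in the list and moved to the front
  past all later operators.
\<close>

lemma partial_power_add_single:
  assumes c: "\<And>i u. u \<in> C \<Longrightarrow> d i u \<in> C" and comm: "\<And>i j u. u \<in> C \<Longrightarrow> d i (d j u) = d j (d i u)" and u: "u \<in> C"
  shows "partial_power d (\<beta> + Poly_Mapping.single i 1) u = d i (partial_power d \<beta> u)"
proof -
  let ?A = "insert i (Poly_Mapping.keys \<beta>)" and ?b = "\<beta> + Poly_Mapping.single i 1"
  let ?f = "\<lambda>\<beta> xs. fold (\<lambda>i. d i ^^ poly_mapping.lookup \<beta> i) xs"
  have commn: "(d j ^^ n) (d i u) = d i ((d j ^^ n) u)" if "u \<in> C" for j n u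
    using that by (induction n) (auto simp: comm fold_funpow_closed(1)[of C d, OF c])
  have commf: "?f b xs (d i u) = d i (?f b xs u)" if "u \<in> C" for b xs u
    using that by (induction xs arbitrary: u) (simp_all add: commn fold_funpow_closed(1)[of C d, OF c])
  have notin: "?f ?b xs = ?f \<beta> xs" if "i \<notin> set xs" for xs
    using that by (induction xs) (auto simp: lookup_add lookup_single)
  have main: "?f ?b xs u = d i (?f \<beta> xs u)" if "distinct xs" "i \<in> set xs" "u \<in> C" for xs u
    using that
  proof (induction xs arbitrary: u)
    case (Cons x xs)
    show ?case
    proof (cases "x = i")
      case True
      have "poly_mapping.lookup ?b i = Suc (poly_mapping.lookup \<beta> i)"
        by (simp add: lookup_add)
      then have "?f ?b (x # xs) u = ?f ?b xs (d i ((d i ^^ poly_mapping.lookup \<beta> i) u))"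
        by (simp only: True fold.simps(2) o_apply funpow.simps(2))
      also have "\<dots> = ?f \<beta> xs (d i ((d i ^^ poly_mapping.lookup \<beta> i) u))"
        using Cons.prems True by (subst notin) auto
      also have "\<dots> = d i (?f \<beta> (x # xs) u)"
        using Cons.prems True by (simp add: commf fold_funpow_closed(1)[of C d, OF c])
      finally show ?thesis .
    next
      case False
      then show ?thesis using Cons
        by (simp add: lookup_add lookup_single fold_funpow_closed(1)[of C d, OF c])
    qed
  qed simp
  have "Poly_Mapping.keys ?b \<subseteq> ?A" using keys_add[of \<beta> "Poly_Mapping.single i 1"] by auto
  then have b: "partial_power d ?b = ?f ?b (sorted_list_of_set ?A)" by (intro partial_power_superset) simp_all
  have \<beta>: "partial_power d \<beta> = ?f \<beta> (sorted_list_of_set ?A)"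
    by (rule partial_power_superset) auto
  show ?thesis unfolding b \<beta>
  proof (rule main)
    show "distinct (sorted_list_of_set ?A)" by (rule distinct_sorted_list_of_set)
    show "i \<in> set (sorted_list_of_set ?A)" by (subst set_sorted_list_of_set) auto
  qed (fact u)
qed

section \<open>The Weyl algebra and its modules\<close>

lemma subring_of_type_simps [simp]:
  "carrier (subring_of_type S) = S" "mult (subring_of_type S) = (*)" "one (subring_of_type S) = 1"
  "zero (subring_of_type S) = 0" "add (subring_of_type S) = (+)"
  by (simp_all add: subring_of_type_def)

lemma cring_subring_of_type:
  assumes "0 \<in> S" "1 \<in> S" "\<And>x. x \<in> S \<Longrightarrow> - x \<in> S" "\<And>x y. x \<in> S \<Longrightarrow> y \<in> S \<Longrightarrow> x + y \<in> S"
    "\<And>x y. x \<in> S \<Longrightarrow> y \<in> S \<Longrightarrow> x * y \<in> S"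
  shows "cring (subring_of_type S)"
proof (rule cringI)
  show "abelian_group (subring_of_type S)"
    by (rule abelian_groupI) (use assms in \<open>auto simp: algebra_simps intro: bexI[of _ "- x" for x]\<close>)
  show "comm_monoid (subring_of_type S)"
    by (rule comm_monoidI) (use assms in \<open>auto simp: algebra_simps\<close>)
qed (auto simp: algebra_simps)

lemma Kx_simps [simp]:
  "carrier Kx = UNIV" "mult Kx = (*)" "one Kx = 1" "zero Kx = 0" "add Kx = (+)"
  by (simp_all add: Kx_def)

lemma cring_Kx: "cring Kx"
  unfolding Kx_def by (rule cring_subring_of_type) auto

lemma weyl_free_simps [simp]:
  "carrier weyl_free = UNIV" "add weyl_free = (+)" "zero weyl_free = 0"
  "p \<odot>\<^bsub>weyl_free\<^esub> Q = Poly_Mapping.single 0 p * Q"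
  by (simp_all add: weyl_free_def mult_map_scale_conv_mult)

lemma Weyl_simps [simp]:
  "carrier Weyl = UNIV" "mult Weyl = weyl_act weyl_free weyl_left_partial" "one Weyl = weyl_const 1"
  "zero Weyl = 0" "add Weyl = (+)"
  by (simp_all add: Weyl_def)

lemma module_weyl_free: "module Kx weyl_free"
proof (rule moduleI)
  show "abelian_group weyl_free"
    by (rule abelian_groupI) (auto simp: add_ac intro: exI[of _ "- x" for x])
qed (auto simp: cring_Kx algebra_simps single_add mult_single mult.assoc[symmetric])

lemma weyl_left_partial_single:
  "weyl_left_partial i (Poly_Mapping.single \<beta> q) =
    Poly_Mapping.single (\<beta> + Poly_Mapping.single i 1) q + Poly_Mapping.single \<beta> (mderiv i q)"
  by (cases "q = 0") (simp_all add: weyl_left_partial_def)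

lemma weyl_left_partial_add: "weyl_left_partial i (P + Q) = weyl_left_partial i P + weyl_left_partial i Q"
  unfolding weyl_left_partial_def
  by (rule sum_keys_add[where g = "\<lambda>\<beta> q. Poly_Mapping.single (\<beta> + Poly_Mapping.single i 1) q + Poly_Mapping.single \<beta> (mderiv i q)"])
    (simp_all add: mderiv_add single_add add_ac)

lemma weyl_act_coeff_sum: "weyl_act U d P u = coeff_sum U (\<lambda>\<beta> p. p \<odot>\<^bsub>U\<^esub> partial_power d \<beta> u) P"
  by (simp add: weyl_act_def coeff_sum_def)

text \<open>
  A differential operator acts through scalars and the \<open>\<partial>\<^sub>i\<close> only.  Taking the Weyl algebra itself
  for \<open>U\<close> gives the associativity in \<open>wact_mult\<close>.
\<close>

lemma weyl_act_intertwine: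
  assumes U: "module Kx U" and V: "module Kx V" and H: "additive_map U V H"
    and lin: "\<And>p u. u \<in> carrier U \<Longrightarrow> H (p \<odot>\<^bsub>U\<^esub> u) = p \<odot>\<^bsub>V\<^esub> H u"
    and d: "\<And>i u. u \<in> carrier U \<Longrightarrow> d i u \<in> carrier U" "\<And>i u. u \<in> carrier U \<Longrightarrow> H (d i u) = d' i (H u)"
    and u: "u \<in> carrier U"
  shows "H (weyl_act U d P u) = weyl_act V d' P (H u)"
proof -
  interpret U: module Kx U by fact
  interpret V: module Kx V by fact
  have pc: "partial_power d \<beta> u \<in> carrier U" for \<beta> by (rule partial_power_closed[OF d(1) u])
  have "H (weyl_act U d P u) = (\<Oplus>\<^bsub>V\<^esub>\<beta>\<in>Poly_Mapping.keys P. H (poly_mapping.lookup P \<beta> \<odot>\<^bsub>U\<^esub> partial_power d \<beta> u))"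
    unfolding weyl_act_def
    by (rule additive_finsum[OF U.M.abelian_group_axioms V.M.abelian_group_axioms H]) (auto simp: pc)
  also have "(\<lambda>\<beta>. H (poly_mapping.lookup P \<beta> \<odot>\<^bsub>U\<^esub> partial_power d \<beta> u))
      = (\<lambda>\<beta>. poly_mapping.lookup P \<beta> \<odot>\<^bsub>V\<^esub> partial_power d' \<beta> (H u))"
    by (simp add: lin pc partial_power_intertwine[of "carrier U" d H d', OF d u])
  finally show ?thesis by (simp add: weyl_act_def)
qed

locale kx_diff_module = diff_module Kx U mderiv d
  for U :: "(('n::linorder, 'k::field_char_0) mpoly, 'u, 'b) module_scheme" and d :: "'n \<Rightarrow> 'u \<Rightarrow> 'u"
begin

lemma pp_closed [simp]: "u \<in> carrier U \<Longrightarrow> partial_power d \<beta> u \<in> carrier U"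
  by (rule partial_power_closed) (auto simp: d_closed)

lemma pp_add_single: "u \<in> carrier U \<Longrightarrow> partial_power d (\<beta> + Poly_Mapping.single i 1) u = d i (partial_power d \<beta> u)"
  by (rule partial_power_add_single[of "carrier U"]) (auto simp: d_closed d_commute)

lemma wact_closed [simp]: "u \<in> carrier U \<Longrightarrow> weyl_act U d P u \<in> carrier U"
  unfolding weyl_act_coeff_sum by (rule coeff_sum_closed[of _ UNIV]) auto

lemma smult_zero_l: "u \<in> carrier U \<Longrightarrow> 0 \<odot>\<^bsub>U\<^esub> u = \<zero>\<^bsub>U\<^esub>"
  using smult_l_null[of u] by simp

lemma wact_single: "u \<in> carrier U \<Longrightarrow> weyl_act U d (Poly_Mapping.single \<beta> p) u = p \<odot>\<^bsub>U\<^esub> partial_power d \<beta> u"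
  unfolding weyl_act_coeff_sum by (rule coeff_sum_single) (auto simp: smult_zero_l)

lemma wact_zero: "weyl_act U d 0 u = \<zero>\<^bsub>U\<^esub>"
  unfolding weyl_act_coeff_sum by (rule coeff_sum_zero)

lemma wact_add_left: "u \<in> carrier U \<Longrightarrow> weyl_act U d (P + Q) u = weyl_act U d P u \<oplus>\<^bsub>U\<^esub> weyl_act U d Q u"
  unfolding weyl_act_coeff_sum
  by (rule coeff_sum_add[of _ UNIV]) (use smult_l_distr in \<open>auto simp: smult_zero_l\<close>)

lemma pp_add: "u \<in> carrier U \<Longrightarrow> v \<in> carrier U \<Longrightarrow>
    partial_power d \<beta> (u \<oplus>\<^bsub>U\<^esub> v) = partial_power d \<beta> u \<oplus>\<^bsub>U\<^esub> partial_power d \<beta> v"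
proof -
  assume uv: "u \<in> carrier U" "v \<in> carrier U"
  have 1: "(d i ^^ n) (u \<oplus>\<^bsub>U\<^esub> v) = (d i ^^ n) u \<oplus>\<^bsub>U\<^esub> (d i ^^ n) v \<and> (d i ^^ n) u \<in> carrier U \<and> (d i ^^ n) v \<in> carrier U"
    if "u \<in> carrier U" "v \<in> carrier U" for i n u v
    using that by (induction n) (auto simp: d_add d_closed)
  have "fold (\<lambda>i. d i ^^ g i) xs (u \<oplus>\<^bsub>U\<^esub> v) = fold (\<lambda>i. d i ^^ g i) xs u \<oplus>\<^bsub>U\<^esub> fold (\<lambda>i. d i ^^ g i) xs v" for g xs
    using uv by (induction xs arbitrary: u v) (simp_all add: 1)
  then show ?thesis by (simp add: partial_power_def)
qed

lemma wact_add_right: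
  assumes "u \<in> carrier U" "v \<in> carrier U"
  shows "weyl_act U d P (u \<oplus>\<^bsub>U\<^esub> v) = weyl_act U d P u \<oplus>\<^bsub>U\<^esub> weyl_act U d P v"
proof (induction P rule: poly_mapping_add_induct)
  case zero
  then show ?case by (simp add: wact_zero)
next
  case (single \<beta> p)
  then show ?case using assms by (simp add: wact_single pp_add smult_r_distr)
next
  case (add P Q)
  then show ?case using assms by (simp add: wact_add_left M.a_ac)
qed

lemma wact_const: "u \<in> carrier U \<Longrightarrow> weyl_act U d (weyl_const p) u = p \<odot>\<^bsub>U\<^esub> u"
  by (simp add: weyl_const_def wact_single)

lemma wact_smult_left:
  assumes u: "u \<in> carrier U"
  shows "weyl_act U d (Poly_Mapping.single 0 p * Q) u = p \<odot>\<^bsub>U\<^esub> weyl_act U d Q u"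
proof (induction Q rule: poly_mapping_add_induct)
  case (single \<beta> q)
  then show ?case using u smult_assoc1[of p q "partial_power d \<beta> u"] by (simp add: wact_single mult_single)
next
  case (add P Q)
  then show ?case using u by (simp add: wact_add_left distrib_left smult_r_distr)
qed (simp add: wact_zero)

text \<open>
  This is where the relation \<open>\<partial>\<^sub>i q = q \<partial>\<^sub>i + \<partial>q/\<partial>x\<^sub>i\<close>, built into \<open>weyl_left_partial\<close>, meets the
  Leibniz rule of the module.
\<close>

lemma wact_left_partial:
  assumes u: "u \<in> carrier U"
  shows "weyl_act U d (weyl_left_partial i Q) u = d i (weyl_act U d Q u)"
proof (induction Q rule: poly_mapping_add_induct)
  case zero
  then show ?case using additive_zero[OF M.abelian_group_axioms M.abelian_group_axioms additive_d]
    by (simp add: wact_zero weyl_left_partial_def)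
next
  case (single \<beta> q)
  then show ?case using u d_closed[of "partial_power d \<beta> u" i]
    by (simp add: wact_single weyl_left_partial_single wact_add_left pp_add_single[simplified] d_smult M.a_comm)
next
  case (add P Q)
  then show ?case using u by (simp add: wact_add_left weyl_left_partial_add d_add)
qed

text \<open>
  For fixed \<open>u\<close>, the map \<open>Q \<mapsto> Q u\<close> from the Weyl algebra to \<open>U\<close> commutes with \<open>K[x]\<close> and with left
  multiplication by the \<open>\<partial>\<^sub>i\<close>, hence with \<open>P\<close>.
\<close>

lemma wact_mult: "u \<in> carrier U \<Longrightarrow> weyl_act U d (P \<otimes>\<^bsub>Weyl\<^esub> Q) u = weyl_act U d P (weyl_act U d Q u)"
  unfolding Weyl_simps
  by (rule weyl_act_intertwine[where H = "\<lambda>Q. weyl_act U d Q u"])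
    (auto simp: module_weyl_free module_axioms wact_smult_left wact_left_partial wact_add_left intro: additiveI)

end

lemma weyl_free_act_single:
  "weyl_act weyl_free weyl_left_partial (Poly_Mapping.single \<beta> p) Q = Poly_Mapping.single 0 p * partial_power weyl_left_partial \<beta> Q"
proof -
  interpret module Kx weyl_free by (rule module_weyl_free)
  show ?thesis unfolding weyl_act_coeff_sum by (subst coeff_sum_single) simp_all
qed

lemma Weyl_const_mult: "weyl_const p \<otimes>\<^bsub>Weyl\<^esub> Q = Poly_Mapping.single 0 p * Q"
  by (simp add: weyl_const_def weyl_free_act_single)

lemma Weyl_partial_mult: "weyl_partial i \<otimes>\<^bsub>Weyl\<^esub> Q = weyl_left_partial i Q"
  by (simp add: weyl_partial_def weyl_free_act_single partial_power_def)

lemma weyl_left_partial_0 [simp]: "weyl_left_partial i 0 = 0"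
  by (simp add: weyl_left_partial_def)

lemma weyl_left_partial_const_mult:
  "weyl_left_partial i (Poly_Mapping.single 0 p * Q) =
    Poly_Mapping.single 0 (mderiv i p) * Q + Poly_Mapping.single 0 p * weyl_left_partial i Q"
  by (induction Q rule: poly_mapping_add_induct)
    (simp_all add: weyl_left_partial_single weyl_left_partial_add mult_single derivation_mult[OF derivation_mderiv]
      single_add algebra_simps)

lemma weyl_left_partial_commute: "weyl_left_partial i (weyl_left_partial j Q) = weyl_left_partial j (weyl_left_partial i Q)"
  by (induction Q rule: poly_mapping_add_induct)
    (simp_all add: weyl_left_partial_single weyl_left_partial_add mderiv_commute[of i j] add_ac)

lemma kx_diff_module_weyl_free: "kx_diff_module weyl_free weyl_left_partial"
  by (intro kx_diff_module.intro diff_module.intro module_weyl_free diff_module_axioms.intro)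
    (auto intro: additiveI weyl_left_partial_commute simp: weyl_left_partial_add weyl_left_partial_const_mult)

interpretation weyl_free: kx_diff_module weyl_free weyl_left_partial
  by (rule kx_diff_module_weyl_free)

text \<open>
  Multiplying 1 from the left by derivatives only produces normal forms without correction terms,
  since 1 has derivative zero.  It follows that 1 is a right unit of the Weyl algebra.
\<close>

lemma partial_power_weyl_left_partial:
  "partial_power weyl_left_partial \<beta> 1 = (Poly_Mapping.single \<beta> 1 :: ('n::linorder, 'k::field_char_0) weyl)"
proof -
  have "partial_power weyl_left_partial (\<alpha> + \<beta>) 1 = Poly_Mapping.single (\<alpha> + \<beta>) (1 :: ('n, 'k) mpoly)"
    if "partial_power weyl_left_partial \<alpha> 1 = Poly_Mapping.single \<alpha> (1 :: ('n, 'k) mpoly)" for \<alpha>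
    using that
  proof (induction \<beta> arbitrary: \<alpha> rule: poly_mapping_add_induct)
    case (single i n)
    then show ?case
    proof (induction n)
      case (Suc n)
      have eq: "\<alpha> + Poly_Mapping.single i (Suc n) = (\<alpha> + Poly_Mapping.single i n) + Poly_Mapping.single i 1"
        by (simp add: add.assoc single_add[symmetric])
      show ?case unfolding eq
        using Suc by (subst weyl_free.pp_add_single)
          (simp_all add: weyl_left_partial_single derivation_1[OF derivation_mderiv])
    qed simp
  next
    case (add p q)
    then show ?case by (simp add: add.assoc[symmetric])
  qed simp
  from this[of 0] show ?thesis by simp
qed

text \<open>
  The Weyl algebra acts on itself, so associativity and distributivity are the corresponding laws of
  that action.
\<close>

lemma ring_Weyl: "ring Weyl"
proof (rule ringI)
  show "abelian_group Weyl"
    by (rule comm_group_abelian_group[OF weyl_free.a_comm_group]) simp_all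
  have one: "weyl_const 1 = 1" by (simp add: weyl_const_def)
  have "P \<otimes>\<^bsub>Weyl\<^esub> 1 = P" for P
    by (induction P rule: poly_mapping_add_induct)
      (simp_all add: weyl_free.wact_zero[simplified] weyl_free.wact_add_left[simplified] weyl_free_act_single
        partial_power_weyl_left_partial mult_single)
  then show "monoid Weyl"
    by (intro monoidI) (use weyl_free.wact_mult in
      \<open>simp_all add: one weyl_free_act_single[of 0 1, simplified]\<close>)
qed (simp_all add: weyl_free.wact_add_left[simplified] weyl_free.wact_add_right[simplified])

lemma weyl_const_hom: "weyl_const \<in> ring_hom Kx Weyl"
  by (rule ring_hom_memI) (simp_all add: Weyl_const_mult del: Weyl_simps(2), simp_all add: weyl_const_def mult_single single_add)

definition weyl_base :: "(('n::linorder, 'k::field_char_0) weyl, 'm) module \<Rightarrow> (('n, 'k) mpoly, 'm) module"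
  where "weyl_base M = restrict_scalars weyl_const M"

text \<open>
  The Leibniz rule and the commutation of the \<open>\<partial>\<^sub>i\<close> on a left module are the relations
  \<open>\<partial>\<^sub>i p = p \<partial>\<^sub>i + \<partial>p/\<partial>x\<^sub>i\<close> and \<open>\<partial>\<^sub>i \<partial>\<^sub>j = \<partial>\<^sub>j \<partial>\<^sub>i\<close> of the Weyl algebra.
\<close>

lemma diff_module_weyl_base:
  fixes M :: "(('n::linorder, 'k::field_char_0) weyl, 'm) module"
  assumes "left_module Weyl M"
  shows "diff_module Kx (weyl_base M) mderiv (\<lambda>i. smult M (weyl_partial i))"
proof -
  interpret M: left_module Weyl M by fact
  have "left_module Kx (weyl_base M)"
    unfolding weyl_base_def by (rule left_module_restrict_scalars[OF assms cring.axioms(1)[OF cring_Kx] weyl_const_hom])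
  then have 1: "module Kx (weyl_base M)" by (simp add: module_iff_left_module cring_Kx)
  show ?thesis
  proof (intro diff_module.intro 1 diff_module_axioms.intro)
    show "additive_map (weyl_base M) (weyl_base M) (smult M (weyl_partial i))" for i
      by (rule additiveI) (simp_all add: weyl_base_def M.smult_closed M.smult_r_distr)
    show "weyl_partial i \<odot>\<^bsub>M\<^esub> (p \<odot>\<^bsub>weyl_base M\<^esub> u) =
        mderiv i p \<odot>\<^bsub>weyl_base M\<^esub> u \<oplus>\<^bsub>weyl_base M\<^esub> p \<odot>\<^bsub>weyl_base M\<^esub> (weyl_partial i \<odot>\<^bsub>M\<^esub> u)"
      if "u \<in> carrier (weyl_base M)" for i p u
    proof -
      have "weyl_partial i \<otimes>\<^bsub>Weyl\<^esub> weyl_const p = weyl_const (mderiv i p) \<oplus>\<^bsub>Weyl\<^esub> (weyl_const p \<otimes>\<^bsub>Weyl\<^esub> weyl_partial i)"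
        unfolding Weyl_partial_mult Weyl_const_mult
        by (simp add: weyl_const_def weyl_partial_def weyl_left_partial_single mult_single)
      then show ?thesis
        using that M.smult_assoc[of "weyl_partial i" "weyl_const p" u] M.smult_assoc[of "weyl_const p" "weyl_partial i" u]
          M.smult_l_distr[of "weyl_const (mderiv i p)" "weyl_const p \<otimes>\<^bsub>Weyl\<^esub> weyl_partial i" u]
        by (simp add: weyl_base_def del: Weyl_simps(2,5))
    qed
    show "weyl_partial i \<odot>\<^bsub>M\<^esub> (weyl_partial j \<odot>\<^bsub>M\<^esub> u) = weyl_partial j \<odot>\<^bsub>M\<^esub> (weyl_partial i \<odot>\<^bsub>M\<^esub> u)"
      if "u \<in> carrier (weyl_base M)" for i j u
    proof -
      have "(weyl_partial i :: ('n, 'k) weyl) \<otimes>\<^bsub>Weyl\<^esub> weyl_partial j = weyl_partial j \<otimes>\<^bsub>Weyl\<^esub> weyl_partial i"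
        unfolding Weyl_partial_mult
        by (simp add: weyl_partial_def weyl_left_partial_single derivation_1[OF derivation_mderiv] add.commute)
      then show ?thesis
        using that M.smult_assoc[of "weyl_partial i" "weyl_partial j" u, symmetric]
          M.smult_assoc[of "weyl_partial j" "weyl_partial i" u, symmetric]
        by (simp add: weyl_base_def del: Weyl_simps(2))
    qed
  qed simp
qed

section \<open>Localization at \<open>f\<close>\<close>

lemma carrier_Kxf: "carrier (Kxf f) = {Fract p (f ^ k) | p k. True}"
  by (simp add: Kxf_def)

lemma Kxf_simps [simp]: "mult (Kxf f) = (*)" "one (Kxf f) = 1" "zero (Kxf f) = 0" "add (Kxf f) = (+)"
  by (simp_all add: Kxf_def)

lemma KxfI: "Fract p (f ^ k) \<in> carrier (Kxf f)"
  unfolding carrier_Kxf by blast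

lemma KxfE:
  assumes "g \<in> carrier (Kxf f)"
  obtains p k where "g = Fract p (f ^ k)"
  using assms unfolding carrier_Kxf by blast

lemma to_fract_Kxf [simp]: "to_fract p \<in> carrier (Kxf f)"
  using KxfI[of p f 0] by (simp add: to_fract_def)

lemma Kxf_0 [simp]: "0 \<in> carrier (Kxf f)" and Kxf_1 [simp]: "1 \<in> carrier (Kxf f)"
  using to_fract_Kxf[of 0 f] to_fract_Kxf[of 1 f] by simp_all

locale localization =
  fixes f :: "('n::linorder, 'k::field_char_0) mpoly"
  assumes f_nonzero [simp]: "f \<noteq> 0"
begin

lemma Kxf_mult [simp]: "g \<in> carrier (Kxf f) \<Longrightarrow> h \<in> carrier (Kxf f) \<Longrightarrow> g * h \<in> carrier (Kxf f)"
  by (elim KxfE) (simp add: power_add[symmetric] KxfI)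

lemma Kxf_minus [simp]: "g \<in> carrier (Kxf f) \<Longrightarrow> - g \<in> carrier (Kxf f)"
  by (elim KxfE) (simp add: KxfI)

lemma Kxf_add [simp]: "g \<in> carrier (Kxf f) \<Longrightarrow> h \<in> carrier (Kxf f) \<Longrightarrow> g + h \<in> carrier (Kxf f)"
  by (elim KxfE) (simp add: power_add[symmetric] KxfI)

lemma cring_Kxf: "cring (Kxf f)"
proof -
  have "cring (subring_of_type (carrier (Kxf f)))" by (rule cring_subring_of_type) simp_all
  then show ?thesis by (simp add: Kxf_def)
qed

lemma x_deriv_Kxf [simp]: "g \<in> carrier (Kxf f) \<Longrightarrow> x_deriv i g \<in> carrier (Kxf f)"
  unfolding x_deriv_def
  by (elim KxfE) (simp add: fract_deriv_Fract[OF derivation_mderiv] power_add[symmetric] KxfI)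

lemma to_fract_hom: "to_fract \<in> ring_hom Kx (Kxf f)"
  by (rule ring_hom_memI) simp_all

lemma inverse_f_Kxf [simp]: "inverse (to_fract f) \<in> carrier (Kxf f)"
  using KxfI[of 1 f 1] by (simp add: to_fract_def)

lemma Kxf_over_Kx_simps [simp]:
  "carrier (Kxf_over_Kx f) = carrier (Kxf f)" "add (Kxf_over_Kx f) = (+)" "zero (Kxf_over_Kx f) = 0"
  "p \<odot>\<^bsub>Kxf_over_Kx f\<^esub> g = to_fract p * g"
  by (simp_all add: Kxf_over_Kx_def regular_module_def)

lemma diff_module_Kxf_over_Kx: "diff_module Kx (Kxf_over_Kx f) mderiv x_deriv"
proof -
  interpret cring "Kxf f" by (rule cring_Kxf)
  have "left_module Kx (Kxf_over_Kx f)"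
    unfolding Kxf_over_Kx_def
    by (intro left_module_restrict_scalars[OF left_module_regular] ring_axioms cring.axioms(1)[OF cring_Kx] to_fract_hom)
  then have 1: "module Kx (Kxf_over_Kx f)" by (simp add: module_iff_left_module cring_Kx)
  show ?thesis
    by (intro diff_module.intro 1 diff_module_axioms.intro)
      (auto intro: additiveI x_deriv_commute simp: x_deriv_to_fract derivation_add[OF derivation_x_deriv]
        derivation_mult[OF derivation_x_deriv])
qed

lemma diff_module_Kxf_regular: "diff_module (Kxf f) (with_smult (Kxf_over_Kx f) (*)) x_deriv x_deriv"
proof -
  interpret cring "Kxf f" by (rule cring_Kxf)
  have 1: "module (Kxf f) (with_smult (Kxf_over_Kx f) (*))"
    by (rule moduleI) (auto simp: cring_Kxf algebra_simps intro: comm_group_abelian_group[OF a_comm_group])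
  show ?thesis
    by (intro diff_module.intro 1 diff_module_axioms.intro)
      (auto intro: additiveI x_deriv_commute simp: derivation_add[OF derivation_x_deriv]
        derivation_mult[OF derivation_x_deriv])
qed

end

lemma localize_conv: "localize f M =
    with_smult (tensor_group Kx (Kxf_over_Kx f) (weyl_base M)) (\<lambda>g. tensor_left Kx (Kxf_over_Kx f) (weyl_base M) ((*) g))"
  by (simp add: localize_def weyl_base_def Let_def)

lemma localize_partial_conv:
  "localize_partial f M = (\<lambda>i. tensor_leibniz Kx (Kxf_over_Kx f) (weyl_base M) (x_deriv i) (smult M (weyl_partial i)))"
  by (simp add: localize_partial_def weyl_base_def fun_eq_iff)

lemma localize_elt_conv: "localize_elt f M = tensor_elt Kx (Kxf_over_Kx f) (weyl_base M)"
  by (simp add: localize_elt_def weyl_base_def fun_eq_iff)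

locale localized_weyl_module = localization f
  for f :: "('n::linorder, 'k::field_char_0) mpoly" +
  fixes M :: "(('n, 'k) weyl, 'm) module"
  assumes left_module_M: "left_module Weyl M"
begin

sublocale M: left_module Weyl M by (rule left_module_M)

interpretation A: diff_module Kx "Kxf_over_Kx f" mderiv x_deriv by (rule diff_module_Kxf_over_Kx)
interpretation B: diff_module Kx "weyl_base M" mderiv "\<lambda>i. smult M (weyl_partial i)"
  by (rule diff_module_weyl_base[OF left_module_M])

sublocale tensor: tensor_product Kx "Kxf_over_Kx f" "weyl_base M" ..

lemma diff_module_localize: "diff_module (Kxf f) (localize f M) x_deriv (localize_partial f M)"
  unfolding localize_conv localize_partial_conv
  by (rule diff_module_tensor_group[OF diff_module_Kxf_over_Kx diff_module_weyl_base[OF left_module_M]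
    diff_module_Kxf_regular]) (simp add: mult.left_commute)

lemma carrier_weyl_base [simp]: "carrier (weyl_base M) = carrier M" "add (weyl_base M) = add M" "zero (weyl_base M) = zero M"
  by (simp_all add: weyl_base_def)

lemma localize_simps:
  "carrier (localize f M) = carrier (tensor_group Kx (Kxf_over_Kx f) (weyl_base M))"
  "add (localize f M) = add (tensor_group Kx (Kxf_over_Kx f) (weyl_base M))"
  by (simp_all add: localize_conv)

lemma localize_elt_closed [simp]:
  "g \<in> carrier (Kxf f) \<Longrightarrow> m \<in> carrier M \<Longrightarrow> localize_elt f M g m \<in> carrier (localize f M)"
  unfolding localize_elt_conv localize_simps by (rule tensor.elt_closed) simp_all

lemma localize_elt_add_right:
  "\<lbrakk>g \<in> carrier (Kxf f); m \<in> carrier M; n \<in> carrier M\<rbrakk> \<Longrightarrow>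
    localize_elt f M g (m \<oplus>\<^bsub>M\<^esub> n) = localize_elt f M g m \<oplus>\<^bsub>localize f M\<^esub> localize_elt f M g n"
  unfolding localize_elt_conv localize_simps using tensor.elt_add_right[of g m n] by simp

lemma localize_elt_balanced:
  "\<lbrakk>g \<in> carrier (Kxf f); m \<in> carrier M\<rbrakk> \<Longrightarrow>
    localize_elt f M (to_fract p * g) m = localize_elt f M g (weyl_const p \<odot>\<^bsub>M\<^esub> m)"
  unfolding localize_elt_conv using tensor.elt_balanced[of p g m] by (simp add: weyl_base_def)

lemma localize_smult_elt:
  "\<lbrakk>h \<in> carrier (Kxf f); g \<in> carrier (Kxf f); m \<in> carrier M\<rbrakk> \<Longrightarrow>
    h \<odot>\<^bsub>localize f M\<^esub> localize_elt f M g m = localize_elt f M (h * g) m"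
  unfolding localize_elt_conv localize_conv with_smult_simps
  by (rule tensor_scalar_elt[OF diff_module_Kxf_over_Kx diff_module_weyl_base[OF left_module_M]
    diff_module_Kxf_regular]) (simp_all add: mult.left_commute)

lemma localize_partial_elt:
  "\<lbrakk>g \<in> carrier (Kxf f); m \<in> carrier M\<rbrakk> \<Longrightarrow>
    localize_partial f M i (localize_elt f M g m) =
      localize_elt f M (x_deriv i g) m \<oplus>\<^bsub>localize f M\<^esub> localize_elt f M g (weyl_partial i \<odot>\<^bsub>M\<^esub> m)"
  unfolding localize_elt_conv localize_simps localize_partial_conv
  by (rule tensor_leibniz_elt[OF diff_module_Kxf_over_Kx diff_module_weyl_base[OF left_module_M]
    diff_module_Kxf_regular]) (simp_all add: mult.left_commute)

lemma localize_induct [consumes 1, case_names elt add]: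
  assumes "x \<in> carrier (localize f M)"
    and "\<And>g m. g \<in> carrier (Kxf f) \<Longrightarrow> m \<in> carrier M \<Longrightarrow> P (localize_elt f M g m)"
    and "\<And>x y. \<lbrakk>x \<in> carrier (localize f M); y \<in> carrier (localize f M); P x; P y\<rbrakk> \<Longrightarrow> P (x \<oplus>\<^bsub>localize f M\<^esub> y)"
  shows "P x"
  using assms(1) unfolding localize_simps
proof (induction x rule: tensor.T_induct)
  case (elt a b)
  then show ?case using assms(2)[of a b] by (simp add: localize_elt_conv)
next
  case (add x y)
  then show ?case using assms(3)[of x y] by (simp add: localize_simps)
qed

end

section \<open>The localized Weyl algebra and its modules\<close>

context localization
begin

abbreviation "D \<equiv> regular_module (Weyl :: ('n, 'k) weyl ring)"

sublocale DX: localized_weyl_module f D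
  by (intro localized_weyl_module.intro localized_weyl_module_axioms.intro localization_axioms
      left_module_regular[OF ring_Weyl])

lemma D_simps [simp]: "carrier D = UNIV" "add D = (+)" "zero D = 0" "P \<odot>\<^bsub>D\<^esub> Q = P \<otimes>\<^bsub>Weyl\<^esub> Q"
  by (simp_all add: regular_module_def)

lemma Weyl_loc_simps [simp]:
  "carrier (Weyl_loc f) = carrier (localize f D)" "add (Weyl_loc f) = add (localize f D)"
  "zero (Weyl_loc f) = zero (localize f D)" "one (Weyl_loc f) = localize_elt f D 1 (weyl_const 1)"
  "mult (Weyl_loc f) = weyl_loc_act (localize f D) (localize_partial f D)"
  by (simp_all add: Weyl_loc_def Let_def)

end

locale kxf_diff_module = localization f + diff_module "Kxf f" U x_deriv d
  for f :: "('n::linorder, 'k::field_char_0) mpoly"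
    and U :: "(('n, 'k) mpoly fract, 'u, 'b) module_scheme" and d :: "'n \<Rightarrow> 'u \<Rightarrow> 'u"
begin

abbreviation "U0 \<equiv> restrict_scalars (to_fract :: ('n, 'k) mpoly \<Rightarrow> _) U"

lemma kx_diff_module_U0: "kx_diff_module U0 d"
proof (intro kx_diff_module.intro diff_module.intro diff_module_axioms.intro)
  have "left_module (Kxf f) U" using module_axioms by (simp add: module_iff_left_module)
  then have "left_module Kx U0"
    by (rule left_module_restrict_scalars[OF _ cring.axioms(1)[OF cring_Kx] to_fract_hom])
  then show "module Kx U0" by (simp add: module_iff_left_module cring_Kx)
  show "additive_map U0 U0 (d i)" for i using additive_d[of i] by (simp add: additive_map_def)
qed (simp_all add: d_smult x_deriv_to_fract d_commute)

sublocale U0: kx_diff_module U0 d by (rule kx_diff_module_U0)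

text \<open>
  \<open>(p g) (P u) = g ((p P) u)\<close>, which is what is needed for \<open>g \<otimes> P\<close> to act by \<open>u \<mapsto> g (P u)\<close>.
\<close>

lemma act_balanced:
  assumes u: "u \<in> carrier U"
  shows "balanced Kx (Kxf_over_Kx f) (weyl_base D) U (\<lambda>g P. g \<odot>\<^bsub>U\<^esub> weyl_act U0 d P u)"
  unfolding balanced_def
proof (intro conjI ballI)
  note [simp] = U0.wact_closed[simplified]
  fix P show "additive_map (Kxf_over_Kx f) U (\<lambda>g. g \<odot>\<^bsub>U\<^esub> weyl_act U0 d P u)"
    by (rule additiveI) (use u smult_l_distr in auto)
next
  note [simp] = U0.wact_closed[simplified]
  fix g assume g: "g \<in> carrier (Kxf_over_Kx f)"
  show "additive_map (weyl_base D) U (\<lambda>P. g \<odot>\<^bsub>U\<^esub> weyl_act U0 d P u)"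
    by (rule additiveI) (use u g smult_r_distr U0.wact_add_left in auto)
next
  fix p g P assume "g \<in> carrier (Kxf_over_Kx f)"
  then show "(p \<odot>\<^bsub>Kxf_over_Kx f\<^esub> g) \<odot>\<^bsub>U\<^esub> weyl_act U0 d P u = g \<odot>\<^bsub>U\<^esub> weyl_act U0 d (p \<odot>\<^bsub>weyl_base D\<^esub> P) u"
    using u U0.wact_closed[of u P] U0.wact_smult_left[of u p P] smult_assoc1[of g "to_fract p" "weyl_act U0 d P u"]
    by (simp add: weyl_base_def Weyl_const_mult mult.commute del: Weyl_simps(2))
qed

lemma lact_conv: "weyl_loc_act U d C u = tensor_lift U (\<lambda>(g, P). g \<odot>\<^bsub>U\<^esub> weyl_act U0 d P u) C"
  by (simp add: weyl_loc_act_def)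

lemma lact_additive_left: "u \<in> carrier U \<Longrightarrow> additive_map (localize f D) U (\<lambda>C. weyl_loc_act U d C u)"
  unfolding lact_conv using DX.tensor.additive_tensor_lift[OF M.abelian_group_axioms act_balanced, of u]
  by (simp add: additive_map_def DX.localize_simps)

lemmas lact_closed [simp] = additive_closed[OF lact_additive_left]
lemmas lact_add_left = additive_add[OF lact_additive_left]

lemma lact_elt: "\<lbrakk>u \<in> carrier U; g \<in> carrier (Kxf f)\<rbrakk> \<Longrightarrow>
    weyl_loc_act U d (localize_elt f D g P) u = g \<odot>\<^bsub>U\<^esub> weyl_act U0 d P u"
  unfolding lact_conv localize_elt_conv
  using DX.tensor.tensor_lift_elt[OF M.abelian_group_axioms act_balanced, of u g P] by simp

lemma lact_additive_right:
  assumes C: "C \<in> carrier (localize f D)"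
  shows "additive_map U U (weyl_loc_act U d C)"
proof (rule additiveI)
  fix u v assume uv: "u \<in> carrier U" "v \<in> carrier U"
  show "weyl_loc_act U d C (u \<oplus>\<^bsub>U\<^esub> v) = weyl_loc_act U d C u \<oplus>\<^bsub>U\<^esub> weyl_loc_act U d C v"
    using C
  proof (induction C rule: DX.localize_induct)
    case (elt g P)
    then show ?case using uv U0.wact_closed[of u P] U0.wact_closed[of v P] U0.wact_add_right[of u v P]
      by (simp add: lact_elt smult_r_distr)
  next
    case (add C C')
    then show ?case using uv by (simp add: lact_add_left M.a_ac)
  qed
qed (use C in simp)

lemmas lact_add_right = additive_add[OF lact_additive_right]

lemma lact_smult:
  assumes "C \<in> carrier (localize f D)" "u \<in> carrier U" "g \<in> carrier (Kxf f)"
  shows "weyl_loc_act U d (g \<odot>\<^bsub>localize f D\<^esub> C) u = g \<odot>\<^bsub>U\<^esub> weyl_loc_act U d C u"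
proof -
  interpret L: diff_module "Kxf f" "localize f D" x_deriv "localize_partial f D" by (rule DX.diff_module_localize)
  show ?thesis using assms(1)
  proof (induction C rule: DX.localize_induct)
    case (elt h P)
    then show ?case using assms U0.wact_closed[of u P] smult_assoc1[of g h "weyl_act U0 d P u"]
      by (simp add: lact_elt DX.localize_smult_elt)
  next
    case (add C C')
    then show ?case using assms by (simp add: lact_add_left L.smult_r_distr smult_r_distr)
  qed
qed

text \<open>
  On \<open>h \<otimes> P\<close> both sides are \<open>(\<partial>h/\<partial>x\<^sub>i) (P u) + h \<partial>\<^sub>i (P u)\<close>.
\<close>

lemma lact_partial:
  assumes "C \<in> carrier (localize f D)" "u \<in> carrier U"
  shows "weyl_loc_act U d (localize_partial f D i C) u = d i (weyl_loc_act U d C u)"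
proof -
  interpret L: diff_module "Kxf f" "localize f D" x_deriv "localize_partial f D" by (rule DX.diff_module_localize)
  show ?thesis using assms(1)
  proof (induction C rule: DX.localize_induct)
    case (elt h P)
    then show ?case using assms U0.wact_closed[of u P] U0.wact_left_partial[of u i P]
      by (simp add: DX.localize_partial_elt lact_add_left lact_elt d_smult Weyl_partial_mult del: Weyl_simps(2))
  next
    case (add C C')
    then show ?case using assms by (simp add: lact_add_left L.d_add d_add L.d_closed)
  qed
qed

end

text \<open>
  Commuting with the generators suffices to commute with all of \<open>D\<^sub>X[f\<^sup>-\<^sup>1]\<close>: on \<open>g \<otimes> P\<close> the scalar
  \<open>g\<close> is taken out by linearity, and \<open>P\<close> is covered by \<open>weyl_act_intertwine\<close>.
\<close>

lemma weyl_loc_act_intertwine: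
  assumes U: "kxf_diff_module f U d" and V: "kxf_diff_module f V d'" and H: "additive_map U V H"
    and lin: "\<And>g u. g \<in> carrier (Kxf f) \<Longrightarrow> u \<in> carrier U \<Longrightarrow> H (g \<odot>\<^bsub>U\<^esub> u) = g \<odot>\<^bsub>V\<^esub> H u"
    and d: "\<And>i u. u \<in> carrier U \<Longrightarrow> H (d i u) = d' i (H u)"
    and C: "C \<in> carrier (localize f (regular_module Weyl))" and u: "u \<in> carrier U"
  shows "H (weyl_loc_act U d C u) = weyl_loc_act V d' C (H u)"
proof -
  interpret U: kxf_diff_module f U d by fact
  interpret V: kxf_diff_module f V d' by fact
  note Hc = additive_closed[OF H]
  show ?thesis using C
  proof (induction C rule: U.DX.localize_induct)
    case (elt g P)
    have "H (weyl_act U.U0 d P u) = weyl_act V.U0 d' P (H u)"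
      by (rule weyl_act_intertwine[OF U.U0.module_axioms V.U0.module_axioms])
        (use H lin d u U.d_closed in \<open>auto simp: additive_map_def\<close>)
    then show ?case using elt u U.U0.wact_closed[of u P] by (simp add: U.lact_elt V.lact_elt Hc lin)
  next
    case (add C C')
    then show ?case using u by (simp add: U.lact_add_left V.lact_add_left Hc additive_add[OF H])
  qed
qed

context localization
begin

lemma kxf_diff_module_DX: "kxf_diff_module f (localize f D) (localize_partial f D)"
  by (intro kxf_diff_module.intro localization_axioms DX.diff_module_localize)

sublocale L: kxf_diff_module f "localize f D" "localize_partial f D"
  by (rule kxf_diff_module_DX)

end

context kxf_diff_module
begin

text \<open>
  For fixed \<open>u\<close>, the map \<open>C' \<mapsto> C' u\<close> from \<open>D\<^sub>X[f\<^sup>-\<^sup>1]\<close> to \<open>U\<close> commutes with scalars (\<open>lact_smult\<close>) and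
  with the \<open>\<partial>\<^sub>i\<close> (\<open>lact_partial\<close>), hence with \<open>C\<close>.
\<close>

lemma lact_mult:
  assumes "C \<in> carrier (localize f D)" "C' \<in> carrier (localize f D)" "u \<in> carrier U"
  shows "weyl_loc_act U d (C \<otimes>\<^bsub>Weyl_loc f\<^esub> C') u = weyl_loc_act U d C (weyl_loc_act U d C' u)"
  unfolding Weyl_loc_simps
  by (rule weyl_loc_act_intertwine[where H = "\<lambda>C'. weyl_loc_act U d C' u"])
    (use assms in \<open>simp_all add: kxf_diff_module_DX kxf_diff_module_axioms lact_additive_left lact_smult lact_partial\<close>)

lemma lact_one: "u \<in> carrier U \<Longrightarrow> weyl_loc_act U d \<one>\<^bsub>Weyl_loc f\<^esub> u = u"
  using U0.wact_const[of u 1] U0.smult_one[of u] by (simp add: lact_elt)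

end

context localization
begin

text \<open>
  \<open>Q \<mapsto> 1 \<otimes> Q\<close> commutes with the \<open>\<partial>\<^sub>i\<close> because the derivative of 1 vanishes.  The right unit law of
  \<open>D\<^sub>X[f\<^sup>-\<^sup>1]\<close> and the multiplicativity of \<open>D\<^sub>X \<rightarrow> D\<^sub>X[f\<^sup>-\<^sup>1]\<close> both rest on this.
\<close>

lemma weyl_act_localize_elt:
  "weyl_act L.U0 (localize_partial f D) P (localize_elt f D 1 Q) = localize_elt f D 1 (P \<otimes>\<^bsub>Weyl\<^esub> Q)"
proof -
  have "localize_elt f D 1 (weyl_act weyl_free weyl_left_partial P Q) =
      weyl_act L.U0 (localize_partial f D) P (localize_elt f D 1 Q)"
  proof (rule weyl_act_intertwine[OF module_weyl_free L.U0.module_axioms,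
        where H = "localize_elt f D 1" and d = weyl_left_partial and d' = "localize_partial f D"])
    show "additive_map weyl_free L.U0 (localize_elt f D 1)"
    proof (rule additiveI)
      show "localize_elt f D 1 (P \<oplus>\<^bsub>weyl_free\<^esub> Q) = localize_elt f D 1 P \<oplus>\<^bsub>L.U0\<^esub> localize_elt f D 1 Q" for P Q
        using DX.localize_elt_add_right[of 1 P Q] by simp
    qed simp
    show "localize_elt f D 1 (p \<odot>\<^bsub>weyl_free\<^esub> u) = p \<odot>\<^bsub>L.U0\<^esub> localize_elt f D 1 u" for p u
      using DX.localize_elt_balanced[of 1 u p]
      by (simp add: DX.localize_smult_elt Weyl_const_mult del: Weyl_simps(2))
    show "localize_elt f D 1 (weyl_left_partial i u) = localize_partial f D i (localize_elt f D 1 u)" for i u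
    proof -
      have "localize_elt f D 0 u = \<zero>\<^bsub>localize f D\<^esub>"
        using DX.tensor.elt_zero_left[of u] by (simp add: localize_elt_conv localize_conv)
      then show ?thesis
        by (simp add: DX.localize_partial_elt derivation_1[OF derivation_x_deriv] Weyl_partial_mult del: Weyl_simps(2))
    qed
  qed simp_all
  then show ?thesis by (simp only: Weyl_simps(2))
qed

lemma ring_Weyl_loc: "ring (Weyl_loc f)"
proof (rule ringI)
  show "abelian_group (Weyl_loc f)"
    by (rule comm_group_abelian_group[OF L.M.a_comm_group]) simp_all
  have "C \<otimes>\<^bsub>Weyl_loc f\<^esub> \<one>\<^bsub>Weyl_loc f\<^esub> = C" if "C \<in> carrier (localize f D)" for C
    using that
  proof (induction C rule: DX.localize_induct)
    case (elt g P)
    have "P \<otimes>\<^bsub>Weyl\<^esub> weyl_const 1 = P"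
      using ring.ring_simprules(12) monoid.r_one[OF ring.is_monoid[OF ring_Weyl], of P] by simp
    then show ?case using elt by (simp add: L.lact_elt weyl_act_localize_elt DX.localize_smult_elt del: Weyl_simps(2))
  next
    case (add C C')
    then show ?case by (simp add: L.lact_add_left)
  qed
  then show "monoid (Weyl_loc f)"
    by (intro monoidI) (use L.lact_mult L.lact_one in simp_all)
qed (simp_all add: L.lact_add_left L.lact_add_right)

lemma weyl_to_loc_hom: "weyl_to_loc f \<in> ring_hom Weyl (Weyl_loc f)"
proof (rule ring_hom_memI)
  fix P Q :: "('n, 'k) weyl"
  show "weyl_to_loc f (P \<otimes>\<^bsub>Weyl\<^esub> Q) = weyl_to_loc f P \<otimes>\<^bsub>Weyl_loc f\<^esub> weyl_to_loc f Q"
    by (simp add: weyl_to_loc_def L.lact_elt weyl_act_localize_elt DX.localize_smult_elt del: Weyl_simps(2))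
  show "weyl_to_loc f (P \<oplus>\<^bsub>Weyl\<^esub> Q) = weyl_to_loc f P \<oplus>\<^bsub>Weyl_loc f\<^esub> weyl_to_loc f Q"
    using DX.localize_elt_add_right[of 1 P Q] by (simp add: weyl_to_loc_def)
qed (simp_all add: weyl_to_loc_def)

end

lemma (in kxf_diff_module) left_module_weyl_loc: "left_module (Weyl_loc f) (with_smult U (weyl_loc_act U d))"
  by (intro left_module.intro ring_Weyl_loc abelian_group_with_smult M.abelian_group_axioms left_module_axioms.intro)
    (use lact_mult lact_one in \<open>simp_all add: lact_add_left lact_add_right\<close>)

section \<open>Rational functions in \<open>t\<close> with poles along \<open>tf = 1\<close>\<close>

lemma Kxtf_tf1_over_Kxf_simps [simp]:
  "carrier (Kxtf_tf1_over_Kxf f) = carrier (Kxtf_tf1 f)" "add (Kxtf_tf1_over_Kxf f) = (+)" "zero (Kxtf_tf1_over_Kxf f) = 0"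
  "g \<odot>\<^bsub>Kxtf_tf1_over_Kxf f\<^esub> z = to_fract [:g:] * z"
  by (simp_all add: Kxtf_tf1_over_Kxf_def regular_module_def Kxtf_tf1_def)

lemma Kxtf_tf1_simps [simp]: "mult (Kxtf_tf1 f) = (*)" "one (Kxtf_tf1 f) = 1" "zero (Kxtf_tf1 f) = 0" "add (Kxtf_tf1 f) = (+)"
  by (simp_all add: Kxtf_tf1_def)

definition Kxf_polys :: "('n::linorder, 'k::field_char_0) mpoly \<Rightarrow> ('n, 'k) mpoly fract poly set"
  where "Kxf_polys f = {p. \<forall>j. poly.coeff p j \<in> carrier (Kxf f)}"

lemma carrier_Kxtf: "carrier (Kxtf f) = to_fract ` Kxf_polys f"
  by (auto simp: Kxtf_def Kxf_polys_def to_fract_def)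

lemma Kxtf_tf1I: "p \<in> Kxf_polys f \<Longrightarrow> Fract p (tf1 f ^ k) \<in> carrier (Kxtf_tf1 f)"
  by (auto simp: Kxtf_tf1_def Kxf_polys_def)

lemma Kxtf_tf1E:
  assumes "z \<in> carrier (Kxtf_tf1 f)"
  obtains p k where "p \<in> Kxf_polys f" "z = Fract p (tf1 f ^ k)"
  using assms by (auto simp: Kxtf_tf1_def Kxf_polys_def)

lemma tf1_nonzero [simp]: "tf1 f \<noteq> 0"
  by (simp add: tf1_def)

context localization
begin

lemma Kxf_sum: "(\<And>i. i \<in> I \<Longrightarrow> g i \<in> carrier (Kxf f)) \<Longrightarrow> sum g I \<in> carrier (Kxf f)"
  by (induction I rule: infinite_finite_induct) auto

lemma Kxf_power: "g \<in> carrier (Kxf f) \<Longrightarrow> g ^ k \<in> carrier (Kxf f)"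
  by (induction k) auto

lemma Kxf_of_nat: "of_nat k \<in> carrier (Kxf f)"
  by (induction k) auto

text \<open>
  Positive integers are invertible in \<open>K\<close>, whose elements are the constant polynomials.
\<close>

lemma of_nat_unit_Kxf: "\<exists>s\<in>carrier (Kxf f). of_nat (Suc l) * s = 1"
proof -
  have of_nat: "to_fract (of_nat m) = (of_nat m :: ('n, 'k) mpoly fract)" for m
    by (induction m) simp_all
  have "of_nat (Suc l) * Poly_Mapping.single 0 (inverse (of_nat (Suc l))) = (1 :: ('n, 'k) mpoly)"
    by (simp only: single_of_nat[symmetric] mult_single) (simp del: of_nat_Suc)
  then have "to_fract (of_nat (Suc l) * Poly_Mapping.single 0 (inverse (of_nat (Suc l)))) = (1 :: ('n, 'k) mpoly fract)"
    by simp
  then show ?thesis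
    by (intro bexI[OF _ to_fract_Kxf]) (simp only: to_fract_mult of_nat)
qed

lemma Kxf_polys_arith:
  assumes "p \<in> Kxf_polys f" "q \<in> Kxf_polys f"
  shows "p + q \<in> Kxf_polys f" "p * q \<in> Kxf_polys f" "p - q \<in> Kxf_polys f"
  using assms Kxf_add[OF _ Kxf_minus] by (auto simp: Kxf_polys_def coeff_mult intro!: Kxf_sum)

lemma Kxf_polys_unary:
  assumes "p \<in> Kxf_polys f"
  shows "- p \<in> Kxf_polys f"
    "map_poly (x_deriv i) p \<in> Kxf_polys f" "pderiv p \<in> Kxf_polys f"
proof -
  show "- p \<in> Kxf_polys f" using assms by (auto simp: Kxf_polys_def)
  show "map_poly (x_deriv i) p \<in> Kxf_polys f"
    using assms by (auto simp: Kxf_polys_def coeff_map_poly derivation_0[OF derivation_x_deriv])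
  show "pderiv p \<in> Kxf_polys f"
    using assms Kxf_of_nat[of "Suc k" for k] by (auto simp: Kxf_polys_def coeff_pderiv simp del: of_nat_Suc)
qed

lemmas Kxf_polys_closed = Kxf_polys_arith Kxf_polys_unary

lemma Kxf_polys_pCons [simp]: "pCons a p \<in> Kxf_polys f \<longleftrightarrow> a \<in> carrier (Kxf f) \<and> p \<in> Kxf_polys f"
  by (auto simp: Kxf_polys_def coeff_pCons split: nat.splits)

lemma Kxf_polys_0 [simp]: "0 \<in> Kxf_polys f" and Kxf_polys_1 [simp]: "1 \<in> Kxf_polys f"
  by (auto simp: Kxf_polys_def one_pCons coeff_pCons split: nat.splits)

lemma tf1_Kxf_polys: "tf1 f ^ k \<in> Kxf_polys f"
proof -
  have "tf1 f \<in> Kxf_polys f" by (simp add: tf1_def)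
  then show ?thesis by (induction k) (simp_all add: Kxf_polys_closed)
qed

lemma Kxtf_subset: "carrier (Kxtf f) \<subseteq> carrier (Kxtf_tf1 f)"
  using Kxtf_tf1I[of _ f 0] by (auto simp: carrier_Kxtf to_fract_def)

lemma Kxtf_tf1_arith:
  assumes "z \<in> carrier (Kxtf_tf1 f)" "w \<in> carrier (Kxtf_tf1 f)"
  shows "z + w \<in> carrier (Kxtf_tf1 f)" "z * w \<in> carrier (Kxtf_tf1 f)"
proof -
  obtain p k where z: "p \<in> Kxf_polys f" "z = Fract p (tf1 f ^ k)" using assms(1) by (rule Kxtf_tf1E)
  obtain q l where w: "q \<in> Kxf_polys f" "w = Fract q (tf1 f ^ l)" using assms(2) by (rule Kxtf_tf1E)
  note [simp] = Kxf_polys_closed tf1_Kxf_polys z(1) w(1)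
  show "z + w \<in> carrier (Kxtf_tf1 f)" "z * w \<in> carrier (Kxtf_tf1 f)"
    using Kxtf_tf1I[of "p * tf1 f ^ l + q * tf1 f ^ k" f "k + l"] Kxtf_tf1I[of "p * q" f "k + l"]
    by (simp_all add: z(2) w(2) power_add)
qed

lemma Kxtf_tf1_unary:
  assumes "z \<in> carrier (Kxtf_tf1 f)"
  shows "- z \<in> carrier (Kxtf_tf1 f)" "xt_dx i z \<in> carrier (Kxtf_tf1 f)" "xt_dt z \<in> carrier (Kxtf_tf1 f)"
proof -
  obtain p k where z: "p \<in> Kxf_polys f" "z = Fract p (tf1 f ^ k)" using assms by (rule Kxtf_tf1E)
  note [simp] = Kxf_polys_closed tf1_Kxf_polys z(1)
  show "- z \<in> carrier (Kxtf_tf1 f)"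
    using Kxtf_tf1I[of "- p" f k] by (simp add: z(2))
  show "xt_dx i z \<in> carrier (Kxtf_tf1 f)"
    using Kxtf_tf1I[of "map_poly (x_deriv i) p * tf1 f ^ k - p * map_poly (x_deriv i) (tf1 f ^ k)" f "k + k"]
    by (simp add: xt_dx_def z(2) fract_deriv_Fract derivation_map_poly derivation_x_deriv power_add)
  show "xt_dt z \<in> carrier (Kxtf_tf1 f)"
    using Kxtf_tf1I[of "pderiv p * tf1 f ^ k - p * pderiv (tf1 f ^ k)" f "k + k"]
    by (simp add: xt_dt_def z(2) fract_deriv_Fract derivation_pderiv power_add)
qed

lemmas Kxtf_tf1_closed = Kxtf_tf1_arith Kxtf_tf1_unary

lemma Kxtf_arith:
  assumes "z \<in> carrier (Kxtf f)" "w \<in> carrier (Kxtf f)"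
  shows "z + w \<in> carrier (Kxtf f)" "z * w \<in> carrier (Kxtf f)"
  using assms Kxf_polys_arith unfolding carrier_Kxtf
  by (auto simp: to_fract_add[symmetric] to_fract_mult[symmetric] simp del: to_fract_add to_fract_mult)

lemma Kxtf_unary:
  assumes "z \<in> carrier (Kxtf f)"
  shows "- z \<in> carrier (Kxtf f)" "xt_dx i z \<in> carrier (Kxtf f)" "xt_dt z \<in> carrier (Kxtf f)"
  using assms Kxf_polys_unary unfolding carrier_Kxtf
  by (auto simp: xt_dx_to_fract xt_dt_to_fract to_fract_uminus[symmetric] simp del: to_fract_uminus)

lemmas Kxtf_closed = Kxtf_arith Kxtf_unary

lemma Kxtf_0 [simp]: "0 \<in> carrier (Kxtf f)" and Kxtf_const: "g \<in> carrier (Kxf f) \<Longrightarrow> to_fract [:g:] \<in> carrier (Kxtf f)"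
  unfolding carrier_Kxtf by (auto intro: image_eqI[of _ _ 0])

lemma cring_Kxtf_tf1: "cring (Kxtf_tf1 f)"
proof -
  have "to_fract 1 \<in> carrier (Kxtf f)" unfolding carrier_Kxtf by (rule imageI) simp
  then have "1 \<in> carrier (Kxtf_tf1 f)" "0 \<in> carrier (Kxtf_tf1 f)" using Kxtf_subset Kxtf_0 by auto
  then have "cring (subring_of_type (carrier (Kxtf_tf1 f)))"
    by (intro cring_subring_of_type) (auto intro: Kxtf_tf1_closed)
  then show ?thesis by (simp add: Kxtf_tf1_def)
qed

abbreviation "B0 \<equiv> Kxtf_tf1_over_Kxf f"

lemma diff_module_B0: "diff_module (Kxf f) B0 x_deriv xt_dx"
proof -
  interpret cring "Kxtf_tf1 f" by (rule cring_Kxtf_tf1)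
  have hom: "(\<lambda>g. to_fract [:g:]) \<in> ring_hom (Kxf f) (Kxtf_tf1 f)"
    by (rule ring_hom_memI) (use Kxtf_const Kxtf_subset in \<open>auto simp: to_fract_add[symmetric] to_fract_mult[symmetric] one_pCons[symmetric] simp del: to_fract_add to_fract_mult\<close>)
  have "left_module (Kxf f) B0"
    unfolding Kxtf_tf1_over_Kxf_def
    by (rule left_module_restrict_scalars[OF left_module_regular[OF ring_axioms] cring.axioms(1)[OF cring_Kxf] hom])
  then have 1: "module (Kxf f) B0" by (simp add: module_iff_left_module cring_Kxf)
  have c: "xt_dx i (to_fract [:g:]) = to_fract [:x_deriv i g:]" for i g
    by (simp add: xt_dx_to_fract map_poly_pCons derivation_0[OF derivation_x_deriv])
  have 2: "additive_map B0 B0 (xt_dx i)" for i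
    by (rule additiveI) (simp_all add: Kxtf_tf1_closed derivation_add[OF derivation_xt_dx])
  show ?thesis
    by (intro diff_module.intro 1 2 diff_module_axioms.intro)
      (auto intro: xt_dx_commute simp: derivation_mult[OF derivation_xt_dx] c)
qed

sublocale B0: diff_module "Kxf f" B0 x_deriv xt_dx by (rule diff_module_B0)

lemma additive_subgroup_Kxtf: "additive_subgroup (carrier (Kxtf f)) B0"
  by (rule additive_subgroupI_closed[OF B0.M.abelian_group_axioms])
    (use Kxtf_subset Kxtf_closed in \<open>auto intro: bexI[of _ "- x" for x]\<close>)

lemma Kxtf_smult: "g \<in> carrier (Kxf f) \<Longrightarrow> z \<in> carrier (Kxtf f) \<Longrightarrow> g \<odot>\<^bsub>B0\<^esub> z \<in> carrier (Kxtf f)"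
  by (simp add: Kxtf_closed Kxtf_const)

lemma diff_module_BZf: "diff_module (Kxf f) (BZf f) x_deriv (BZf_dx f)"
  using B0.diff_module_quotient[OF additive_subgroup_Kxtf Kxtf_smult Kxtf_closed(4)]
  by (simp add: BZf_def BZf_dx_def[abs_def])

sublocale B: diff_module "Kxf f" "BZf f" x_deriv "BZf_dx f" by (rule diff_module_BZf)

definition BZf_class :: "('n, 'k) xt_fract \<Rightarrow> ('n, 'k) xt_fract set"
  where "BZf_class z = carrier (Kxtf f) +>\<^bsub>B0\<^esub> z"

lemma carrier_BZf: "carrier (BZf f) = BZf_class ` carrier (Kxtf_tf1 f)"
  by (simp add: BZf_def carrier_quotient_module BZf_class_def)

lemma BZf_class_closed [simp]: "z \<in> carrier (Kxtf_tf1 f) \<Longrightarrow> BZf_class z \<in> carrier (BZf f)"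
  by (simp add: carrier_BZf)

lemma BZf_class_add: "\<lbrakk>z \<in> carrier (Kxtf_tf1 f); w \<in> carrier (Kxtf_tf1 f)\<rbrakk> \<Longrightarrow> BZf_class z \<oplus>\<^bsub>BZf f\<^esub> BZf_class w = BZf_class (z + w)"
  using add_quotient_module[OF B0.M.abelian_group_axioms additive_subgroup_Kxtf, of z w]
  by (simp add: BZf_def BZf_class_def)

lemma BZf_class_smult: "\<lbrakk>g \<in> carrier (Kxf f); z \<in> carrier (Kxtf_tf1 f)\<rbrakk> \<Longrightarrow> g \<odot>\<^bsub>BZf f\<^esub> BZf_class z = BZf_class (to_fract [:g:] * z)"
proof -
  assume g: "g \<in> carrier (Kxf f)" and z: "z \<in> carrier (Kxtf_tf1 f)"
  have "g \<odot>\<^bsub>BZf f\<^esub> BZf_class z = BZf_class (g \<odot>\<^bsub>B0\<^esub> z)"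
    unfolding BZf_def BZf_class_def smult_quotient_module
    by (rule quotient_op_coset[OF B0.M.abelian_group_axioms additive_subgroup_Kxtf B0.additive_smult[OF g] Kxtf_smult[OF g]])
      (simp_all add: z)
  then show ?thesis by simp
qed

lemma BZf_class_dx: "z \<in> carrier (Kxtf_tf1 f) \<Longrightarrow> BZf_dx f i (BZf_class z) = BZf_class (xt_dx i z)"
  using quotient_op_coset[OF B0.M.abelian_group_axioms additive_subgroup_Kxtf B0.additive_d[of i] Kxtf_closed(4), of z]
  by (simp add: BZf_dx_def BZf_class_def)

lemma additive_xt_dt: "additive_map B0 B0 xt_dt"
  by (rule additiveI) (simp_all add: Kxtf_tf1_closed derivation_add[OF derivation_xt_dt])

lemma BZf_class_dt: "z \<in> carrier (Kxtf_tf1 f) \<Longrightarrow> BZf_dt f (BZf_class z) = BZf_class (xt_dt z)"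
  using quotient_op_coset[OF B0.M.abelian_group_axioms additive_subgroup_Kxtf additive_xt_dt Kxtf_closed(5), of z]
  by (simp add: BZf_dt_def BZf_class_def)

lemma BZf_class_Kxtf: "z \<in> carrier (Kxtf f) \<Longrightarrow> BZf_class z = \<zero>\<^bsub>BZf f\<^esub>"
proof -
  assume z: "z \<in> carrier (Kxtf f)"
  have "0 \<in> carrier (Kxtf_tf1 f)" using Kxtf_subset Kxtf_0 by (rule subsetD)
  then show "BZf_class z = \<zero>\<^bsub>BZf f\<^esub>"
    using coset_add_left[OF B0.M.abelian_group_axioms additive_subgroup_Kxtf z, of 0] Kxtf_subset
      B0.M.a_coset_add_zero[of "carrier (Kxtf f)"]
    by (simp add: BZf_def BZf_class_def zero_quotient_module)
qed

lemma additive_BZf_dt: "additive_map (BZf f) (BZf f) (BZf_dt f)"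
  using additive_quotient_op[OF B0.M.abelian_group_axioms additive_subgroup_Kxtf additive_xt_dt Kxtf_closed(5)]
  by (simp add: BZf_def BZf_dt_def[abs_def])

lemma BZf_dt_smult:
  assumes "g \<in> carrier (Kxf f)" "b \<in> carrier (BZf f)"
  shows "BZf_dt f (g \<odot>\<^bsub>BZf f\<^esub> b) = g \<odot>\<^bsub>BZf f\<^esub> BZf_dt f b"
proof -
  obtain z where z: "z \<in> carrier (Kxtf_tf1 f)" "b = BZf_class z" using assms(2) by (auto simp: carrier_BZf)
  have g: "to_fract [:g:] \<in> carrier (Kxtf_tf1 f)" using Kxtf_const[OF assms(1)] Kxtf_subset by blast
  have "xt_dt (to_fract [:g:] * z) = to_fract [:g:] * xt_dt z"
    by (simp add: derivation_mult[OF derivation_xt_dt] xt_dt_to_fract pderiv_pCons)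
  then show ?thesis using z g assms(1) by (simp add: BZf_class_smult BZf_class_dt Kxtf_tf1_closed)
qed

lemma BZf_dx_dt: "b \<in> carrier (BZf f) \<Longrightarrow> BZf_dx f i (BZf_dt f b) = BZf_dt f (BZf_dx f i b)"
  by (auto simp: carrier_BZf BZf_class_dx BZf_class_dt Kxtf_tf1_closed xt_dx_dt_commute)

section \<open>Partial fractions and residues in \<open>t\<close>\<close>

definition tf1_inv :: "nat \<Rightarrow> ('n, 'k) xt_fract"
  where "tf1_inv k = Fract 1 (tf1 f ^ k)"

lemma tf1_inv_closed [simp]: "tf1_inv k \<in> carrier (Kxtf_tf1 f)"
  unfolding tf1_inv_def by (rule Kxtf_tf1I) simp

text \<open>
  This is \<open>t = ((tf - 1) + 1) / f\<close>, multiplied by \<open>p / (tf - 1)\<^bsup>k+1\<^esup>\<close>: a factor \<open>t\<close> of the numerator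
  is traded for a numerator of smaller degree.
\<close>

lemma partial_fraction_step:
  "Fract (pCons a p) (tf1 f ^ Suc k) = to_fract [:a:] * tf1_inv (Suc k) +
    to_fract [:inverse (to_fract f):] * (Fract p (tf1 f ^ k) + Fract p (tf1 f ^ Suc k))"
proof -
  let ?q = "tf1 f"
  have "Fract p (?q ^ k) = Fract (p * ?q) (?q ^ Suc k)" by (simp add: eq_fract)
  then have "Fract p (?q ^ k) + Fract p (?q ^ Suc k) = Fract (p * (?q + 1)) (?q ^ Suc k)"
    by (simp add: eq_fract algebra_simps)
  moreover have "p * (?q + 1) = Polynomial.smult (to_fract f) (pCons 0 p)"
    by (simp add: tf1_def one_pCons)
  ultimately have "to_fract [:inverse (to_fract f):] * (Fract p (?q ^ k) + Fract p (?q ^ Suc k))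
      = Fract (pCons 0 p) (?q ^ Suc k)"
    by (simp add: to_fract_def[of "[:_:]"])
  moreover have "to_fract [:a:] * tf1_inv (Suc k) = Fract [:a:] (?q ^ Suc k)"
    by (simp add: tf1_inv_def to_fract_def)
  moreover have "Fract [:a:] (?q ^ Suc k) + Fract (pCons 0 p) (?q ^ Suc k) = Fract (pCons a p) (?q ^ Suc k)"
    by (simp add: eq_fract algebra_simps)
  ultimately show ?thesis by simp
qed

text \<open>
  Partial fractions: modulo \<open>K[x, t, f\<^sup>-\<^sup>1]\<close>, the powers \<open>(tf - 1)\<^sup>-\<^sup>k\<close> with \<open>k \<ge> 1\<close> span over
  \<open>K[x, f\<^sup>-\<^sup>1]\<close>.
\<close>

lemma Kxtf_tf1_induct [consumes 1, case_names regular pole scale add]: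
  assumes z: "z \<in> carrier (Kxtf_tf1 f)"
    and regular: "\<And>z. z \<in> carrier (Kxtf f) \<Longrightarrow> P z"
    and pole: "\<And>k. P (tf1_inv (Suc k))"
    and scale: "\<And>g z. \<lbrakk>g \<in> carrier (Kxf f); z \<in> carrier (Kxtf_tf1 f); P z\<rbrakk> \<Longrightarrow> P (to_fract [:g:] * z)"
    and add: "\<And>z w. \<lbrakk>z \<in> carrier (Kxtf_tf1 f); w \<in> carrier (Kxtf_tf1 f); P z; P w\<rbrakk> \<Longrightarrow> P (z + w)"
  shows "P z"
proof -
  have c: "to_fract [:g:] * z \<in> carrier (Kxtf_tf1 f)" if "g \<in> carrier (Kxf f)" "z \<in> carrier (Kxtf_tf1 f)" for g z
    using that Kxtf_const Kxtf_subset by (intro Kxtf_tf1_closed) auto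
  have "P (Fract p (tf1 f ^ k))" if "p \<in> Kxf_polys f" for p k
    using that
  proof (induction p arbitrary: k)
    case 0
    have "Fract 0 (tf1 f ^ k) = 0" by (simp add: fract_collapse)
    then show ?case using regular[of 0] by simp
  next
    case (pCons a p)
    show ?case
    proof (cases k)
      case 0
      then show ?thesis using pCons by (intro regular) (auto simp: carrier_Kxtf to_fract_def intro!: imageI)
    next
      case (Suc l)
      show ?thesis unfolding Suc partial_fraction_step
        using pCons by (intro add scale pole c Kxtf_tf1_closed Kxtf_tf1I) (auto simp del: power_Suc)
    qed
  qed
  then show ?thesis using z by (auto elim!: Kxtf_tf1E)
qed

lemma xt_dt_tf1_inv: "xt_dt (tf1_inv (Suc k)) = to_fract [:- (of_nat (Suc k) * to_fract f):] * tf1_inv (Suc (Suc k))"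
proof -
  have "pderiv (tf1 f ^ Suc k) = Polynomial.smult (of_nat (Suc k)) (tf1 f ^ k) * [:to_fract f:]"
    by (simp only: pderiv_power_Suc) (simp add: tf1_def pderiv_pCons)
  then show ?thesis
    unfolding xt_dt_def tf1_inv_def
    by (subst fract_deriv_Fract[OF derivation_pderiv])
      (simp_all add: to_fract_def[of "[:_:]"] eq_fract derivation_1[OF derivation_pderiv] algebra_simps del: of_nat_Suc)
qed

definition delta0 :: "('n, 'k) xt_fract" where "delta0 = Fract [:to_fract f:] (tf1 f)"

lemma delta0_conv: "delta0 = to_fract [:to_fract f:] * tf1_inv (Suc 0)"
  by (simp add: delta0_def tf1_inv_def to_fract_def[of "[:_:]"])

lemma delta0_closed [simp]: "delta0 \<in> carrier (Kxtf_tf1 f)"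
  using Kxtf_tf1I[of "[:to_fract f:]" f 1] by (simp add: delta0_def)

lemma BZf_delta_conv: "BZf_delta f = BZf_class delta0"
  by (simp add: BZf_delta_def BZf_class_def delta0_def)

text \<open>
  Both sides are \<open>- (\<partial>f/\<partial>x\<^sub>i) / (tf - 1)\<^sup>2\<close>.
\<close>

lemma xt_dx_delta0:
  "xt_dx i delta0 = xt_dt (to_fract [:x_deriv i (to_fract f) * inverse (to_fract f):] * tf1_inv (Suc 0))"
proof -
  have "to_fract [:x_deriv i (to_fract f) * inverse (to_fract f):] * tf1_inv (Suc 0)
      = Fract [:x_deriv i (to_fract f) * inverse (to_fract f):] (tf1 f)"
    by (simp add: tf1_inv_def to_fract_def[of "[:_:]"])
  moreover have "map_poly (x_deriv i) (tf1 f) = [:0, x_deriv i (to_fract f):]"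
    by (simp add: tf1_def map_poly_pCons derivation_0[OF derivation_x_deriv] derivation_1[OF derivation_x_deriv]
        derivation_minus[OF derivation_x_deriv])
  ultimately show ?thesis
    unfolding xt_dx_def xt_dt_def delta0_def
    by (simp add: fract_deriv_Fract derivation_map_poly derivation_x_deriv derivation_pderiv map_poly_pCons
        derivation_0[OF derivation_x_deriv] pderiv_pCons)
      (simp add: tf1_def pderiv_pCons mult.assoc)
qed

text \<open>
  The residue of \<open>(tf - 1)\<^sup>-\<^sup>k\<close> is \<open>f\<^sup>-\<^sup>1\<close> for \<open>k = 1\<close> and zero for larger \<open>k\<close>.
\<close>

lemma residue_tf1_inv: "total_residue (tf1_inv (Suc k)) \<in> carrier (Kxf f)"
proof -
  have deg: "degree (tf1 f ^ Suc k) = Suc k" by (subst degree_power_eq) (simp_all add: tf1_def)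
  have "lead_coeff (tf1 f ^ Suc k) = to_fract f ^ Suc k" by (subst lead_coeff_power) (simp add: tf1_def)
  then have "total_residue (tf1_inv (Suc k)) = poly.coeff 1 k * inverse (to_fract f) ^ Suc k"
    unfolding tf1_inv_def using deg
    by (subst total_residue_proper) (simp_all add: field_simps power_inverse del: power_Suc)
  moreover have "poly.coeff 1 k \<in> carrier (Kxf f)" by (simp add: one_pCons coeff_pCons split: nat.splits)
  ultimately show ?thesis by (simp add: Kxf_power del: power_Suc)
qed

lemma residue_Kxf: "z \<in> carrier (Kxtf_tf1 f) \<Longrightarrow> total_residue z \<in> carrier (Kxf f)"
  by (induction z rule: Kxtf_tf1_induct)
    (auto simp: carrier_Kxtf total_residue_poly residue_tf1_inv total_residue_scale total_residue_add)

lemma residue_delta0: "total_residue delta0 = 1"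
  unfolding delta0_def by (subst total_residue_proper) (simp_all add: tf1_def)

definition BZf_residue :: "('n, 'k) xt_fract set \<Rightarrow> ('n, 'k) mpoly fract"
  where "BZf_residue b = the_elem (total_residue ` b)"

lemma BZf_residue:
  assumes "z \<in> carrier (Kxtf_tf1 f)"
  shows "BZf_residue (BZf_class z) = total_residue z"
proof -
  have "BZf_class z = {p + z | p. p \<in> carrier (Kxtf f)}" by (auto simp: BZf_class_def a_r_coset_def')
  moreover have "total_residue (p + z) = total_residue z" if "p \<in> carrier (Kxtf f)" for p
    using that by (auto simp: carrier_Kxtf total_residue_add total_residue_poly)
  ultimately have "total_residue ` BZf_class z = {total_residue z}" using Kxtf_0 by fastforce
  then show ?thesis by (simp add: BZf_residue_def)
qed

lemma BZf_residue_closed [simp]: "b \<in> carrier (BZf f) \<Longrightarrow> BZf_residue b \<in> carrier (Kxf f)"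
  by (auto simp: carrier_BZf BZf_residue residue_Kxf)

lemma BZf_residue_add: "\<lbrakk>b \<in> carrier (BZf f); c \<in> carrier (BZf f)\<rbrakk> \<Longrightarrow> BZf_residue (b \<oplus>\<^bsub>BZf f\<^esub> c) = BZf_residue b + BZf_residue c"
  by (auto simp: carrier_BZf BZf_class_add BZf_residue Kxtf_tf1_closed total_residue_add)

lemma BZf_residue_smult: "\<lbrakk>g \<in> carrier (Kxf f); b \<in> carrier (BZf f)\<rbrakk> \<Longrightarrow> BZf_residue (g \<odot>\<^bsub>BZf f\<^esub> b) = g * BZf_residue b"
  using Kxtf_const[of g] Kxtf_subset by (auto simp: carrier_BZf BZf_class_smult BZf_residue Kxtf_tf1_closed total_residue_scale)

lemma total_residue_dt: "total_residue (xt_dt z) = 0"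
  by (simp add: xt_dt_def total_residue_pderiv)

lemma BZf_residue_dt: "b \<in> carrier (BZf f) \<Longrightarrow> BZf_residue (BZf_dt f b) = 0"
  by (auto simp: carrier_BZf BZf_class_dt BZf_residue Kxtf_tf1_closed total_residue_dt)

end

section \<open>The direct image and the map \<open>\<phi>\<close>\<close>

context localized_weyl_module
begin

abbreviation "L \<equiv> localize f M"
abbreviation "dL \<equiv> localize_partial f M"
abbreviation "T \<equiv> Mtilde_base f M"
abbreviation "te \<equiv> tensor_elt (Kxf f) (BZf f) (localize f M)"

sublocale LM: kxf_diff_module f L dL
  by (intro kxf_diff_module.intro localization_axioms diff_module_localize)

sublocale BL: tensor_product "Kxf f" "BZf f" L
  by (intro tensor_product.intro B.module_axioms LM.module_axioms)

lemma diff_module_BZf': "diff_module (Kxf f) (with_smult (BZf f) (smult (BZf f))) x_deriv (BZf_dx f)"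
  by (simp add: with_smult_smult diff_module_BZf)

text \<open>
  Scalar multiplication is linear over the commutative ring \<open>K[x, f\<^sup>-\<^sup>1]\<close>, so it can act on the first
  factor of the tensor product.
\<close>

lemma BZf_smult_commute:
  assumes "g \<in> carrier (Kxf f)" "h \<in> carrier (Kxf f)" "b \<in> carrier (BZf f)"
  shows "g \<odot>\<^bsub>BZf f\<^esub> (h \<odot>\<^bsub>BZf f\<^esub> b) = h \<odot>\<^bsub>BZf f\<^esub> (g \<odot>\<^bsub>BZf f\<^esub> b)"
  using B.smult_assoc1[of g h b] B.smult_assoc1[of h g b] assms by (simp add: mult.commute)

lemma diff_module_T: "diff_module (Kxf f) T x_deriv (Mtilde_dx f M)"
  using diff_module_tensor_group[OF diff_module_BZf diff_module_localize diff_module_BZf' BZf_smult_commute]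
  by (simp add: Mtilde_base_def Mtilde_dx_def[abs_def])

sublocale T: kxf_diff_module f T "Mtilde_dx f M"
  by (intro kxf_diff_module.intro localization_axioms diff_module_T)

lemma T_simps: "carrier T = carrier (tensor_group (Kxf f) (BZf f) L)" "add T = add (tensor_group (Kxf f) (BZf f) L)"
  "zero T = zero (tensor_group (Kxf f) (BZf f) L)"
  by (simp_all add: Mtilde_base_def)

lemma te_closed [simp]: "b \<in> carrier (BZf f) \<Longrightarrow> v \<in> carrier L \<Longrightarrow> te b v \<in> carrier T"
  by (simp add: T_simps)

lemma te_add_left: "\<lbrakk>b \<in> carrier (BZf f); c \<in> carrier (BZf f); v \<in> carrier L\<rbrakk> \<Longrightarrow> te (b \<oplus>\<^bsub>BZf f\<^esub> c) v = te b v \<oplus>\<^bsub>T\<^esub> te c v"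
  and te_add_right: "\<lbrakk>b \<in> carrier (BZf f); v \<in> carrier L; w \<in> carrier L\<rbrakk> \<Longrightarrow> te b (v \<oplus>\<^bsub>L\<^esub> w) = te b v \<oplus>\<^bsub>T\<^esub> te b w"
  by (simp_all add: T_simps BL.elt_add_left BL.elt_add_right)

lemma te_zero_left: "v \<in> carrier L \<Longrightarrow> te \<zero>\<^bsub>BZf f\<^esub> v = \<zero>\<^bsub>T\<^esub>"
  by (simp add: T_simps BL.elt_zero_left)

lemma te_smult: "\<lbrakk>g \<in> carrier (Kxf f); b \<in> carrier (BZf f); v \<in> carrier L\<rbrakk> \<Longrightarrow> g \<odot>\<^bsub>T\<^esub> te b v = te (g \<odot>\<^bsub>BZf f\<^esub> b) v"
  using tensor_scalar_elt[OF diff_module_BZf diff_module_localize diff_module_BZf' BZf_smult_commute]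
  by (simp add: Mtilde_base_def)

lemma te_dx: "\<lbrakk>b \<in> carrier (BZf f); v \<in> carrier L\<rbrakk> \<Longrightarrow>
    Mtilde_dx f M i (te b v) = te (BZf_dx f i b) v \<oplus>\<^bsub>T\<^esub> te b (dL i v)"
  using tensor_leibniz_elt[OF diff_module_BZf diff_module_localize diff_module_BZf' BZf_smult_commute, of b v i]
  by (simp add: T_simps Mtilde_dx_def)

lemmas Mtilde_induct [consumes 1, case_names elt add] = BL.T_induct[folded T_simps]

abbreviation "dt \<equiv> Mtilde_dt f M"

lemma additive_dt: "additive_map T T dt"
  using BL.additive_tensor_left[OF additive_BZf_dt BZf_dt_smult]
  by (simp add: Mtilde_dt_def[abs_def] additive_map_def T_simps)

lemma te_dt: "\<lbrakk>b \<in> carrier (BZf f); v \<in> carrier L\<rbrakk> \<Longrightarrow> dt (te b v) = te (BZf_dt f b) v"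
  using BL.tensor_left_elt[OF additive_BZf_dt BZf_dt_smult] by (simp add: Mtilde_dt_def)

lemmas BZf_dt_closed [simp] = additive_closed[OF additive_BZf_dt]
lemmas dt_closed [simp] = additive_closed[OF additive_dt]
lemmas dt_add = additive_add[OF additive_dt]

lemma dt_smult:
  assumes g: "g \<in> carrier (Kxf f)" and x: "x \<in> carrier T"
  shows "dt (g \<odot>\<^bsub>T\<^esub> x) = g \<odot>\<^bsub>T\<^esub> dt x"
  using x
proof (induction x rule: Mtilde_induct)
  case (elt b v)
  then show ?case using g by (simp add: te_smult te_dt BZf_dt_smult)
next
  case (add x y)
  then show ?case using g by (simp add: dt_add T.smult_r_distr)
qed

lemma dt_dx: "x \<in> carrier T \<Longrightarrow> dt (Mtilde_dx f M i x) = Mtilde_dx f M i (dt x)"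
proof (induction x rule: Mtilde_induct)
  case (elt b v)
  then show ?case by (simp add: te_dx te_dt BZf_dx_dt dt_add B.d_closed LM.d_closed)
next
  case (add x y)
  then show ?case by (simp add: dt_add T.d_add T.d_closed)
qed

text \<open>
  Since \<open>\<partial>\<^sub>t\<close> commutes with scalars and with the \<open>\<partial>\<^sub>i\<close>, it is linear over \<open>D\<^sub>X[f\<^sup>-\<^sup>1]\<close>, and its image is
  a submodule.
\<close>

lemma dt_act:
  assumes "C \<in> carrier (localize f D)" "x \<in> carrier T"
  shows "dt (weyl_loc_act T (Mtilde_dx f M) C x) = weyl_loc_act T (Mtilde_dx f M) C (dt x)"
  by (rule weyl_loc_act_intertwine[where H = dt, OF T.kxf_diff_module_axioms T.kxf_diff_module_axioms additive_dt])
    (simp_all add: dt_smult dt_dx assms)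

abbreviation "N \<equiv> dt ` carrier T"

lemma N_I: "x \<in> carrier T \<Longrightarrow> dt x \<in> N"
  by (rule imageI)

lemma additive_subgroup_N: "additive_subgroup N T"
proof (rule additive_subgroupI_closed[OF T.M.abelian_group_axioms])
  have T: "abelian_group T" ..
  show "N \<subseteq> carrier T" by (intro image_subsetI dt_closed)
  show "\<zero>\<^bsub>T\<^esub> \<in> N" using N_I[OF T.M.zero_closed] by (simp only: additive_zero[OF T T additive_dt])
next
  fix x y assume "x \<in> N" "y \<in> N"
  then obtain u v where uv: "u \<in> carrier T" "v \<in> carrier T" "x = dt u" "y = dt v" by blast
  show "x \<oplus>\<^bsub>T\<^esub> y \<in> N" using N_I[OF T.M.a_closed[OF uv(1,2)]] by (simp only: uv(3,4) dt_add[OF uv(1,2)])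
next
  fix x assume "x \<in> N"
  then obtain u where u: "u \<in> carrier T" "x = dt u" by blast
  have "dt (\<ominus>\<^bsub>T\<^esub> u) \<oplus>\<^bsub>T\<^esub> x = dt (\<ominus>\<^bsub>T\<^esub> u \<oplus>\<^bsub>T\<^esub> u)" using u by (simp add: dt_add)
  also have "\<dots> = \<zero>\<^bsub>T\<^esub>"
    using u additive_zero[OF T.M.abelian_group_axioms T.M.abelian_group_axioms additive_dt] by (simp add: T.M.l_neg)
  finally show "\<exists>y\<in>N. y \<oplus>\<^bsub>T\<^esub> x = \<zero>\<^bsub>T\<^esub>"
    using N_I[OF T.M.a_inv_closed[OF u(1)]] by (rule bexI)
qed

abbreviation "Q \<equiv> quotient_module T N"
abbreviation "dQ \<equiv> \<lambda>i. quotient_op T N (Mtilde_dx f M i)"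

lemma N_smult:
  assumes g: "g \<in> carrier (Kxf f)" and n: "n \<in> N"
  shows "g \<odot>\<^bsub>T\<^esub> n \<in> N"
proof -
  obtain x where x: "x \<in> carrier T" "n = dt x" using n by blast
  show ?thesis using N_I[OF T.smult_closed[OF g x(1)]] by (simp only: x(2) dt_smult[OF g x(1)])
qed

lemma N_dx:
  assumes n: "n \<in> N"
  shows "Mtilde_dx f M i n \<in> N"
proof -
  obtain x where x: "x \<in> carrier T" "n = dt x" using n by blast
  show ?thesis using N_I[OF T.d_closed[OF x(1)]] by (simp only: x(2) dt_dx[OF x(1)])
qed

lemma N_act:
  assumes C: "C \<in> carrier (localize f D)" and n: "n \<in> N"
  shows "weyl_loc_act T (Mtilde_dx f M) C n \<in> N"
proof -
  obtain x where x: "x \<in> carrier T" "n = dt x" using n by blast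
  show ?thesis using N_I[OF T.lact_closed[OF x(1) C]] by (simp only: x(2) dt_act[OF C x(1)])
qed

sublocale Q: kxf_diff_module f Q dQ
  by (intro kxf_diff_module.intro localization_axioms T.diff_module_quotient additive_subgroup_N N_smult N_dx)

abbreviation "proj \<equiv> \<lambda>x. N +>\<^bsub>T\<^esub> x"

lemma additive_proj: "additive_map T Q proj"
  by (rule additive_quotient_proj[OF T.M.abelian_group_axioms additive_subgroup_N])

lemma proj_smult: "g \<in> carrier (Kxf f) \<Longrightarrow> x \<in> carrier T \<Longrightarrow> g \<odot>\<^bsub>Q\<^esub> proj x = proj (g \<odot>\<^bsub>T\<^esub> x)"
  unfolding smult_quotient_module
  by (rule quotient_op_coset[OF T.M.abelian_group_axioms additive_subgroup_N T.additive_smult N_smult])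

lemma proj_dx: "x \<in> carrier T \<Longrightarrow> dQ i (proj x) = proj (Mtilde_dx f M i x)"
  by (rule quotient_op_coset[OF T.M.abelian_group_axioms additive_subgroup_N T.additive_d N_dx])

text \<open>
  The quotient is used in two ways: with the induced action of \<open>D\<^sub>X[f\<^sup>-\<^sup>1]\<close>, and with the action that is
  assembled from the induced operators \<open>\<partial>\<^sub>i\<close>.  They agree since the projection commutes with scalars
  and with the \<open>\<partial>\<^sub>i\<close>.
\<close>

lemma proj_act:
  assumes "C \<in> carrier (localize f D)" "x \<in> carrier T"
  shows "proj (weyl_loc_act T (Mtilde_dx f M) C x) = weyl_loc_act Q dQ C (proj x)"
  by (rule weyl_loc_act_intertwine[OF T.kxf_diff_module_axioms Q.kxf_diff_module_axioms additive_proj])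
    (simp_all add: proj_smult proj_dx assms)

lemma Mtilde_simps: "Mtilde f M = with_smult T (weyl_loc_act T (Mtilde_dx f M))"
  by (simp add: Mtilde_def)

lemma Mtilde_mod_dt_conv: "Mtilde_mod_dt f M = quotient_module (Mtilde f M) N"
  by (simp add: Mtilde_mod_dt_def Mtilde_simps)

lemma Mtilde_mod_dt_simps: "carrier (Mtilde_mod_dt f M) = carrier Q" "add (Mtilde_mod_dt f M) = add Q"
  by (simp_all add: Mtilde_mod_dt_conv Mtilde_simps quotient_module_with_smult)

lemma additive_subgroup_N': "additive_subgroup N (Mtilde f M)"
  using additive_subgroup_N unfolding Mtilde_simps additive_subgroup_def subgroup_def
  by (simp add: m_inv_def)

lemma left_module_Mtilde: "left_module (Weyl_loc f) (Mtilde f M)"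
  unfolding Mtilde_simps by (rule T.left_module_weyl_loc)

lemma left_module_Mtilde_mod_dt: "left_module (Weyl_loc f) (Mtilde_mod_dt f M)"
  unfolding Mtilde_mod_dt_conv
  by (rule left_module_quotient_module[OF left_module_Mtilde additive_subgroup_N']) (simp add: Mtilde_simps N_act)

lemma Mtilde_mod_dt_smult:
  assumes C: "C \<in> carrier (localize f D)" and x: "x \<in> carrier T"
  shows "C \<odot>\<^bsub>Mtilde_mod_dt f M\<^esub> proj x = weyl_loc_act Q dQ C (proj x)"
proof -
  have "C \<odot>\<^bsub>Mtilde_mod_dt f M\<^esub> (N +>\<^bsub>Mtilde f M\<^esub> x) = N +>\<^bsub>Mtilde f M\<^esub> (weyl_loc_act T (Mtilde_dx f M) C x)"
    unfolding Mtilde_mod_dt_conv smult_quotient_module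
  proof (subst quotient_op_coset[OF _ additive_subgroup_N'])
    show "abelian_group (Mtilde f M)" unfolding Mtilde_simps by (rule abelian_group_with_smult) (rule T.M.abelian_group_axioms)
    show "additive_map (Mtilde f M) (Mtilde f M) (smult (Mtilde f M) C)"
      using T.lact_additive_right[OF C] by (simp add: Mtilde_simps additive_map_def)
  qed (simp_all add: Mtilde_simps C x N_act)
  then show ?thesis using proj_act[OF C x] by (simp add: Mtilde_simps)
qed

abbreviation "delta \<equiv> BZf_delta f"

lemma delta_closed [simp]: "delta \<in> carrier (BZf f)"
  by (simp add: BZf_delta_conv)

lemma phi_conv: "phi f M v = proj (te delta v)"
  by (simp add: phi_def Mtilde_simps)

lemma phi_closed: "v \<in> carrier L \<Longrightarrow> phi f M v \<in> carrier Q"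
  by (simp add: phi_conv carrier_quotient_module)

lemma additive_phi: "additive_map L Q (phi f M)"
proof -
  have "additive_map L T (te delta)" by (rule additiveI) (simp_all add: te_add_right)
  then have "additive_map L Q (\<lambda>v. proj (te delta v))" by (rule additive_compose[OF _ additive_proj])
  moreover have "phi f M = (\<lambda>v. proj (te delta v))" by (rule ext) (rule phi_conv)
  ultimately show ?thesis by (simp only:)
qed

lemma te_move: "\<lbrakk>g \<in> carrier (Kxf f); b \<in> carrier (BZf f); v \<in> carrier L\<rbrakk> \<Longrightarrow>
    te (g \<odot>\<^bsub>BZf f\<^esub> b) v = te b (g \<odot>\<^bsub>L\<^esub> v)"
  by (rule BL.elt_balanced)

lemma phi_smult: "\<lbrakk>g \<in> carrier (Kxf f); v \<in> carrier L\<rbrakk> \<Longrightarrow> phi f M (g \<odot>\<^bsub>L\<^esub> v) = g \<odot>\<^bsub>Q\<^esub> phi f M v"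
  by (simp add: phi_conv proj_smult te_smult te_move)

text \<open>
  Why the particular class \<open>\<delta>\<close> works: its derivatives with respect to the \<open>x\<^sub>i\<close> are derivatives with
  respect to \<open>t\<close>.
\<close>

lemma dx_delta: "\<exists>b\<in>carrier (BZf f). BZf_dx f i delta = BZf_dt f b"
proof -
  let ?z = "to_fract [:x_deriv i (to_fract f) * inverse (to_fract f):] * tf1_inv (Suc 0)"
  have "to_fract [:x_deriv i (to_fract f) * inverse (to_fract f):] \<in> carrier (Kxtf_tf1 f)"
    using Kxtf_const[of "x_deriv i (to_fract f) * inverse (to_fract f)"] Kxtf_subset by auto
  then have z: "?z \<in> carrier (Kxtf_tf1 f)" by (rule Kxtf_tf1_closed) simp
  then have "BZf_dx f i delta = BZf_dt f (BZf_class ?z)" by (simp add: BZf_delta_conv BZf_class_dx BZf_class_dt xt_dx_delta0)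
  then show ?thesis using z by (intro bexI[of _ "BZf_class ?z"]) simp_all
qed

text \<open>
  In \<open>\<partial>\<^sub>i (\<delta> \<otimes> v) = \<partial>\<^sub>i \<delta> \<otimes> v + \<delta> \<otimes> \<partial>\<^sub>i v\<close> the first term is the image under \<open>\<partial>\<^sub>t\<close> of some \<open>b \<otimes> v\<close>.
\<close>

lemma phi_partial:
  assumes v: "v \<in> carrier L"
  shows "phi f M (dL i v) = dQ i (phi f M v)"
proof -
  obtain b where b: "b \<in> carrier (BZf f)" "BZf_dx f i delta = BZf_dt f b" using dx_delta by blast
  have "Mtilde_dx f M i (te delta v) = dt (te b v) \<oplus>\<^bsub>T\<^esub> te delta (dL i v)"
    using v b by (simp add: te_dx te_dt)
  then have "proj (Mtilde_dx f M i (te delta v)) = proj (te delta (dL i v))"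
    using coset_add_left[OF T.M.abelian_group_axioms additive_subgroup_N N_I, of "te b v" "te delta (dL i v)"] v b
    by (simp add: LM.d_closed)
  then show ?thesis using v by (simp add: phi_conv proj_dx)
qed

lemma localized_module_simps: "localized_module f M = with_smult L (weyl_loc_act L dL)"
  by (simp add: localized_module_def)

lemma phi_hom: "phi f M \<in> left_module_hom (Weyl_loc f) (localized_module f M) (Mtilde_mod_dt f M)"
proof -
  have "phi f M (weyl_loc_act L dL C v) = C \<odot>\<^bsub>Mtilde_mod_dt f M\<^esub> phi f M v"
    if "C \<in> carrier (localize f D)" "v \<in> carrier L" for C v
  proof -
    have "phi f M (weyl_loc_act L dL C v) = weyl_loc_act Q dQ C (phi f M v)"
      by (rule weyl_loc_act_intertwine[where H = "phi f M", OF LM.kxf_diff_module_axioms Q.kxf_diff_module_axioms additive_phi])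
        (simp_all add: phi_smult phi_partial that)
    then show ?thesis using Mtilde_mod_dt_smult[OF that(1), of "te delta v"] that(2) by (simp add: phi_conv)
  qed
  then show ?thesis using additive_phi
    by (auto simp: left_module_hom_def localized_module_simps Mtilde_mod_dt_simps additive_map_def)
qed

section \<open>Injectivity by taking residues\<close>

text \<open>
  The contraction \<open>b \<otimes> v \<mapsto> res(b) v\<close>; on the quotient by the image of \<open>\<partial>\<^sub>t\<close> it induces the inverse of
  \<open>\<phi>\<close>.
\<close>

definition residue_map :: "('n, 'k, 'm) tilde \<Rightarrow> ('n, 'k, 'm) localized"
  where "residue_map = tensor_lift L (\<lambda>(b, v). BZf_residue b \<odot>\<^bsub>L\<^esub> v)"

lemma balanced_residue_map: "balanced (Kxf f) (BZf f) L L (\<lambda>b v. BZf_residue b \<odot>\<^bsub>L\<^esub> v)"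
  unfolding balanced_def
proof (intro conjI ballI)
  fix v assume "v \<in> carrier L"
  then show "additive_map (BZf f) L (\<lambda>b. BZf_residue b \<odot>\<^bsub>L\<^esub> v)"
    using LM.smult_l_distr by (intro additiveI) (simp_all add: BZf_residue_add)
next
  fix b assume "b \<in> carrier (BZf f)"
  then show "additive_map L L (smult L (BZf_residue b))" by (intro LM.additive_smult BZf_residue_closed)
next
  fix g b v assume "g \<in> carrier (Kxf f)" "b \<in> carrier (BZf f)" "v \<in> carrier L"
  then show "BZf_residue (g \<odot>\<^bsub>BZf f\<^esub> b) \<odot>\<^bsub>L\<^esub> v = BZf_residue b \<odot>\<^bsub>L\<^esub> (g \<odot>\<^bsub>L\<^esub> v)"
    using LM.smult_assoc1[of "BZf_residue b" g v] by (simp add: BZf_residue_smult mult.commute)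
qed

lemma additive_residue_map: "additive_map T L residue_map"
  using BL.additive_tensor_lift[OF LM.M.abelian_group_axioms balanced_residue_map] by (simp add: residue_map_def T_simps additive_map_def)

lemma residue_map_te: "\<lbrakk>b \<in> carrier (BZf f); v \<in> carrier L\<rbrakk> \<Longrightarrow> residue_map (te b v) = BZf_residue b \<odot>\<^bsub>L\<^esub> v"
  unfolding residue_map_def by (rule BL.tensor_lift_elt[OF LM.M.abelian_group_axioms balanced_residue_map])

lemma residue_map_dt: "x \<in> carrier T \<Longrightarrow> residue_map (dt x) = \<zero>\<^bsub>L\<^esub>"
proof (induction x rule: Mtilde_induct)
  case (elt b v)
  then show ?case using LM.smult_l_null[of v] by (simp add: te_dt residue_map_te BZf_residue_dt)
next
  case (add x y)
  then show ?case by (simp add: dt_add additive_add[OF additive_residue_map])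
qed

lemma residue_map_delta: "v \<in> carrier L \<Longrightarrow> residue_map (te delta v) = v"
  using LM.smult_one[of v] by (simp add: residue_map_te BZf_delta_conv BZf_residue residue_delta0)

lemma inj_phi: "inj_on (phi f M) (carrier L)"
proof (rule inj_onI)
  fix v w assume v: "v \<in> carrier L" and w: "w \<in> carrier L" and "phi f M v = phi f M w"
  then have "proj (te delta v) = proj (te delta w)" by (simp only: phi_conv)
  then obtain n where "n \<in> N" "te delta v = n \<oplus>\<^bsub>T\<^esub> te delta w"
    by (rule coset_eqE[OF T.M.abelian_group_axioms additive_subgroup_N te_closed[OF delta_closed v]])
  then obtain x where x: "x \<in> carrier T" "te delta v = dt x \<oplus>\<^bsub>T\<^esub> te delta w" by blast
  have "residue_map (te delta v) = residue_map (dt x) \<oplus>\<^bsub>L\<^esub> residue_map (te delta w)"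
    unfolding x(2) by (rule additive_add[OF additive_residue_map dt_closed[OF x(1)] te_closed[OF delta_closed w]])
  then show "v = w" by (simp only: residue_map_dt[OF x(1)] residue_map_delta[OF v] residue_map_delta[OF w] LM.M.l_zero[OF w])
qed

section \<open>Surjectivity by reducing pole orders\<close>

lemma phi_image_add:
  assumes "x \<in> phi f M ` carrier L" "y \<in> phi f M ` carrier L"
  shows "x \<oplus>\<^bsub>Q\<^esub> y \<in> phi f M ` carrier L"
proof -
  obtain v w where vw: "v \<in> carrier L" "w \<in> carrier L" "x = phi f M v" "y = phi f M w" using assms by blast
  show ?thesis unfolding vw(3,4) additive_add[OF additive_phi vw(1,2), symmetric]
    by (rule imageI[OF LM.M.a_closed[OF vw(1,2)]])
qed

lemma phi_image_zero: "\<zero>\<^bsub>Q\<^esub> \<in> phi f M ` carrier L"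
  using imageI[OF LM.M.zero_closed, of "phi f M"]
  by (simp only: additive_zero[OF LM.M.abelian_group_axioms Q.M.abelian_group_axioms additive_phi])

lemma proj_dt:
  assumes x: "x \<in> carrier T"
  shows "proj (dt x) = \<zero>\<^bsub>Q\<^esub>"
proof -
  have "proj (dt x) = proj \<zero>\<^bsub>T\<^esub>"
    using coset_add_left[OF T.M.abelian_group_axioms additive_subgroup_N N_I[OF x] T.M.zero_closed]
    by (simp only: T.M.r_zero[OF dt_closed[OF x]])
  also have "\<dots> = \<zero>\<^bsub>Q\<^esub>" by (rule additive_zero[OF T.M.abelian_group_axioms Q.M.abelian_group_axioms additive_proj])
  finally show ?thesis .
qed

text \<open>
  It suffices to treat the class \<open>b\<close> of \<open>(tf - 1)\<^bsup>-(k+1)\<^esup>\<close>, with arbitrary \<open>v\<close> so that coefficients can be moved into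
  the second factor.  For \<open>k = 0\<close> this is \<open>\<delta>\<close> up to a unit, and for \<open>k > 0\<close> the tensor is in the image
  of \<open>\<partial>\<^sub>t\<close>.
\<close>

lemma proj_te_eq_phi:
  assumes "b \<in> carrier (BZf f)" "v \<in> carrier L"
  shows "proj (te b v) \<in> phi f M ` carrier L"
proof -
  let ?I = "phi f M ` carrier L"
  have "\<forall>v\<in>carrier L. proj (te (BZf_class z) v) \<in> ?I" if "z \<in> carrier (Kxtf_tf1 f)" for z
    using that
  proof (induction z rule: Kxtf_tf1_induct)
    case (regular z)
    show ?case
    proof
      fix v assume v: "v \<in> carrier L"
      have "proj (te (BZf_class z) v) = proj \<zero>\<^bsub>T\<^esub>" using v regular by (simp only: BZf_class_Kxtf te_zero_left)
      also have "\<dots> = \<zero>\<^bsub>Q\<^esub>"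
        by (rule additive_zero[OF T.M.abelian_group_axioms Q.M.abelian_group_axioms additive_proj])
      finally show "proj (te (BZf_class z) v) \<in> ?I" by (simp only: phi_image_zero)
    qed
  next
    case (scale g z)
    show ?case
    proof
      fix v assume v: "v \<in> carrier L"
      have "te (BZf_class (to_fract [:g:] * z)) v = te (BZf_class z) (g \<odot>\<^bsub>L\<^esub> v)"
        using scale v te_move[of g "BZf_class z" v] by (simp add: BZf_class_smult)
      then show "proj (te (BZf_class (to_fract [:g:] * z)) v) \<in> ?I" using scale v by simp
    qed
  next
    case (add z w)
    show ?case
    proof
      fix v assume v: "v \<in> carrier L"
      have "proj (te (BZf_class (z + w)) v) = proj (te (BZf_class z) v) \<oplus>\<^bsub>Q\<^esub> proj (te (BZf_class w) v)"
        using add.hyps v by (simp only: BZf_class_add[symmetric] te_add_left BZf_class_closed additive_add[OF additive_proj] te_closed)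
      moreover have "proj (te (BZf_class z) v) \<oplus>\<^bsub>Q\<^esub> proj (te (BZf_class w) v) \<in> ?I"
        using add.IH v by (intro phi_image_add) blast+
      ultimately show "proj (te (BZf_class (z + w)) v) \<in> ?I" by (simp only:)
    qed
  next
    case (pole k)
    show ?case
    proof
      fix v assume v: "v \<in> carrier L"
      show "proj (te (BZf_class (tf1_inv (Suc k))) v) \<in> ?I"
      proof (cases k)
        case 0
        have "delta = to_fract f \<odot>\<^bsub>BZf f\<^esub> BZf_class (tf1_inv (Suc 0))"
          by (simp add: BZf_delta_conv delta0_conv BZf_class_smult)
        then have "te (BZf_class (tf1_inv (Suc 0))) v = te delta (inverse (to_fract f) \<odot>\<^bsub>L\<^esub> v)"
          using v LM.smult_assoc1[of "to_fract f" "inverse (to_fract f)" v] LM.smult_one[of v]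
          by (simp add: te_move)
        then have "proj (te (BZf_class (tf1_inv (Suc k))) v) = phi f M (inverse (to_fract f) \<odot>\<^bsub>L\<^esub> v)"
          by (simp only: phi_conv 0)
        then show ?thesis using v by (simp only:) (intro imageI LM.smult_closed inverse_f_Kxf)
      next
        case (Suc l)
        let ?c = "- (of_nat (Suc l) * to_fract f) :: ('n, 'k) mpoly fract"
        obtain s where s: "s \<in> carrier (Kxf f)" "of_nat (Suc l) * s = 1"
          using of_nat_unit_Kxf by blast
        \<comment> \<open>The inverse of the factor \<open>c = - (l + 1) f\<close> in \<open>\<partial>\<^sub>t (tf - 1)\<^bsup>-(l+1)\<^esup> = c (tf - 1)\<^bsup>-(l+2)\<^esup>\<close>.\<close>
        let ?i = "- (s * inverse (to_fract f))"
        have "?c * ?i = (of_nat (Suc l) * s) * (to_fract f * inverse (to_fract f))"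
          by (simp add: mult_ac del: of_nat_Suc)
        then have ci: "?c * ?i = 1" using s(2) by (simp del: of_nat_Suc)
        have c: "?c \<in> carrier (Kxf f)" and i: "?i \<in> carrier (Kxf f)"
          using Kxf_of_nat[of "Suc l"] s(1) by (simp_all del: of_nat_Suc)
        have "BZf_dt f (BZf_class (tf1_inv (Suc l))) = ?c \<odot>\<^bsub>BZf f\<^esub> BZf_class (tf1_inv (Suc k))"
          using c Suc by (simp add: BZf_class_dt xt_dt_tf1_inv BZf_class_smult del: of_nat_Suc)
        then have "dt (te (BZf_class (tf1_inv (Suc l))) (?i \<odot>\<^bsub>L\<^esub> v)) = te (BZf_class (tf1_inv (Suc k))) (?c \<odot>\<^bsub>L\<^esub> (?i \<odot>\<^bsub>L\<^esub> v))"
          using v c i by (simp add: te_dt te_move del: of_nat_Suc)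
        also have "?c \<odot>\<^bsub>L\<^esub> (?i \<odot>\<^bsub>L\<^esub> v) = v"
          using v c i ci LM.smult_assoc1[of ?c ?i v] LM.smult_one[of v] by (simp del: of_nat_Suc)
        finally have "te (BZf_class (tf1_inv (Suc k))) v = dt (te (BZf_class (tf1_inv (Suc l))) (?i \<odot>\<^bsub>L\<^esub> v))" ..
        then show ?thesis using v i
          by (simp only: proj_dt phi_image_zero te_closed BZf_class_closed tf1_inv_closed LM.smult_closed)
      qed
    qed
  qed
  then show ?thesis using assms unfolding carrier_BZf by blast
qed

lemma surj_phi: "phi f M ` carrier L = carrier Q"
proof
  show "phi f M ` carrier L \<subseteq> carrier Q" using phi_closed by blast
  have "proj x \<in> phi f M ` carrier L" if "x \<in> carrier T" for x
    using that
  proof (induction x rule: Mtilde_induct)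
    case (elt b v)
    then show ?case by (rule proj_te_eq_phi)
  next
    case (add x y)
    then show ?case unfolding additive_add[OF additive_proj add.hyps] by (intro phi_image_add)
  qed
  then show "carrier Q \<subseteq> phi f M ` carrier L" by (auto simp: carrier_quotient_module)
qed

lemma phi_iso: "left_module_iso (Weyl_loc f) (localized_module f M) (Mtilde_mod_dt f M) (phi f M)"
  unfolding left_module_iso_def
  using LM.left_module_weyl_loc left_module_Mtilde_mod_dt phi_hom inj_phi surj_phi
  by (simp add: localized_module_simps Mtilde_mod_dt_simps bij_betw_def)

end

theorem theorem2p13:
  fixes f :: "('n::{finite,linorder}, 'k::field_char_0) mpoly"
    and M :: "(('n, 'k) weyl, 'm) module"
  assumes "left_module Weyl M"
    and "f \<noteq> 0"
  shows "left_module_iso (Weyl_loc f) (localized_module f M) (Mtilde_mod_dt f M) (phi f M) \<and>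
    left_module_iso Weyl
      (restrict_scalars (weyl_to_loc f) (localized_module f M))
      (restrict_scalars (weyl_to_loc f) (Mtilde_mod_dt f M)) (phi f M)"
proof -
  interpret localized_weyl_module f M
    by (intro localized_weyl_module.intro localization.intro localized_weyl_module_axioms.intro assms)
  show ?thesis
    using phi_iso left_module_iso_restrict_scalars[OF phi_iso ring_Weyl weyl_to_loc_hom] by simp
qed

end
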